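(* Let $K$ be an element (tetrahedron) of $\mathcal T_h$, let $k\ge 0$ and $\kappa>0$, and let $C>0$ be a constant, depending only on the shape-regularity of the grid, such that $\|\mathbf v\|_K\le C h_K\|\boldsymbol\varepsilon(\mathbf v)\|_K$ for all $\mathbf v\in H^1(K;\mathbb C^3)$ satisfying $\langle\mathbf v,\boldsymbol\mu\rangle_{\partial K}=0$ for all $\boldsymbol\mu\in\prod_{F\in\mathcal E(K)}\mathcal P_0(F;\mathbb C^3)$. If $$\kappa\,h_K<\frac{1}{C\,\|c_{\mathcal A}\|_{L^\infty(K)}^{1/2}\,\|\rho\|_{L^\infty(K)}^{1/2}},$$ then the local solver associated to $K$ is well defined; that is, if $(\boldsymbol\sigma,\mathbf u)\in\mathcal P_k(K;\mathbb C^{3\times3}_{\rm sym})\times\mathcal P_{k+1}(K;\mathbb C^3)$ satisfies $$\imath\kappa(\mathcal A\boldsymbol\sigma,\boldsymbol\xi)_K-(\mathbf u,\nabla\cdot\boldsymbol\xi)_K=0\qquad\forall\boldsymbol\xi\in\mathcal P_k(K;\mathbb C^{3\times3}_{\rm sym}),$$ $$(\nabla\cdot\boldsymbol\sigma,\mathbf w)_K+\langle\boldsymbol\tau_K\mathbf P_M\mathbf u,\mathbf w\rangle_{\partial K}+\imath\kappa(\rho\mathbf u,\mathbf w)_K=0\qquad\forall\mathbf w\in\mathcal P_{k+1}(K;\mathbb C^3),$$ then $(\boldsymbol\sigma,\mathbf u)=(\mathbf 0,\mathbf 0)$.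
   Context: All brackets are bilinear (no conjugation): $(\mathbf u,\mathbf v)_K=\int_K\mathbf u\cdot\mathbf v$, $(\boldsymbol\xi,\boldsymbol\chi)_K=\int_K\boldsymbol\xi:\boldsymbol\chi$ with $\boldsymbol\xi:\boldsymbol\chi=\mathrm{trace}(\boldsymbol\chi^\top\boldsymbol\xi)$, $\langle\mathbf u,\mathbf v\rangle_{\partial K}=\int_{\partial K}\mathbf u\cdot\mathbf v$; $\|\cdot\|_K$, $\|\cdot\|_{\partial K}$ are $L^2$ norms. $\imath=\sqrt{-1}$. $\mathbb C^{3\times3}_{\rm sym}$ is the space of complex symmetric (not Hermitian) matrices. Divergence acts on rows; $\boldsymbol\varepsilon(\mathbf v)=\frac12(\nabla\mathbf v+(\nabla\mathbf v)^\top)$. $\mathcal T_h$ is a shape-regular conforming tetrahedrization of a Lipschitz polyhedron $\Omega\subset\mathbb R^3$; $h_K$ is the diameter of $K$ and $\mathcal E(K)$ its set of faces. For a.e. $\mathbf x\in\Omega$, $\mathcal C(\mathbf x)$ is a linear operator on $\mathbb R^{3\times3}_{\rm sym}$, symmetric with respect to $:$, with $(\mathcal C(\mathbf x)\boldsymbol\xi):\boldsymbol\xi\ge C_0\,\boldsymbol\xi:\boldsymbol\xi$ for some $C_0>0$, and with $L^\infty(\Omega)$ components; $\mathcal A(\mathbf x)=\mathcal C(\mathbf x)^{-1}$, extended complex-linearly. $c_{\mathcal A}$ is the positive bounded function given by the maximum spectral value of $\mathcal A$, so that for a.e. $\mathbf x$, $(\mathcal A(\mathbf x)\boldsymbol\xi):\boldsymbol\xi\le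 c_{\mathcal A}(\mathbf x)\,\boldsymbol\xi:\boldsymbol\xi$ for all $\boldsymbol\xi\in\mathbb R^{3\times3}_{\rm sym}$. $\rho:\Omega\to\mathbb R$ is bounded, and bounded below by a positive constant. $\mathbf P_M$ is the $L^2(\partial K)$-orthogonal projection onto $\prod_{F\in\mathcal E(K)}\mathcal P_k(F;\mathbb C^3)$. The stabilization $\boldsymbol\tau_K:\partial K\to\mathbb R^{3\times3}_{\rm sym}$ is constant on each face of $K$ and satisfies, with positive constants $c_\tau,c_\tau'$, $c_\tau h_K^{-1}\|\boldsymbol\mu\|_{\partial K}^2\le\langle\boldsymbol\tau_K\boldsymbol\mu,\overline{\boldsymbol\mu}\rangle_{\partial K}\le c'_\tau h_K^{-1}\|\boldsymbol\mu\|^2_{\partial K}$ for all $\boldsymbol\mu\in L^2(\partial K;\mathbb C^3)$. *)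

theory Defs
  imports "HOL-Analysis.Analysis" "HOL-Analysis.Cross3" "HOL-Probability.Essential_Supremum"
begin

section \<open>Complex vectors and matrices\<close>

definition bdot :: "complex^3 \<Rightarrow> complex^3 \<Rightarrow> complex" where
  "bdot u v = (\<Sum>i\<in>UNIV. u $ i * v $ i)"

definition ddot :: "'a::comm_semiring_1^3^3 \<Rightarrow> 'a^3^3 \<Rightarrow> 'a" where
  "ddot \<xi> \<zeta> = trace (transpose \<zeta> ** \<xi>)"

definition conj_vec :: "complex^3 \<Rightarrow> complex^3" where
  "conj_vec v = (\<chi> i. cnj (v $ i))"

definition sym_mat :: "('a^3^3) set" where
  "sym_mat = {\<xi>. transpose \<xi> = \<xi>}"

definition sym_part :: "complex^3^3 \<Rightarrow> complex^3^3" where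
  "sym_part G = (1/2) *\<^sub>R (G + transpose G)"


section \<open>Classical derivatives and smooth functions\<close>

definition pd :: "3 \<Rightarrow> (real^3 \<Rightarrow> 'b::real_normed_vector) \<Rightarrow> real^3 \<Rightarrow> 'b" where
  "pd j f x = frechet_derivative f (at x) (axis j 1)"

definition grad :: "(real^3 \<Rightarrow> complex^3) \<Rightarrow> real^3 \<Rightarrow> complex^3^3" where
  "grad v x = (\<chi> i j. pd j v x $ i)"

definition row_div :: "(real^3 \<Rightarrow> complex^3^3) \<Rightarrow> real^3 \<Rightarrow> complex^3" where
  "row_div \<xi> x = (\<chi> i. \<Sum>j\<in>UNIV. pd j \<xi> x $ i $ j)"

primrec C_diff :: "nat \<Rightarrow> (real^3 \<Rightarrow> 'b::real_normed_vector) \<Rightarrow> bool" where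
  "C_diff 0 f \<longleftrightarrow> continuous_on UNIV f"
| "C_diff (Suc n) f \<longleftrightarrow> (\<forall>x. f differentiable (at x)) \<and> (\<forall>j. C_diff n (pd j f))"

definition smooth :: "(real^3 \<Rightarrow> 'b::real_normed_vector) \<Rightarrow> bool" where
  "smooth f \<longleftrightarrow> (\<forall>n. C_diff n f)"


section \<open>Polynomial spaces\<close>

text \<open>The space of functions on \<open>S\<close> that are restrictions of polynomials of total degree at most
  \<open>k\<close> in the three Cartesian coordinates, with coefficients in \<open>V\<close>; multi-indices are functions
  from the index type \<open>3\<close> to the naturals. Values outside \<open>S\<close> are irrelevant. For a planar face
  this is the same as using polynomials in two coordinates of the plane.\<close>

definition poly_on :: "nat \<Rightarrow> (real^3) set \<Rightarrow> 'b::real_vector set \<Rightarrow> (real^3 \<Rightarrow> 'b) set" where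
  "poly_on k S V = {f. \<exists>c :: (3 \<Rightarrow> nat) \<Rightarrow> 'b. (\<forall>\<alpha>. c \<alpha> \<in> V) \<and>
     (\<forall>x\<in>S. f x = (\<Sum>\<alpha> | (\<Sum>i\<in>UNIV. \<alpha> i) \<le> k. (\<Prod>i\<in>UNIV. (x $ i) ^ \<alpha> i) *\<^sub>R c \<alpha>))}"


section \<open>Square integrable functions\<close>

definition L2 :: "'a measure \<Rightarrow> ('a \<Rightarrow> 'b::euclidean_space) \<Rightarrow> bool" where
  "L2 M f \<longleftrightarrow> f \<in> borel_measurable M \<and> integrable M (\<lambda>x. (norm (f x))\<^sup>2)"

definition L2_norm_on :: "(real^3) set \<Rightarrow> (real^3 \<Rightarrow> 'b::euclidean_space) \<Rightarrow> real" where
  "L2_norm_on S f = sqrt (LINT x|lebesgue_on S. (norm (f x))\<^sup>2)"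

text \<open>The brackets on \<open>K\<close>. If \<open>f\<close> is only given on \<open>K\<close>, then the classical derivatives of \<open>f\<close> are
  determined in the interior of \<open>K\<close>, that is, almost everywhere in \<open>K\<close>.\<close>

definition ipv :: "(real^3) set \<Rightarrow> (real^3 \<Rightarrow> complex^3) \<Rightarrow> (real^3 \<Rightarrow> complex^3) \<Rightarrow> complex" where
  "ipv K u v = (LINT x|lebesgue_on K. bdot (u x) (v x))"

definition ipm :: "(real^3) set \<Rightarrow> (real^3 \<Rightarrow> complex^3^3) \<Rightarrow> (real^3 \<Rightarrow> complex^3^3) \<Rightarrow> complex" where
  "ipm K \<xi> \<zeta> = (LINT x|lebesgue_on K. ddot (\<xi> x) (\<zeta> x))"

text \<open>Meaningful for measurable, essentially bounded functions only (\<open>real_of_ereal\<close> sends \<open>\<infinity>\<close> to 0).\<close>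

definition Linf_norm_on :: "(real^3) set \<Rightarrow> (real^3 \<Rightarrow> real) \<Rightarrow> real" where
  "Linf_norm_on S f = real_of_ereal (esssup (lebesgue_on S) (\<lambda>x. ereal \<bar>f x\<bar>))"


section \<open>The boundary of a tetrahedron\<close>

text \<open>Surface measure of the triangle with vertices \<open>a\<close>, \<open>b\<close>, \<open>c\<close>, via the parametrization
  \<open>(s, t) \<mapsto> a + s (b - a) + t (c - a)\<close> of the triangle over the unit simplex, whose area element
  is the norm of \<open>(b - a) \<times> (c - a)\<close>. The measure is completed so that the values of functions
  on null sets (such as the edges) do not affect measurability. It does not depend on the
  numbering of the vertices, so the choice in \<open>surface_measure\<close> is harmless.\<close>

definition triangle_measure :: "real^3 \<Rightarrow> real^3 \<Rightarrow> real^3 \<Rightarrow> (real^3) measure" where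
  "triangle_measure a b c = completion (distr
     (density lborel (\<lambda>p :: real \<times> real.
        ennreal (norm (cross3 (b - a) (c - a))) * indicator {(s, t). 0 \<le> s \<and> 0 \<le> t \<and> s + t \<le> 1} p))
     borel (\<lambda>(s, t). a + s *\<^sub>R (b - a) + t *\<^sub>R (c - a)))"

definition surface_measure :: "(real^3) set \<Rightarrow> (real^3) measure" where
  "surface_measure F = (SOME M. \<exists>a b c. F = convex hull {a, b, c} \<and> M = triangle_measure a b c)"

definition L2_bd :: "(real^3) set \<Rightarrow> (real^3 \<Rightarrow> complex^3) \<Rightarrow> bool" where
  "L2_bd K \<mu> \<longleftrightarrow> (\<forall>F. F facet_of K \<longrightarrow> L2 (surface_measure F) \<mu>)"

definition ip_bd :: "(real^3) set \<Rightarrow> (real^3 \<Rightarrow> complex^3) \<Rightarrow> (real^3 \<Rightarrow> complex^3) \<Rightarrow> complex" where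
  "ip_bd K u v = (\<Sum>F | F facet_of K. LINT x|surface_measure F. bdot (u x) (v x))"

definition L2_norm_bd :: "(real^3) set \<Rightarrow> (real^3 \<Rightarrow> complex^3) \<Rightarrow> real" where
  "L2_norm_bd K \<mu> = sqrt (\<Sum>F | F facet_of K. LINT x|surface_measure F. (norm (\<mu> x))\<^sup>2)"

text \<open>The product over the faces \<open>F\<close> of \<open>K\<close> of the polynomial spaces on \<open>F\<close>, as a space of functions
  on the boundary defined up to null sets.\<close>

definition face_poly :: "nat \<Rightarrow> (real^3) set \<Rightarrow> (real^3 \<Rightarrow> complex^3) set" where
  "face_poly k K = {\<mu>. \<forall>F. F facet_of K \<longrightarrow>
     (\<exists>p\<in>poly_on k F UNIV. AE x in surface_measure F. x \<in> F \<longrightarrow> \<mu> x = p x)}"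

text \<open>The orthogonal projection onto \<open>face_poly k K\<close>, unique up to null sets.\<close>

definition proj_M :: "nat \<Rightarrow> (real^3) set \<Rightarrow> (real^3 \<Rightarrow> complex^3) \<Rightarrow> real^3 \<Rightarrow> complex^3" where
  "proj_M k K u = (SOME g. g \<in> face_poly k K \<and>
     (\<forall>\<mu>\<in>face_poly k K. ip_bd K (\<lambda>x. u x - g x) (\<lambda>x. conj_vec (\<mu> x)) = 0))"

definition mat_app :: "(real^3 \<Rightarrow> real^3^3) \<Rightarrow> (real^3 \<Rightarrow> complex^3) \<Rightarrow> real^3 \<Rightarrow> complex^3" where
  "mat_app \<tau> \<mu> x = map_matrix complex_of_real (\<tau> x) *v \<mu> x"

text \<open>The pairing bounded from below and above is real, because \<open>\<tau>\<close> is real and symmetric.\<close>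

definition stabilization :: "(real^3) set \<Rightarrow> (real^3 \<Rightarrow> real^3^3) \<Rightarrow> real \<Rightarrow> real \<Rightarrow> bool" where
  "stabilization K \<tau> c\<^sub>\<tau> c\<^sub>\<tau>' \<longleftrightarrow>
     (\<forall>F. F facet_of K \<longrightarrow> (\<exists>T\<in>sym_mat. AE x in surface_measure F. x \<in> F \<longrightarrow> \<tau> x = T)) \<and>
     (\<forall>\<mu>. L2_bd K \<mu> \<longrightarrow>
        c\<^sub>\<tau> * inverse (diameter K) * (L2_norm_bd K \<mu>)\<^sup>2
          \<le> Re (ip_bd K (mat_app \<tau> \<mu>) (\<lambda>x. conj_vec (\<mu> x))) \<and>
        Re (ip_bd K (mat_app \<tau> \<mu>) (\<lambda>x. conj_vec (\<mu> x)))
          \<le> c\<^sub>\<tau>' * inverse (diameter K) * (L2_norm_bd K \<mu>)\<^sup>2)"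


section \<open>The Sobolev space on a tetrahedron and its traces\<close>

text \<open>\<open>H1 K v G\<close>: \<open>v\<close> belongs to \<open>H\<^sup>1\<close> of the interior of \<open>K\<close>, with distributional gradient \<open>G\<close>
  (\<open>G\<^sub>i\<^sub>j\<close> is the derivative of \<open>v\<^sub>i\<close> in direction \<open>j\<close>).\<close>

definition H1 :: "(real^3) set \<Rightarrow> (real^3 \<Rightarrow> complex^3) \<Rightarrow> (real^3 \<Rightarrow> complex^3^3) \<Rightarrow> bool" where
  "H1 K v G \<longleftrightarrow> L2 (lebesgue_on K) v \<and> L2 (lebesgue_on K) G \<and>
     (\<forall>\<phi> :: real^3 \<Rightarrow> real. smooth \<phi> \<longrightarrow> compact (closure {x. \<phi> x \<noteq> 0}) \<longrightarrow>
        closure {x. \<phi> x \<noteq> 0} \<subseteq> interior K \<longrightarrow>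
        (\<forall>i j. (LINT x|lebesgue_on K. pd j \<phi> x *\<^sub>R (v x $ i))
             = - (LINT x|lebesgue_on K. \<phi> x *\<^sub>R (G x $ i $ j))))"

text \<open>\<open>g\<close> is the trace on the boundary of \<open>K\<close> of the \<open>H\<^sup>1\<close> function \<open>v\<close> with gradient \<open>G\<close>: the trace
  operator is the continuous extension of the restriction to the boundary from smooth functions.\<close>

definition H1_trace ::
    "(real^3) set \<Rightarrow> (real^3 \<Rightarrow> complex^3) \<Rightarrow> (real^3 \<Rightarrow> complex^3^3) \<Rightarrow> (real^3 \<Rightarrow> complex^3) \<Rightarrow> bool" where
  "H1_trace K v G g \<longleftrightarrow> L2_bd K g \<and>
     (\<exists>w :: nat \<Rightarrow> real^3 \<Rightarrow> complex^3. (\<forall>n. smooth (w n)) \<and>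
        (\<lambda>n. L2_norm_on K (\<lambda>x. w n x - v x)) \<longlonglongrightarrow> 0 \<and>
        (\<lambda>n. L2_norm_on K (\<lambda>x. grad (w n) x - G x)) \<longlonglongrightarrow> 0 \<and>
        (\<lambda>n. L2_norm_bd K (\<lambda>x. w n x - g x)) \<longlonglongrightarrow> 0)"


section \<open>Domain and grid\<close>

text \<open>Near each of its boundary points, and in suitable orthonormal coordinates, \<open>\<Omega>\<close> is the strict
  hypograph of a Lipschitz function.\<close>

definition lipschitz_boundary :: "(real^3) set \<Rightarrow> bool" where
  "lipschitz_boundary \<Omega> \<longleftrightarrow> (\<forall>x\<in>frontier \<Omega>. \<exists>(T :: real^3 \<Rightarrow> real^3) (\<phi> :: real \<times> real \<Rightarrow> real) L r.
     orthogonal_transformation T \<and> L-lipschitz_on UNIV \<phi> \<and> 0 < r \<and>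
     (\<forall>y\<in>ball x r. y \<in> \<Omega> \<longleftrightarrow> T y $ 3 < \<phi> (T y $ 1, T y $ 2)))"

definition lipschitz_polyhedron :: "(real^3) set \<Rightarrow> bool" where
  "lipschitz_polyhedron \<Omega> \<longleftrightarrow> open \<Omega> \<and> bounded \<Omega> \<and> lipschitz_boundary \<Omega> \<and>
     (\<exists>\<P>. finite \<P> \<and> (\<forall>P\<in>\<P>. polytope P) \<and> closure \<Omega> = \<Union>\<P>)"

definition tetrahedrization :: "(real^3) set \<Rightarrow> (real^3) set set \<Rightarrow> bool" where
  "tetrahedrization \<Omega> \<T> \<longleftrightarrow> triangulation \<T> \<and> (\<forall>K\<in>\<T>. 3 simplex K) \<and> \<Union>\<T> = closure \<Omega>"

definition inradius :: "(real^3) set \<Rightarrow> real" where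
  "inradius K = Sup {r. \<exists>x. cball x r \<subseteq> K}"

definition shape_regular :: "real \<Rightarrow> (real^3) set set \<Rightarrow> bool" where
  "shape_regular \<gamma> \<T> \<longleftrightarrow> (\<forall>K\<in>\<T>. diameter K \<le> \<gamma> * inradius K)"


section \<open>Material coefficients\<close>

text \<open>A field \<open>\<C>\<close> of linear operators on real symmetric matrices. Its components are the functions
  \<open>(\<C> \<xi>) : \<zeta>\<close> for \<open>\<xi>\<close>, \<open>\<zeta>\<close> symmetric. Values on non-symmetric matrices are irrelevant.\<close>

definition elasticity_field :: "(real^3) set \<Rightarrow> (real^3 \<Rightarrow> real^3^3 \<Rightarrow> real^3^3) \<Rightarrow> bool" where
  "elasticity_field \<Omega> \<C> \<longleftrightarrow>
     (AE x in lebesgue_on \<Omega>.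
        (\<forall>\<xi>\<in>sym_mat. \<C> x \<xi> \<in> sym_mat) \<and>
        (\<forall>\<xi>\<in>sym_mat. \<forall>\<zeta>\<in>sym_mat. \<forall>a b. \<C> x (a *\<^sub>R \<xi> + b *\<^sub>R \<zeta>) = a *\<^sub>R \<C> x \<xi> + b *\<^sub>R \<C> x \<zeta>) \<and>
        (\<forall>\<xi>\<in>sym_mat. \<forall>\<zeta>\<in>sym_mat. ddot (\<C> x \<xi>) \<zeta> = ddot \<xi> (\<C> x \<zeta>))) \<and>
     (\<exists>C\<^sub>0>0. AE x in lebesgue_on \<Omega>. \<forall>\<xi>\<in>sym_mat. ddot (\<C> x \<xi>) \<xi> \<ge> C\<^sub>0 * ddot \<xi> \<xi>) \<and>
     (\<forall>\<xi>\<in>sym_mat. \<forall>\<zeta>\<in>sym_mat. (\<lambda>x. ddot (\<C> x \<xi>) \<zeta>) \<in> borel_measurable (lebesgue_on \<Omega>) \<and>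
        (\<exists>B. AE x in lebesgue_on \<Omega>. \<bar>ddot (\<C> x \<xi>) \<zeta>\<bar> \<le> B))"

definition compliance :: "(real^3 \<Rightarrow> real^3^3 \<Rightarrow> real^3^3) \<Rightarrow> real^3 \<Rightarrow> real^3^3 \<Rightarrow> real^3^3" where
  "compliance \<C> x = inv_into sym_mat (\<C> x)"

definition complex_ext :: "(real^3^3 \<Rightarrow> real^3^3) \<Rightarrow> complex^3^3 \<Rightarrow> complex^3^3" where
  "complex_ext A \<xi> = (\<chi> i j. Complex (A (map_matrix Re \<xi>) $ i $ j) (A (map_matrix Im \<xi>) $ i $ j))"

text \<open>The largest eigenvalue of the compliance operator.\<close>

definition c_A :: "(real^3 \<Rightarrow> real^3^3 \<Rightarrow> real^3^3) \<Rightarrow> real^3 \<Rightarrow> real" where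
  "c_A \<C> x = (GREATEST l. \<exists>\<xi>\<in>sym_mat. \<xi> \<noteq> 0 \<and> compliance \<C> x \<xi> = l *\<^sub>R \<xi>)"

definition density_field :: "(real^3) set \<Rightarrow> (real^3 \<Rightarrow> real) \<Rightarrow> bool" where
  "density_field \<Omega> \<rho> \<longleftrightarrow> \<rho> \<in> borel_measurable (lebesgue_on \<Omega>) \<and>
     (\<exists>B. AE x in lebesgue_on \<Omega>. \<bar>\<rho> x\<bar> \<le> B) \<and> (\<exists>b>0. AE x in lebesgue_on \<Omega>. b \<le> \<rho> x)"

end

theory Submission
  imports Defs
begin

text \<open>The proof is an energy argument on the single element \<open>K\<close> of diameter \<open>h\<close>. Test the first
  equation with \<open>cnj \<sigma>\<close> and the second with \<open>cnj u\<close>, and add the conjugate of the first to the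
  second. The divergence terms cancel, and what remains is
  \<open>\<langle>\<tau> P u, cnj (P u)\<rangle> + \<i> \<kappa> ((\<rho> u, cnj u) - (A \<sigma>, cnj \<sigma>)) = 0\<close>,
  where \<open>P\<close> is the projection onto the face polynomials; it may be applied to the test function as
  well because \<open>\<tau>\<close> is constant on each face (\<open>ip_bd_stabilization_proj_M\<close>). Both volume terms are
  real, so the real part says that \<open>P u = 0\<close>, by positivity of the stabilization, and then
  \<open>(A \<sigma>, cnj \<sigma>) = (\<rho> u, cnj u)\<close>.

  Now integrate the first equation by parts (\<open>green_formula\<close>). The boundary term pairs \<open>u\<close> with the
  normal component of the test stress, which is a face polynomial of degree \<open>k\<close>, so it vanishes and
  \<open>\<i> \<kappa> (A \<sigma>, \<xi>) = - (\<epsilon>(u), \<xi>)\<close> for all \<open>\<xi>\<close>. For \<open>\<xi> = cnj (\<epsilon>(u))\<close>, positivity of the form of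
  \<open>A\<close> (\<open>form_cross_estimate\<close>) gives
  \<open>\<parallel>\<epsilon>(u)\<parallel>\<^sup>2 \<le> \<kappa>\<^sup>2 \<parallel>c_A\<parallel> (A \<sigma>, cnj \<sigma>) = \<kappa>\<^sup>2 \<parallel>c_A\<parallel> (\<rho> u, cnj u) \<le> \<kappa>\<^sup>2 \<parallel>c_A\<parallel> \<parallel>\<rho>\<parallel> \<parallel>u\<parallel>\<^sup>2\<close>.
  Since \<open>P u = 0\<close>, the mean of \<open>u\<close> on each face is zero and the Korn inequality applies:
  \<open>\<parallel>u\<parallel> \<le> C h \<parallel>\<epsilon>(u)\<parallel>\<close>. Together, \<open>\<parallel>u\<parallel> \<le> q \<parallel>u\<parallel>\<close> with \<open>q < 1\<close> by the smallness of \<open>\<kappa> h\<close>. Hence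
  \<open>u = 0\<close>, then \<open>(A \<sigma>, cnj \<sigma>) = 0\<close>, and \<open>\<sigma> = 0\<close>. This is \<open>local_solver_unique\<close>.

  The argument rests on four facts of analysis. Integration by parts needs the divergence theorem
  with the given surface measures (\<open>divergence_theorem_tetrahedron\<close>), proved by the fundamental
  theorem of calculus along the edges at a vertex. The projection is defined by a choice, and its
  characterization becomes available by the Gram--Schmidt process (\<open>face_projection_exists\<close>). The
  compliance must be measurable for its form to be integrable; only the components of the stiffness
  are given as measurable, and the quadratic form of the inverse is recovered from them as a
  countable supremum (\<open>measurable_compliance_quadratic\<close>). Finally, the coefficients are given
  almost everywhere on the domain, and the element is contained in it up to a null set because the
  domain has a Lipschitz boundary (\<open>interior_closure_lipschitz\<close>).\<close>

section \<open>Integrals over triangles\<close>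

abbreviation unit_triangle :: "(real \<times> real) set" where
  "unit_triangle \<equiv> {(s, t). 0 \<le> s \<and> 0 \<le> t \<and> s + t \<le> 1}"

lemma unit_triangle_borel [measurable]: "unit_triangle \<in> sets borel"
proof -
  have "closed {p :: real \<times> real. 0 \<le> fst p \<and> 0 \<le> snd p \<and> fst p + snd p \<le> 1}"
    by (intro closed_Collect_conj closed_Collect_le continuous_intros)
  then show ?thesis
    by (simp add: case_prod_unfold borel_closed)
qed

lemma compact_unit_triangle: "compact unit_triangle"
proof -
  have "closed {p :: real \<times> real. 0 \<le> fst p \<and> 0 \<le> snd p \<and> fst p + snd p \<le> 1}"
    by (intro closed_Collect_conj closed_Collect_le continuous_intros)
  moreover have "{p :: real \<times> real. 0 \<le> fst p \<and> 0 \<le> snd p \<and> fst p + snd p \<le> 1} \<subseteq> cbox (0,0) (1,1)"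
    by (auto simp: cbox_Pair_eq mem_box)
  ultimately show ?thesis
    by (metis (no_types, lifting) Collect_cong bounded_cbox bounded_subset case_prod_unfold compact_eq_bounded_closed)
qed

lemma distr_swap_lborel: "distr lborel borel (\<lambda>(s, t). (t, s)) = (lborel :: (real \<times> real) measure)"
proof -
  have "distr (lborel \<Otimes>\<^sub>M lborel) (lborel \<Otimes>\<^sub>M lborel) (\<lambda>(s, t). (t, s)) = (lborel \<Otimes>\<^sub>M (lborel :: real measure) :: (real \<times> real) measure)"
    by (rule lborel_pair.distr_pair_swap[symmetric])
  then show ?thesis
    by (metis (no_types, lifting) distr_cong lborel_prod sets_lborel)
qed

lemma distr_reflect_lborel:
  "distr lborel borel (\<lambda>(s, t). (1 - s - t, t)) = (lborel :: (real \<times> real) measure)"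
proof (rule measure_eqI)
  fix A :: "(real \<times> real) set"
  assume "A \<in> sets (distr lborel borel (\<lambda>(s, t). (1 - s - t, t)))"
  then have A[measurable]: "A \<in> sets borel" by simp
  have A2[measurable]: "A \<in> sets (borel \<Otimes>\<^sub>M borel)"
    using A by (metis borel_prod)
  have "emeasure (distr lborel borel (\<lambda>(s, t). (1 - s - t, t))) A
      = (\<integral>\<^sup>+p. indicator A p \<partial>distr lborel borel (\<lambda>(s, t). (1 - s - t, t)))"
    by simp
  also have "\<dots> = (\<integral>\<^sup>+p. indicator A (case p of (s, t) \<Rightarrow> (1 - s - t, t)) \<partial>lborel)"
    by (subst nn_integral_distr) (auto simp: borel_prod[symmetric])
  also have "\<dots> = (\<integral>\<^sup>+t. \<integral>\<^sup>+s. indicator A (1 - s - t, t) \<partial>lborel \<partial>lborel)"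
    by (subst lborel_prod[symmetric], subst lborel_pair.nn_integral_snd[symmetric])
      (auto simp: borel_prod[symmetric])
  also have "\<dots> = (\<integral>\<^sup>+t. \<integral>\<^sup>+s. indicator A (s, t) \<partial>lborel \<partial>lborel)"
  proof (rule nn_integral_cong)
    fix t :: real
    show "(\<integral>\<^sup>+s. indicator A (1 - s - t, t) \<partial>lborel) = (\<integral>\<^sup>+s. indicator A (s, t) \<partial>lborel)"
      by (subst nn_integral_real_affine[where c="-1" and t="1 - t"]) (auto simp: algebra_simps)
  qed
  also have "\<dots> = (\<integral>\<^sup>+p. indicator A p \<partial>(lborel \<Otimes>\<^sub>M lborel))"
    using lborel_pair.nn_integral_snd[of "indicator A"] by simp
  also have "\<dots> = (\<integral>\<^sup>+p. indicator A p \<partial>lborel)"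
    by (simp only: lborel_prod)
  finally show "emeasure (distr lborel borel (\<lambda>(s, t). (1 - s - t, t))) A = emeasure lborel A"
    by simp
qed simp

text \<open>Renumbering the vertices changes the parametrization by an affine map of the unit triangle
  onto itself, which preserves area. The two maps above correspond to transpositions of
  neighbouring vertices, and these generate all permutations.\<close>

lemma triangle_measure_reparam:
  fixes T :: "real \<times> real \<Rightarrow> real \<times> real"
  assumes distr_T: "distr lborel borel T = lborel" and [measurable]: "T \<in> borel_measurable borel"
    and tri: "\<And>p. T p \<in> unit_triangle \<longleftrightarrow> p \<in> unit_triangle"
    and area: "norm (cross3 (b' - a') (c' - a')) = norm (cross3 (b - a) (c - a))"
    and param: "\<And>p. (case T p of (s, t) \<Rightarrow> a + s *\<^sub>R (b - a) + t *\<^sub>R (c - a))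
      = (case p of (s, t) \<Rightarrow> a' + s *\<^sub>R (b' - a') + t *\<^sub>R (c' - a'))"
  shows "triangle_measure a' b' c' = triangle_measure a b c"
proof -
  let ?w = "\<lambda>p. ennreal (norm (cross3 (b - a) (c - a))) * indicator unit_triangle p"
  let ?g = "\<lambda>(s, t). a + s *\<^sub>R (b - a) + t *\<^sub>R (c - a)"
  have g[measurable]: "?g \<in> borel_measurable borel"
    by (intro borel_measurable_continuous_onI) (auto simp: case_prod_unfold intro!: continuous_intros)
  have "density lborel ?w = density (distr lborel borel T) ?w"
    by (simp add: distr_T)
  also have "\<dots> = distr (density lborel (\<lambda>p. ?w (T p))) borel T"
    by (rule density_distr) auto
  also have "(\<lambda>p. ?w (T p)) = ?w"
    by (simp only: indicator_def tri)
  finally have "distr (density lborel ?w) borel ?g = distr (distr (density lborel ?w) borel T) borel ?g"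
    by (rule arg_cong[where f="\<lambda>M. distr M borel ?g"])
  also have "\<dots> = distr (density lborel ?w) borel (?g \<circ> T)"
    by (rule distr_distr) auto
  also have "?g \<circ> T = (\<lambda>(s, t). a' + s *\<^sub>R (b' - a') + t *\<^sub>R (c' - a'))"
    using param by (auto simp: fun_eq_iff)
  finally show ?thesis
    by (simp add: triangle_measure_def area)
qed

lemma triangle_measure_swap_last: "triangle_measure a c b = triangle_measure a b c"
proof (rule triangle_measure_reparam[OF distr_swap_lborel])
  show "(\<lambda>(s, t). (t, s)) \<in> borel_measurable (borel :: (real \<times> real) measure)"
    by (intro borel_measurable_continuous_onI) (auto simp: case_prod_unfold intro!: continuous_intros)
  show "norm (cross3 (c - a) (b - a)) = norm (cross3 (b - a) (c - a))"
    by (subst cross_skew) simp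
qed (auto split: prod.splits)

lemma triangle_measure_swap_first: "triangle_measure b a c = triangle_measure a b c"
proof (rule triangle_measure_reparam[OF distr_reflect_lborel])
  show "(\<lambda>(s, t). (1 - s - t, t)) \<in> borel_measurable (borel :: (real \<times> real) measure)"
    by (intro borel_measurable_continuous_onI) (auto simp: case_prod_unfold intro!: continuous_intros)
  have "cross3 (a - b) (c - b) = - cross3 (b - a) (c - a)"
    by (simp add: cross3_simps)
  then show "norm (cross3 (a - b) (c - b)) = norm (cross3 (b - a) (c - a))"
    by simp
qed (auto simp: scaleR_diff_left scaleR_diff_right algebra_simps)

lemma triangle_measure_permute:
  assumes "{a', b', c'} = {a, b, c}" "card {a, b, c} = 3"
  shows "triangle_measure a' b' c' = triangle_measure a b c"
proof -
  have "a \<noteq> b" "b \<noteq> c" "a \<noteq> c"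
    using assms(2) by (auto simp: card_insert_if split: if_splits)
  then consider "a' = a" "b' = b" "c' = c" | "a' = a" "b' = c" "c' = b" | "a' = b" "b' = a" "c' = c"
    | "a' = b" "b' = c" "c' = a" | "a' = c" "b' = a" "c' = b" | "a' = c" "b' = b" "c' = a"
    using assms(1) by (smt (verit) insertE insertI1 insert_commute singletonD)
  then show ?thesis
    by cases (metis triangle_measure_swap_first triangle_measure_swap_last)+
qed

text \<open>The vertices of a nondegenerate triangle are its extreme points, so that the choice made in
  the definition of the surface measure concerns only their order.\<close>

lemma surface_measure_triangle:
  assumes indep: "\<not> affine_dependent {a, b, c}" and card: "card {a, b, c} = 3"
  shows "surface_measure (convex hull {a, b, c}) = triangle_measure a b c"
  unfolding surface_measure_def
proof (rule some_equality)
  show "\<exists>a' b' c'. convex hull {a, b, c} = convex hull {a', b', c'}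
      \<and> triangle_measure a b c = triangle_measure a' b' c'"
    by blast
next
  fix M
  assume "\<exists>a' b' c'. convex hull {a, b, c} = convex hull {a', b', c'} \<and> M = triangle_measure a' b' c'"
  then obtain a' b' c' where hull: "convex hull {a, b, c} = convex hull {a', b', c'}"
    and M: "M = triangle_measure a' b' c'" by blast
  have "{a, b, c} \<subseteq> {a', b', c'}"
  proof
    fix x
    assume "x \<in> {a, b, c}"
    then have "x extreme_point_of (convex hull {a', b', c'})"
      unfolding hull[symmetric] extreme_point_of_convex_hull_affine_independent[OF indep] .
    then show "x \<in> {a', b', c'}"
      by (rule extreme_point_of_convex_hull)
  qed
  moreover have "card {a', b', c'} \<le> 3"
    by (simp add: card_insert_if)
  ultimately have "{a, b, c} = {a', b', c'}"
    using card by (intro card_seteq) simp_all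
  then show "M = triangle_measure a b c"
    using triangle_measure_permute[of a' b' c' a b c] card M by metis
qed

lemma measurable_triangle_param:
  "(\<lambda>(s, t). a + s *\<^sub>R (b - a) + t *\<^sub>R (c - a)) \<in> borel_measurable (borel :: (real \<times> real) measure)"
  for a b c :: "real^3"
  by (intro borel_measurable_continuous_onI) (auto simp: case_prod_unfold intro!: continuous_intros)

lemma space_triangle_measure [simp]: "space (triangle_measure a b c) = UNIV"
  by (simp add: triangle_measure_def)

lemma borel_measurable_triangle_measureI:
  "f \<in> borel_measurable borel \<Longrightarrow> f \<in> borel_measurable (triangle_measure a b c)"
  unfolding triangle_measure_def by (intro measurable_completion) auto

lemma triangle_param_in_hull:
  assumes "p \<in> unit_triangle"
  shows "(case p of (s, t) \<Rightarrow> a + s *\<^sub>R (b - a) + t *\<^sub>R (c - a)) \<in> convex hull {a, b, c}"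
proof -
  obtain s t where p: "p = (s, t)" by (cases p)
  have "a + s *\<^sub>R (b - a) + t *\<^sub>R (c - a) = (1 - s - t) *\<^sub>R a + s *\<^sub>R b + t *\<^sub>R c"
    by (simp add: algebra_simps)
  moreover have "0 \<le> 1 - s - t" "0 \<le> s" "0 \<le> t" "1 - s - t + s + t = 1"
    using assms p by auto
  ultimately show ?thesis
    unfolding convex_hull_3 p case_prod_conv mem_Collect_eq by blast
qed

lemma AE_triangle_measureI:
  assumes "AE p in lborel. p \<in> unit_triangle \<longrightarrow> P (case p of (s, t) \<Rightarrow> a + s *\<^sub>R (b - a) + t *\<^sub>R (c - a))"
    and "{x. P x} \<in> sets borel"
  shows "AE x in triangle_measure a b c. P x"
  unfolding triangle_measure_def
proof (rule AE_completion, subst AE_distr_iff)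
  let ?w = "\<lambda>p. ennreal (norm (cross3 (b - a) (c - a))) * indicator unit_triangle p"
  show "AE p in density lborel ?w. P (case p of (s, t) \<Rightarrow> a + s *\<^sub>R (b - a) + t *\<^sub>R (c - a))"
  proof (subst AE_density)
    show "?w \<in> borel_measurable lborel" by measurable
    show "AE p in lborel. 0 < ?w p \<longrightarrow> P (case p of (s, t) \<Rightarrow> a + s *\<^sub>R (b - a) + t *\<^sub>R (c - a))"
      using assms(1) by eventually_elim (auto simp: indicator_def)
  qed
qed (use assms(2) measurable_triangle_param in auto)

lemma integral_triangle_measure:
  fixes f :: "real^3 \<Rightarrow> 'b::euclidean_space"
  assumes [measurable]: "f \<in> borel_measurable borel"
  shows "(LINT x|triangle_measure a b c. f x) = norm (cross3 (b - a) (c - a)) *\<^sub>R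
    (LINT p|lborel. indicator unit_triangle p *\<^sub>R f (case p of (s, t) \<Rightarrow> a + s *\<^sub>R (b - a) + t *\<^sub>R (c - a)))"
proof -
  let ?g = "\<lambda>(s, t). a + s *\<^sub>R (b - a) + t *\<^sub>R (c - a)"
  let ?n = "norm (cross3 (b - a) (c - a))"
  note measurable_triangle_param[of a b c, measurable]
  have w: "(\<lambda>p. ennreal ?n * indicator unit_triangle p)
      = (\<lambda>p. ennreal (?n * indicator unit_triangle p))"
    by (auto simp: fun_eq_iff indicator_def)
  have "(LINT x|triangle_measure a b c. f x)
      = (LINT p|density lborel (\<lambda>p. ennreal ?n * indicator unit_triangle p). f (?g p))"
    unfolding triangle_measure_def by (subst integral_completion, simp, subst integral_distr) auto
  also have "\<dots> = (LINT p|lborel. (?n * indicator unit_triangle p) *\<^sub>R f (?g p))"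
    unfolding w by (subst integral_density) auto
  finally show ?thesis
    by (simp flip: scaleR_scaleR)
qed

lemma finite_measure_triangle_measure: "finite_measure (triangle_measure a b c)"
proof
  let ?w = "\<lambda>p. ennreal (norm (cross3 (b - a) (c - a))) * indicator unit_triangle p"
  note measurable_triangle_param[of a b c, measurable]
  have "emeasure lborel unit_triangle < \<infinity>"
    using emeasure_bounded_finite[OF compact_imp_bounded[OF compact_unit_triangle]] by simp
  then have "emeasure (density lborel ?w) UNIV < \<infinity>"
    by (subst emeasure_density) (auto simp: nn_integral_cmult ennreal_mult_less_top)
  then show "emeasure (triangle_measure a b c) (space (triangle_measure a b c)) \<noteq> \<infinity>"
    unfolding triangle_measure_def by (simp add: emeasure_distr)
qed

lemma AE_in_triangle:
  "AE x in triangle_measure a b c. x \<in> convex hull {a, b, c}"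
proof (rule AE_triangle_measureI)
  show "AE p in lborel. p \<in> unit_triangle \<longrightarrow>
      (case p of (s, t) \<Rightarrow> a + s *\<^sub>R (b - a) + t *\<^sub>R (c - a)) \<in> convex hull {a, b, c}"
    using triangle_param_in_hull by (intro AE_I2) blast
qed (auto intro!: borel_compact finite_imp_compact_convex_hull)

lemma integrable_continuous_triangle:
  fixes f :: "real^3 \<Rightarrow> 'b::euclidean_space"
  assumes f: "continuous_on UNIV f"
  shows "integrable (triangle_measure a b c) f"
proof -
  interpret finite_measure "triangle_measure a b c" by (rule finite_measure_triangle_measure)
  have "bounded (f ` (convex hull {a, b, c}))"
    by (intro compact_imp_bounded compact_continuous_image continuous_on_subset[OF f]
        finite_imp_compact_convex_hull) auto
  then obtain B where "\<And>x. x \<in> convex hull {a, b, c} \<Longrightarrow> norm (f x) \<le> B"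
    by (auto simp: bounded_iff)
  then have "AE x in triangle_measure a b c. norm (f x) \<le> B"
    using AE_in_triangle[of a b c] by (auto elim!: eventually_mono)
  then show ?thesis
    by (intro integrable_const_bound[of _ B] borel_measurable_triangle_measureI
        borel_measurable_continuous_onI f)
qed

text \<open>A point in \<open>A\<close> has parameters with \<open>s + t = 1\<close>; for any other parameters \<open>a\<close> would be an
  affine combination of the point and of \<open>b\<close> and \<open>c\<close>.\<close>

lemma AE_triangle_not_in_affine:
  assumes "affine A" "b \<in> A" "c \<in> A" "a \<notin> A"
  shows "AE x in triangle_measure a b c. x \<notin> A"
proof (rule AE_triangle_measureI)
  have "negligible {p :: real \<times> real. (1, 1) \<bullet> p = 1}"
    by (rule negligible_hyperplane) auto
  then have "AE p :: real \<times> real in lborel. (1, 1) \<bullet> p \<noteq> 1"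
    by (subst AE_completion_iff[symmetric]) (auto simp: negligible_iff_null_sets intro: AE_I')
  then show "AE p in lborel. p \<in> unit_triangle \<longrightarrow>
      (case p of (s, t) \<Rightarrow> a + s *\<^sub>R (b - a) + t *\<^sub>R (c - a)) \<notin> A"
  proof eventually_elim
    case (elim p)
    obtain s t where p: "p = (s, t)" by (cases p)
    define r where "r = 1 - s - t"
    have r: "r \<noteq> 0" using elim p by (auto simp: r_def)
    have False if x: "a + s *\<^sub>R (b - a) + t *\<^sub>R (c - a) \<in> A"
    proof -
      have "(1 / r) *\<^sub>R (a + s *\<^sub>R (b - a) + t *\<^sub>R (c - a)) + (- s / r) *\<^sub>R b + (- t / r) *\<^sub>R c \<in> A"
        by (rule mem_affine_3[OF assms(1) x assms(2,3)]) (use r in \<open>simp add: divide_simps, simp add: r_def\<close>)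
      also have "(1 / r) *\<^sub>R (a + s *\<^sub>R (b - a) + t *\<^sub>R (c - a)) + (- s / r) *\<^sub>R b + (- t / r) *\<^sub>R c
          = (1 / r) *\<^sub>R (r *\<^sub>R a)"
        by (simp add: r_def algebra_simps)
      finally show False using r assms(4) by simp
    qed
    then show ?case using p by auto
  qed
  have "closed A"
    by (metis assms(1) closed_affine_hull hull_same)
  then show "{x. x \<notin> A} \<in> sets borel"
    by (simp add: Collect_neg_eq borel_closed)
qed

section \<open>The divergence theorem on a tetrahedron\<close>

text \<open>Continuity is required of the directional derivatives; in finite dimension this is continuity
  of the derivative. The derivative is an argument so that the product rule can be applied to it.\<close>

definition C1 :: "(real^3 \<Rightarrow> 'b::real_normed_vector) \<Rightarrow> (real^3 \<Rightarrow> real^3 \<Rightarrow> 'b) \<Rightarrow> bool" where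
  "C1 f f' \<longleftrightarrow> (\<forall>x. (f has_derivative f' x) (at x)) \<and> (\<forall>e. continuous_on UNIV (\<lambda>x. f' x e))"

lemma C1_imp_continuous: "C1 f f' \<Longrightarrow> continuous_on S f"
  unfolding C1_def by (meson continuous_at_imp_continuous_on has_derivative_continuous)

lemma integrable_lebesgue_on_compact:
  fixes f :: "'a::euclidean_space \<Rightarrow> 'b::euclidean_space"
  assumes "compact K" "continuous_on K f"
  shows "integrable (lebesgue_on K) f"
proof -
  have i: "integrable lborel (\<lambda>x. indicator K x *\<^sub>R f x)"
    using borel_integrable_compact[OF assms] by (simp add: set_integrable_def)
  then have "integrable lebesgue (\<lambda>x. indicator K x *\<^sub>R f x)"
    by (simp add: integrable_completion)
  then show ?thesis
    using assms(1) by (subst integrable_restrict_space) (auto intro: fmeasurableD lmeasurable_compact)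
qed

text \<open>A measure that agrees with Lebesgue measure on boxes is Lebesgue measure. The preimage of a box
  under the affine map is the image of a box under the inverse linear map, so its measure is that of
  a box up to the determinant.\<close>

lemma distr_affine_lborel:
  fixes g :: "real^3 \<Rightarrow> real^3"
  assumes g: "linear g" "inj g"
  shows "\<exists>D>0. distr lborel borel (\<lambda>x. v + g x) = density lborel (\<lambda>_. ennreal D)"
proof -
  obtain h where h: "linear h" "h \<circ> g = id"
    using linear_injective_left_inverse[OF g] by blast
  then have hg: "h (g x) = x" for x by (metis comp_apply id_apply)
  have gh: "g (h y) = y" for y
    using linear_injective_imp_surjective[OF g] hg by (metis surjD)
  define D where "D = \<bar>det (matrix h)\<bar>"
  have "matrix h ** matrix g = mat 1"
    using matrix_compose[OF g(1) h(1)] h(2) by (simp add: matrix_id_mat_1)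
  then have "det (matrix h) * det (matrix g) = 1"
    by (metis det_I det_mul)
  then have D: "D > 0" by (auto simp: D_def)
  have meas: "(\<lambda>x. v + g x) \<in> borel_measurable borel"
    using g(1) by (intro borel_measurable_continuous_onI continuous_intros linear_continuous_on)
      (simp add: linear_conv_bounded_linear)
  have "lborel = density (distr lborel borel (\<lambda>x. v + g x)) (\<lambda>_. ennreal (1 / D))"
  proof (rule lborel_eqI)
    fix l u :: "real^3" assume le: "\<And>b. b \<in> Basis \<Longrightarrow> l \<bullet> b \<le> u \<bullet> b"
    have vim: "(\<lambda>x. v + g x) -` box l u = h ` box (l - v) (u - v)"
    proof (intro set_eqI iffI)
      fix x assume "x \<in> (\<lambda>x. v + g x) -` box l u"
      then have "g x \<in> box (l - v) (u - v)"
        by (auto simp: mem_box inner_diff_left inner_add_left algebra_simps)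
      then show "x \<in> h ` box (l - v) (u - v)" using hg by (metis imageI)
    next
      fix x assume "x \<in> h ` box (l - v) (u - v)"
      then obtain y where "y \<in> box (l - v) (u - v)" "x = h y" by blast
      then show "x \<in> (\<lambda>x. v + g x) -` box l u"
        by (auto simp: mem_box inner_diff_left inner_add_left algebra_simps gh)
    qed
    have box: "box (l - v) (u - v) \<in> lmeasurable" by simp
    have "emeasure lborel ((\<lambda>x. v + g x) -` box l u) = emeasure lebesgue (h ` box (l - v) (u - v))"
      unfolding vim[symmetric]
      using measurable_sets_borel[OF meas, of "box l u"] by simp
    also have "\<dots> = ennreal (measure lebesgue (h ` box (l - v) (u - v)))"
      using measurable_linear_image[OF h(1) box] by (simp add: emeasure_eq_measure2)
    also have "measure lebesgue (h ` box (l - v) (u - v)) = D * (\<Prod>b\<in>Basis. (u - l) \<bullet> b)"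
      using measure_linear_image[OF h(1) box] le
      by (simp add: D_def measure_completion inner_diff_left)
    finally have em: "emeasure lborel ((\<lambda>x. v + g x) -` box l u) = ennreal (D * (\<Prod>b\<in>Basis. (u - l) \<bullet> b))" .
    have "emeasure (density (distr lborel borel (\<lambda>x. v + g x)) (\<lambda>_. ennreal (1 / D))) (box l u)
      = ennreal (1 / D) * emeasure lborel ((\<lambda>x. v + g x) -` box l u)"
      using meas by (simp add: emeasure_density nn_integral_cmult emeasure_distr)
    also have "\<dots> = ennreal (\<Prod>b\<in>Basis. (u - l) \<bullet> b)"
      unfolding em using D le
      by (subst ennreal_mult[symmetric]) (auto intro!: prod_nonneg mult_nonneg_nonneg simp: inner_diff_left less_imp_le)
    finally show "emeasure (density (distr lborel borel (\<lambda>x. v + g x)) (\<lambda>_. ennreal (1 / D))) (box l u)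
      = (\<Prod>b\<in>Basis. (u - l) \<bullet> b)" .
  qed simp
  then have "density lborel (\<lambda>_. ennreal D)
      = density (density (distr lborel borel (\<lambda>x. v + g x)) (\<lambda>_. ennreal (1 / D))) (\<lambda>_. ennreal D)"
    by (rule arg_cong[where f="\<lambda>M. density M (\<lambda>_. ennreal D)"])
  also have "\<dots> = density (distr lborel borel (\<lambda>x. v + g x)) (\<lambda>_. ennreal (1 / D) * ennreal D)"
    by (rule density_density_eq) auto
  also have "(\<lambda>_. ennreal (1 / D) * ennreal D) = (\<lambda>_. 1)"
    using D by (subst ennreal_mult[symmetric]) auto
  finally show ?thesis
    using D by (auto simp: density_1)
qed

lemma distr_triple_lborel:
  "distr lborel borel (\<lambda>((s, t), r). r *\<^sub>R axis 1 1 + s *\<^sub>R axis 2 1 + t *\<^sub>R axis 3 1)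
    = (lborel :: (real^3) measure)"
proof (rule lborel_eqI[symmetric])
  fix l u :: "real^3" assume le: "\<And>b. b \<in> Basis \<Longrightarrow> l \<bullet> b \<le> u \<bullet> b"
  have le': "l $ i \<le> u $ i" for i
    using le[of "axis i 1"] by (auto simp: inner_axis)
  let ?\<psi> = "\<lambda>((s, t), r). r *\<^sub>R axis 1 1 + s *\<^sub>R axis 2 1 + t *\<^sub>R axis 3 1 :: real^3"
  have meas: "?\<psi> \<in> borel_measurable borel"
    by (intro borel_measurable_continuous_onI)
      (auto simp: case_prod_unfold intro!: continuous_intros)
  have vim: "?\<psi> -` box l u = box ((l$2, l$3), l$1) ((u$2, u$3), u$1)"
    by (auto simp: mem_box_cart forall_3 mem_box Basis_prod_def ball_Un axis_def)
  have Basis3: "(\<Prod>b\<in>Basis. (u - l) \<bullet> b) = (u - l) $ 1 * (u - l) $ 2 * (u - l) $ 3"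
  proof -
    have B: "(Basis :: (real^3) set) = {axis 1 1, axis 2 1, axis 3 1}"
      by (auto simp: Basis_vec_def UNIV_3)
    show ?thesis
      unfolding B by (simp add: axis_eq_axis inner_axis mult.assoc)
  qed
  have "emeasure (distr lborel borel ?\<psi>) (box l u) = emeasure lborel (box ((l$2, l$3), l$1) ((u$2, u$3), u$1))"
    using meas vim by (simp add: emeasure_distr)
  also have "\<dots> = (\<Prod>b\<in>Basis. (u - l) \<bullet> b)"
    unfolding Basis3 using le'
    by (subst emeasure_lborel_box) (auto simp: Basis_prod_def prod.union_disjoint prod.reindex inj_on_def)
  finally show "emeasure (distr lborel borel ?\<psi>) (box l u) = (\<Prod>b\<in>Basis. (u - l) \<bullet> b)" .
qed simp

text \<open>If a coefficient were nonzero, then the corresponding vertex would be an affine combination of the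
  three others.\<close>

lemma tetrahedron_edges_independent:
  fixes v0 v1 v2 v3 :: "real^3"
  assumes indep: "\<not> affine_dependent {v0, v1, v2, v3}" and card: "card {v0, v1, v2, v3} = 4"
    and 0: "r *\<^sub>R (v1 - v0) + s *\<^sub>R (v2 - v0) + t *\<^sub>R (v3 - v0) = 0"
  shows "r = 0 \<and> s = 0 \<and> t = 0"
proof -
  have dist: "v0 \<noteq> v1" "v0 \<noteq> v2" "v0 \<noteq> v3" "v1 \<noteq> v2" "v1 \<noteq> v3" "v2 \<noteq> v3"
    using card by (auto simp: card_insert_if split: if_splits)
  have key: "r = 0" if "w1 \<notin> affine hull {v0, w2, w3}"
    and 0: "r *\<^sub>R (w1 - v0) + s *\<^sub>R (w2 - v0) + t *\<^sub>R (w3 - v0) = 0" for r s t and w1 w2 w3 :: "real^3"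
  proof (rule ccontr)
    assume r: "r \<noteq> 0"
    have "w1 = (1 / r) *\<^sub>R (r *\<^sub>R (w1 - v0)) + v0" using r by simp
    also have "r *\<^sub>R (w1 - v0) = - (s *\<^sub>R (w2 - v0) + t *\<^sub>R (w3 - v0))"
      using 0 by (simp only: eq_neg_iff_add_eq_0 add.assoc)
    also have "(1 / r) *\<^sub>R - (s *\<^sub>R (w2 - v0) + t *\<^sub>R (w3 - v0)) + v0
        = (1 + s / r + t / r) *\<^sub>R v0 + (- s / r) *\<^sub>R w2 + (- t / r) *\<^sub>R w3"
      by (simp add: algebra_simps)
    also have "\<dots> \<in> affine hull {v0, w2, w3}"
      by (intro mem_affine_3 affine_affine_hull hull_inc) auto
    finally show False using that by blast
  qed
  have not_in: "x \<notin> affine hull ({v0, v1, v2, v3} - {x})" if "x \<in> {v0, v1, v2, v3}" for x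
    using indep that unfolding affine_dependent_def by blast
  have "{v0, v1, v2, v3} - {v1} = {v0, v2, v3}" "{v0, v1, v2, v3} - {v2} = {v0, v1, v3}"
    "{v0, v1, v2, v3} - {v3} = {v0, v1, v2}"
    using dist by auto
  then have n: "v1 \<notin> affine hull {v0, v2, v3}" "v2 \<notin> affine hull {v0, v1, v3}" "v3 \<notin> affine hull {v0, v1, v2}"
    using not_in[of v1] not_in[of v2] not_in[of v3] by auto
  show ?thesis
    using key[OF n(1) 0] key[OF n(2), of s r t] key[OF n(3), of t r s] 0 by (simp add: algebra_simps)
qed

lemma linear_edge_map: "linear (\<lambda>x :: real^3. x $ 1 *\<^sub>R a + x $ 2 *\<^sub>R b + x $ 3 *\<^sub>R c)"
  for a b c :: "real^3"
  by (auto intro!: linearI simp: algebra_simps)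

lemma inj_edge_map:
  fixes v0 v1 v2 v3 :: "real^3"
  assumes indep: "\<not> affine_dependent {v0, v1, v2, v3}" and card: "card {v0, v1, v2, v3} = 4"
  shows "inj (\<lambda>x :: real^3. x $ 1 *\<^sub>R (v1 - v0) + x $ 2 *\<^sub>R (v2 - v0) + x $ 3 *\<^sub>R (v3 - v0))"
  unfolding linear_injective_0[OF linear_edge_map]
proof (intro allI impI)
  fix x :: "real^3"
  assume "x $ 1 *\<^sub>R (v1 - v0) + x $ 2 *\<^sub>R (v2 - v0) + x $ 3 *\<^sub>R (v3 - v0) = 0"
  from tetrahedron_edges_independent[OF assms this] show "x = 0"
    by (simp add: vec_eq_iff forall_3)
qed

text \<open>The unit tetrahedron is parametrized with the coordinate \<open>r\<close> along the edge from \<open>v0\<close> to \<open>v1\<close>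
  last, so that integrating over it first leaves an integral over the unit triangle.\<close>

abbreviation tetra_param ::
    "real^3 \<Rightarrow> real^3 \<Rightarrow> real^3 \<Rightarrow> real^3 \<Rightarrow> (real \<times> real) \<times> real \<Rightarrow> real^3" where
  "tetra_param v0 v1 v2 v3 \<equiv> \<lambda>((s, t), r). v0 + (r *\<^sub>R (v1 - v0) + s *\<^sub>R (v2 - v0) + t *\<^sub>R (v3 - v0))"

lemma continuous_tetra_param: "continuous_on S (tetra_param v0 v1 v2 v3)"
  by (auto simp: case_prod_unfold intro!: continuous_intros)

lemma distr_tetra_param:
  fixes v0 v1 v2 v3 :: "real^3"
  assumes indep: "\<not> affine_dependent {v0, v1, v2, v3}" and card: "card {v0, v1, v2, v3} = 4"
  shows "\<exists>D>0. distr lborel borel (tetra_param v0 v1 v2 v3) = density lborel (\<lambda>_. ennreal D)"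
proof -
  let ?g = "\<lambda>x :: real^3. x $ 1 *\<^sub>R (v1 - v0) + x $ 2 *\<^sub>R (v2 - v0) + x $ 3 *\<^sub>R (v3 - v0)"
  let ?\<psi> = "\<lambda>((s, t), r). r *\<^sub>R axis 1 1 + s *\<^sub>R axis 2 1 + t *\<^sub>R axis 3 1 :: real^3"
  obtain D where D: "D > 0" "distr lborel borel (\<lambda>x. v0 + ?g x) = density lborel (\<lambda>_. ennreal D)"
    using distr_affine_lborel[OF linear_edge_map inj_edge_map[OF assms], of v0] by blast
  have "tetra_param v0 v1 v2 v3 = (\<lambda>x. v0 + ?g x) \<circ> ?\<psi>"
    by (auto simp: fun_eq_iff axis_def)
  moreover have "distr lborel borel ((\<lambda>x. v0 + ?g x) \<circ> ?\<psi>) = distr (distr lborel borel ?\<psi>) borel (\<lambda>x. v0 + ?g x)"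
    by (rule distr_distr[symmetric])
      (auto simp: case_prod_unfold intro!: borel_measurable_continuous_onI continuous_intros)
  ultimately show ?thesis
    using D by (auto simp: distr_triple_lborel)
qed

lemma integral_tetra_param:
  fixes v0 v1 v2 v3 :: "real^3" and f :: "real^3 \<Rightarrow> 'b::euclidean_space"
  assumes D: "D > 0" "distr lborel borel (tetra_param v0 v1 v2 v3) = density lborel (\<lambda>_. ennreal D)"
    and f[measurable]: "f \<in> borel_measurable borel"
  shows "(LINT x|lborel. f x) = (1 / D) *\<^sub>R (LINT q|lborel. f (tetra_param v0 v1 v2 v3 q))"
    and "integrable lborel f \<longleftrightarrow> integrable lborel (\<lambda>q. f (tetra_param v0 v1 v2 v3 q))"
proof -
  have m[measurable]: "tetra_param v0 v1 v2 v3 \<in> borel_measurable borel"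
    by (intro borel_measurable_continuous_onI continuous_tetra_param)
  have "(LINT q|lborel. f (tetra_param v0 v1 v2 v3 q)) = (LINT x|distr lborel borel (tetra_param v0 v1 v2 v3). f x)"
    by (subst integral_distr) auto
  also have "\<dots> = D *\<^sub>R (LINT x|lborel. f x)"
    unfolding D(2) using D(1) by (subst integral_density) (auto simp: less_imp_le)
  finally show "(LINT x|lborel. f x) = (1 / D) *\<^sub>R (LINT q|lborel. f (tetra_param v0 v1 v2 v3 q))"
    using D(1) by simp
  have "integrable lborel (\<lambda>q. f (tetra_param v0 v1 v2 v3 q)) \<longleftrightarrow> integrable (distr lborel borel (tetra_param v0 v1 v2 v3)) f"
    by (subst integrable_distr_eq) auto
  also have "\<dots> \<longleftrightarrow> integrable lborel f"
    unfolding D(2) using D(1) integrable_scaleR_right[of "1 / D" lborel "\<lambda>x. D *\<^sub>R f x"]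
    by (subst integrable_density) (auto simp: less_imp_le)
  finally show "integrable lborel f \<longleftrightarrow> integrable lborel (\<lambda>q. f (tetra_param v0 v1 v2 v3 q))" ..
qed

abbreviation unit_tetrahedron :: "((real \<times> real) \<times> real) set" where
  "unit_tetrahedron \<equiv> {((s, t), r). 0 \<le> r \<and> 0 \<le> s \<and> 0 \<le> t \<and> r + s + t \<le> 1}"

text \<open>The parameters \<open>r\<close>, \<open>s\<close>, \<open>t\<close> are the barycentric coordinates with respect to \<open>v1\<close>, \<open>v2\<close>, \<open>v3\<close>,
  and these are unique.\<close>

lemma tetra_param_in_hull_iff:
  fixes v0 v1 v2 v3 :: "real^3"
  assumes indep: "\<not> affine_dependent {v0, v1, v2, v3}" and card: "card {v0, v1, v2, v3} = 4"
  shows "tetra_param v0 v1 v2 v3 q \<in> convex hull {v0, v1, v2, v3} \<longleftrightarrow> q \<in> unit_tetrahedron"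
proof -
  obtain s t r where q: "q = ((s, t), r)" by (cases q) auto
  have dist: "v0 \<noteq> v1" "v0 \<noteq> v2" "v0 \<noteq> v3" "v1 \<noteq> v2" "v1 \<noteq> v3" "v2 \<noteq> v3"
    using card by (auto simp: card_insert_if split: if_splits)
  have hull: "convex hull {v0, v1, v2, v3} = {y. \<exists>u. (\<forall>x\<in>{v0, v1, v2, v3}. 0 \<le> u x)
      \<and> sum u {v0, v1, v2, v3} = 1 \<and> (\<Sum>x\<in>{v0, v1, v2, v3}. u x *\<^sub>R x) = y}"
    by (rule convex_hull_finite) simp
  show ?thesis
  proof
    assume "tetra_param v0 v1 v2 v3 q \<in> convex hull {v0, v1, v2, v3}"
    then obtain u where u: "\<forall>x\<in>{v0, v1, v2, v3}. 0 \<le> u x" "sum u {v0, v1, v2, v3} = 1"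
      and y: "(\<Sum>x\<in>{v0, v1, v2, v3}. u x *\<^sub>R x) = tetra_param v0 v1 v2 v3 q"
      unfolding hull by blast
    have 1: "u v0 = 1 - u v1 - u v2 - u v3"
      using u(2) dist by simp
    have "u v0 *\<^sub>R v0 + u v1 *\<^sub>R v1 + u v2 *\<^sub>R v2 + u v3 *\<^sub>R v3
        = v0 + (r *\<^sub>R (v1 - v0) + s *\<^sub>R (v2 - v0) + t *\<^sub>R (v3 - v0))"
      using y dist q by (simp add: add.assoc)
    then have "(u v1 - r) *\<^sub>R (v1 - v0) + (u v2 - s) *\<^sub>R (v2 - v0) + (u v3 - t) *\<^sub>R (v3 - v0) = 0"
      unfolding 1 by (simp add: algebra_simps)
    from tetrahedron_edges_independent[OF assms this]
    have "u v1 = r" "u v2 = s" "u v3 = t"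
      by simp_all
    then show "q \<in> unit_tetrahedron"
      using u(1) 1 q by auto
  next
    assume "q \<in> unit_tetrahedron"
    then have pos: "0 \<le> r" "0 \<le> s" "0 \<le> t" "r + s + t \<le> 1" using q by auto
    define u where "u x = (if x = v1 then r else if x = v2 then s else if x = v3 then t else 1 - r - s - t)" for x
    have "(\<forall>x\<in>{v0, v1, v2, v3}. 0 \<le> u x)" "sum u {v0, v1, v2, v3} = 1"
      using pos dist by (auto simp: u_def)
    moreover have "(\<Sum>x\<in>{v0, v1, v2, v3}. u x *\<^sub>R x) = tetra_param v0 v1 v2 v3 q"
      using dist q by (auto simp: u_def algebra_simps)
    ultimately show "tetra_param v0 v1 v2 v3 q \<in> convex hull {v0, v1, v2, v3}"
      unfolding hull by blast
  qed
qed

text \<open>Along the edge from \<open>v0\<close> to \<open>v1\<close> the fundamental theorem of calculus turns the volume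
  integral of the derivative in the direction of the edge into the difference of the integrals over
  the two faces that meet the edge in one end point only.\<close>

lemma integral_edge_derivative:
  fixes v0 v1 v2 v3 :: "real^3"
  assumes indep: "\<not> affine_dependent {v0, v1, v2, v3}" and card: "card {v0, v1, v2, v3} = 4"
  shows "\<exists>c. \<forall>(f :: real^3 \<Rightarrow> 'b::euclidean_space) f'. C1 f f' \<longrightarrow>
    (LINT x|lebesgue_on (convex hull {v0, v1, v2, v3}). f' x (v1 - v0)) = c *\<^sub>R
      ((LINT p|lborel. indicator unit_triangle p *\<^sub>R f (case p of (s, t) \<Rightarrow> v1 + s *\<^sub>R (v2 - v1) + t *\<^sub>R (v3 - v1)))
     - (LINT p|lborel. indicator unit_triangle p *\<^sub>R f (case p of (s, t) \<Rightarrow> v0 + s *\<^sub>R (v2 - v0) + t *\<^sub>R (v3 - v0))))"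
proof -
  let ?K = "convex hull {v0, v1, v2, v3}"
  let ?\<Phi> = "tetra_param v0 v1 v2 v3"
  obtain D where D: "D > 0" "distr lborel borel ?\<Phi> = density lborel (\<lambda>_. ennreal D)"
    using distr_tetra_param[OF assms] by blast
  have K: "compact ?K" by (intro finite_imp_compact_convex_hull) auto
  have Kb[measurable]: "?K \<in> sets borel" using K by (rule borel_compact)
  have "(LINT x|lebesgue_on ?K. f' x (v1 - v0)) = (1 / D) *\<^sub>R
      ((LINT p|lborel. indicator unit_triangle p *\<^sub>R f (case p of (s, t) \<Rightarrow> v1 + s *\<^sub>R (v2 - v1) + t *\<^sub>R (v3 - v1)))
     - (LINT p|lborel. indicator unit_triangle p *\<^sub>R f (case p of (s, t) \<Rightarrow> v0 + s *\<^sub>R (v2 - v0) + t *\<^sub>R (v3 - v0))))"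
    if "C1 f f'" for f :: "real^3 \<Rightarrow> 'b" and f'
  proof -
    define F where "F x = f' x (v1 - v0)" for x
    have F: "continuous_on S F" for S
      using that continuous_on_subset unfolding C1_def F_def by blast
    have f: "continuous_on S f" for S
      using that by (rule C1_imp_continuous)
    have [measurable]: "F \<in> borel_measurable borel" "f \<in> borel_measurable borel"
      using F f by (auto intro: borel_measurable_continuous_onI)
    have intF: "integrable lborel (\<lambda>x. indicator ?K x *\<^sub>R F x)"
      using borel_integrable_compact[OF K F] by (simp add: set_integrable_def)
    have cp: "continuous_on S (\<lambda>(s, t). a + s *\<^sub>R (b - a) + t *\<^sub>R (c - a))"
      for S and a b c :: "real^3"
      by (auto simp: case_prod_unfold intro!: continuous_intros)
    have intf: "integrable lborel (\<lambda>p. indicator unit_triangle p *\<^sub>R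
        f (case p of (s, t) \<Rightarrow> a + s *\<^sub>R (b - a) + t *\<^sub>R (c - a)))" for a b c
      using borel_integrable_compact[OF compact_unit_triangle
          continuous_on_compose2[OF f[of UNIV] cp[of _ a b c] subset_UNIV]]
      by (simp add: set_integrable_def case_prod_unfold)
    have ind: "indicator ?K (?\<Phi> q) = (indicator unit_tetrahedron q :: real)" for q
      using tetra_param_in_hull_iff[OF assms, of q] by (simp only: indicator_def)
    define G where "G p r = indicator unit_tetrahedron (p, r) *\<^sub>R F (?\<Phi> (p, r))" for p r
    have "integrable lborel (\<lambda>q. indicator ?K (?\<Phi> q) *\<^sub>R F (?\<Phi> q))"
      using intF by (subst (asm) integral_tetra_param(2)[OF D]) auto
    then have int: "integrable (lborel \<Otimes>\<^sub>M lborel) (case_prod G)"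
      unfolding ind lborel_prod by (simp add: G_def case_prod_unfold)
    have inner: "(LINT r|lborel. G p r) = indicator unit_triangle p *\<^sub>R
        (f (case p of (s, t) \<Rightarrow> v1 + s *\<^sub>R (v2 - v1) + t *\<^sub>R (v3 - v1))
       - f (case p of (s, t) \<Rightarrow> v0 + s *\<^sub>R (v2 - v0) + t *\<^sub>R (v3 - v0)))" for p
    proof -
      obtain s t where p: "p = (s, t)" by (cases p)
      show ?thesis
      proof (cases "p \<in> unit_triangle")
        case False
        then have "G p r = 0" for r using p by (auto simp: G_def indicator_def)
        then show ?thesis using False by simp
      next
        case True
        then have st: "0 \<le> s" "0 \<le> t" "s + t \<le> 1" using p by auto
        define \<gamma> where "\<gamma> r = v0 + (r *\<^sub>R (v1 - v0) + s *\<^sub>R (v2 - v0) + t *\<^sub>R (v3 - v0))" for r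
        have "G p r = indicator {0..1 - s - t} r *\<^sub>R F (\<gamma> r)" for r
          using p st by (auto simp: G_def indicator_def \<gamma>_def)
        moreover have "(LINT r|lborel. indicator {0..1 - s - t} r *\<^sub>R F (\<gamma> r)) = f (\<gamma> (1 - s - t)) - f (\<gamma> 0)"
        proof (rule integral_FTC_atLeastAtMost)
          fix r
          have "(f has_derivative f' (\<gamma> r)) (at (\<gamma> r))"
            using that by (simp add: C1_def)
          moreover have "(\<gamma> has_vector_derivative (v1 - v0)) (at r within {0..1 - s - t})"
            unfolding \<gamma>_def by (auto intro!: derivative_eq_intros)
          ultimately show "((\<lambda>r. f (\<gamma> r)) has_vector_derivative F (\<gamma> r)) (at r within {0..1 - s - t})"
            unfolding F_def by (metis (no_types, lifting) has_derivative_at_withinI vector_derivative_diff_chain_within o_def ext)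
        next
          show "continuous_on {0..1 - s - t} (\<lambda>r. F (\<gamma> r))"
            unfolding \<gamma>_def by (intro continuous_on_compose2[OF F[of UNIV]] continuous_intros) auto
        qed (use st in auto)
        moreover have "\<gamma> (1 - s - t) = v1 + s *\<^sub>R (v2 - v1) + t *\<^sub>R (v3 - v1)"
          "\<gamma> 0 = v0 + s *\<^sub>R (v2 - v0) + t *\<^sub>R (v3 - v0)"
          by (simp_all add: \<gamma>_def algebra_simps)
        ultimately show ?thesis using True p by simp
      qed
    qed
    have "(LINT x|lebesgue_on ?K. F x) = (LINT x|lebesgue. indicator ?K x *\<^sub>R F x)"
      by (rule integral_restrict_space) auto
    also have "\<dots> = (LINT x|lborel. indicator ?K x *\<^sub>R F x)"
      by (rule integral_completion) auto
    also have "\<dots> = (1 / D) *\<^sub>R (LINT q|lborel. indicator ?K (?\<Phi> q) *\<^sub>R F (?\<Phi> q))"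
      by (rule integral_tetra_param(1)[OF D]) auto
    also have "(LINT q|lborel. indicator ?K (?\<Phi> q) *\<^sub>R F (?\<Phi> q)) = integral\<^sup>L (lborel \<Otimes>\<^sub>M lborel) (case_prod G)"
      unfolding ind lborel_prod by (simp add: G_def case_prod_unfold)
    also have "\<dots> = (LINT p|lborel. LINT r|lborel. G p r)"
      by (rule lborel_pair.integral_fst[OF int, symmetric])
    also have "\<dots> = (LINT p|lborel. indicator unit_triangle p *\<^sub>R f (case p of (s, t) \<Rightarrow> v1 + s *\<^sub>R (v2 - v1) + t *\<^sub>R (v3 - v1)))
     - (LINT p|lborel. indicator unit_triangle p *\<^sub>R f (case p of (s, t) \<Rightarrow> v0 + s *\<^sub>R (v2 - v0) + t *\<^sub>R (v3 - v0)))"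
      unfolding inner
      by (subst Bochner_Integration.integral_diff[OF intf intf, symmetric]) (simp only: scaleR_diff_right)
    finally show ?thesis unfolding F_def .
  qed
  then show ?thesis by blast
qed

definition tetrahedron_vertices :: "(real^3) set \<Rightarrow> bool" where
  "tetrahedron_vertices S \<longleftrightarrow> \<not> affine_dependent S \<and> card S = 4"

lemma facet_of_tetrahedron_iff:
  assumes "tetrahedron_vertices S"
  shows "F facet_of (convex hull S) \<longleftrightarrow> (\<exists>v\<in>S. F = convex hull (S - {v}))"
  using assms facet_of_convex_hull_affine_independent_alt[of S F]
  by (auto simp: tetrahedron_vertices_def)

lemma finite_facets_tetrahedron:
  assumes "tetrahedron_vertices S"
  shows "finite {F. F facet_of (convex hull S)}"
proof -
  have "finite S" using assms card.infinite by (fastforce simp: tetrahedron_vertices_def)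
  moreover have "{F. F facet_of (convex hull S)} = (\<lambda>v. convex hull (S - {v})) ` S"
    using facet_of_tetrahedron_iff[OF assms] by auto
  ultimately show ?thesis by simp
qed

text \<open>The vertices are numbered so that a given edge from \<open>u\<close> to \<open>v\<close> comes first. The two faces that
  do not contain this edge are the triangles \<open>v a b\<close> and \<open>u a b\<close>.\<close>

lemma tetrahedron_vertices_cases:
  assumes "tetrahedron_vertices S" "u \<in> S" "v \<in> S" "u \<noteq> v"
  obtains a b where "S = {u, v, a, b}" "card {u, v, a, b} = 4"
proof -
  have fin: "finite S" and c: "card S = 4"
    using assms(1) card.infinite by (fastforce simp: tetrahedron_vertices_def)+
  have "card (S - {u, v}) = 2"
    using assms fin c by (simp add: card_Diff_subset)
  then obtain a b where ab: "S - {u, v} = {a, b}"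
    by (auto simp: card_2_iff)
  then have "S = {u, v, a, b}" using assms by auto
  then show thesis using that c by metis
qed

lemma surface_measure_face:
  assumes S: "tetrahedron_vertices S" and eq: "S = {v, a, b, c}"
  shows "surface_measure (convex hull (S - {v})) = triangle_measure a b c" "S - {v} = {a, b, c}"
    and "cross3 (b - a) (c - a) \<noteq> 0"
proof -
  have c4: "card {v, a, b, c} = 4" using S eq by (simp add: tetrahedron_vertices_def)
  then have dist: "v \<noteq> a" "v \<noteq> b" "v \<noteq> c" "a \<noteq> b" "a \<noteq> c" "b \<noteq> c"
    by (auto simp: card_insert_if split: if_splits)
  then show S': "S - {v} = {a, b, c}" using eq by auto
  have ind: "\<not> affine_dependent {a, b, c}"
    using S affine_independent_Diff[of S "{v}"] unfolding S'[symmetric] tetrahedron_vertices_def by blast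
  have c3: "card {a, b, c} = 3" using dist by simp
  show "surface_measure (convex hull (S - {v})) = triangle_measure a b c"
    unfolding S' by (rule surface_measure_triangle[OF ind c3])
  show "cross3 (b - a) (c - a) \<noteq> 0"
  proof
    assume "cross3 (b - a) (c - a) = 0"
    then have "collinear {0, b - a, c - a}" by (simp add: cross_eq_0)
    then have "collinear {a, b, c}"
      using collinear_3[of b a c] by (simp add: insert_commute)
    then show False
      using ind dist unfolding collinear_3_eq_affine_dependent by blast
  qed
qed

text \<open>For a fixed direction \<open>e\<close>, the volume integrals of the derivatives in direction \<open>e\<close> are a
  combination of face integrals whose weights do not depend on the function. The directions with
  this property form a subspace that contains the edges at a vertex, hence all directions. In the
  classical statement \<open>N F\<close> is the outward unit normal; for integration by parts it matters that
  \<open>N F\<close> depends on the face only.\<close>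

theorem divergence_theorem_tetrahedron:
  assumes S: "tetrahedron_vertices S"
  shows "\<exists>N :: (real^3) set \<Rightarrow> real^3. \<forall>(f :: real^3 \<Rightarrow> 'b::euclidean_space) f'. C1 f f' \<longrightarrow>
    (\<forall>j. (LINT x|lebesgue_on (convex hull S). f' x (axis j 1))
      = (\<Sum>F | F facet_of (convex hull S). N F $ j *\<^sub>R (LINT x|surface_measure F. f x)))"
proof -
  let ?K = "convex hull S"
  let ?\<F> = "{F. F facet_of ?K}"
  have finS: "finite S" using S card.infinite by (fastforce simp: tetrahedron_vertices_def)
  have fin: "finite ?\<F>" by (rule finite_facets_tetrahedron[OF S])
  define G where "G e \<longleftrightarrow> (\<exists>w :: (real^3) set \<Rightarrow> real. \<forall>(f :: real^3 \<Rightarrow> 'b) f'. C1 f f' \<longrightarrow>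
    (LINT x|lebesgue_on ?K. f' x e) = (\<Sum>F\<in>?\<F>. w F *\<^sub>R (LINT x|surface_measure F. f x)))" for e
  have int: "integrable (lebesgue_on ?K) (\<lambda>x. f' x e)" if "C1 f f'" for f :: "real^3 \<Rightarrow> 'b" and f' e
    using that unfolding C1_def
    by (intro integrable_lebesgue_on_compact compact_convex_hull finite_imp_compact finS)
      (meson continuous_on_subset subset_UNIV)
  have lin: "linear (f' x)" if "C1 f f'" for f :: "real^3 \<Rightarrow> 'b" and f' x
    using that unfolding C1_def by (meson has_derivative_linear)
  have Gadd: "G (a *\<^sub>R d + b *\<^sub>R e)" if d: "G d" and e: "G e" for d e a b
  proof -
    obtain w where w: "\<And>(f :: real^3 \<Rightarrow> 'b) f'. C1 f f' \<Longrightarrow>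
        (LINT x|lebesgue_on ?K. f' x d) = (\<Sum>F\<in>?\<F>. w F *\<^sub>R (LINT x|surface_measure F. f x))"
      using d unfolding G_def by blast
    obtain w' where w': "\<And>(f :: real^3 \<Rightarrow> 'b) f'. C1 f f' \<Longrightarrow>
        (LINT x|lebesgue_on ?K. f' x e) = (\<Sum>F\<in>?\<F>. w' F *\<^sub>R (LINT x|surface_measure F. f x))"
      using e unfolding G_def by blast
    have "(LINT x|lebesgue_on ?K. f' x (a *\<^sub>R d + b *\<^sub>R e))
        = (\<Sum>F\<in>?\<F>. (a * w F + b * w' F) *\<^sub>R (LINT x|surface_measure F. f x))"
      if f: "C1 f f'" for f :: "real^3 \<Rightarrow> 'b" and f'
    proof -
      have "f' x (a *\<^sub>R d + b *\<^sub>R e) = a *\<^sub>R f' x d + b *\<^sub>R f' x e" for x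
        using lin[OF f, of x] by (simp add: linear_add linear_cmul)
      then have "(LINT x|lebesgue_on ?K. f' x (a *\<^sub>R d + b *\<^sub>R e))
          = a *\<^sub>R (LINT x|lebesgue_on ?K. f' x d) + b *\<^sub>R (LINT x|lebesgue_on ?K. f' x e)"
        using int[OF f] by simp
      then show ?thesis
        unfolding w[OF f] w'[OF f] by (simp add: scaleR_sum_right sum.distrib[symmetric] algebra_simps)
    qed
    then show ?thesis
      unfolding G_def by (intro exI[of _ "\<lambda>F. a * w F + b * w' F"]) blast
  qed
  have Gedge: "G (u - v)" if uv: "u \<in> S" "v \<in> S" "u \<noteq> v" for u v
  proof -
    obtain a b where ab: "S = {v, u, a, b}" "card {v, u, a, b} = 4"
      using tetrahedron_vertices_cases[OF S uv(2,1)] uv(3) by metis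
    have ab': "S = {u, v, a, b}" using ab by auto
    have ind: "\<not> affine_dependent {v, u, a, b}" using S ab by (simp add: tetrahedron_vertices_def)
    let ?Fv = "convex hull (S - {v})" and ?Fu = "convex hull (S - {u})"
    note Fv = surface_measure_face[OF S ab(1)] and Fu = surface_measure_face[OF S ab']
    define n where "n = norm (cross3 (a - u) (b - u))"
    define m where "m = norm (cross3 (a - v) (b - v))"
    have n: "n \<noteq> 0" "m \<noteq> 0" using Fv(3) Fu(3) by (auto simp: n_def m_def)
    have mem: "?Fv \<in> ?\<F>" "?Fu \<in> ?\<F>"
      using facet_of_tetrahedron_iff[OF S] uv by auto
    have ne: "?Fv \<noteq> ?Fu"
    proof
      assume "?Fv = ?Fu"
      then have "u \<in> convex hull (S - {u})" using uv by (metis Diff_iff hull_inc singletonD)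
      then show False using S uv(1) convex_hull_subset_affine_hull[of "S - {u}"]
        unfolding tetrahedron_vertices_def affine_dependent_def by blast
    qed
    obtain c where c: "\<And>(f :: real^3 \<Rightarrow> 'b) f'. C1 f f' \<Longrightarrow> (LINT x|lebesgue_on ?K. f' x (u - v)) = c *\<^sub>R
      ((LINT p|lborel. indicator unit_triangle p *\<^sub>R f (case p of (s, t) \<Rightarrow> u + s *\<^sub>R (a - u) + t *\<^sub>R (b - u)))
     - (LINT p|lborel. indicator unit_triangle p *\<^sub>R f (case p of (s, t) \<Rightarrow> v + s *\<^sub>R (a - v) + t *\<^sub>R (b - v))))"
      using integral_edge_derivative[OF ind ab(2), where 'b = 'b] unfolding ab(1)[symmetric] by blast
    \<comment> \<open>Dividing by \<open>n\<close> and \<open>m\<close> turns integrals over the faces into integrals over the parameters.\<close>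
    define w where "w F = (if F = ?Fv then c / n else if F = ?Fu then - c / m else 0)" for F
    have "(LINT x|lebesgue_on ?K. f' x (u - v)) = (\<Sum>F\<in>?\<F>. w F *\<^sub>R (LINT x|surface_measure F. f x))"
      if f: "C1 f f'" for f :: "real^3 \<Rightarrow> 'b" and f'
    proof -
      have meas: "f \<in> borel_measurable borel"
        using C1_imp_continuous[OF f] by (rule borel_measurable_continuous_onI)
      have "(\<Sum>F\<in>?\<F>. w F *\<^sub>R (LINT x|surface_measure F. f x))
          = (\<Sum>F\<in>{?Fv, ?Fu}. w F *\<^sub>R (LINT x|surface_measure F. f x))"
        by (rule sum.mono_neutral_right[OF fin]) (use mem in \<open>auto simp: w_def\<close>)
      also have "\<dots> = (c / n) *\<^sub>R (LINT x|triangle_measure u a b. f x) + (- c / m) *\<^sub>R (LINT x|triangle_measure v a b. f x)"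
        using ne Fv(1) Fu(1) by (simp add: w_def)
      also have "\<dots> = (LINT x|lebesgue_on ?K. f' x (u - v))"
        unfolding c[OF f] integral_triangle_measure[OF meas] using n
        by (simp add: n_def[symmetric] m_def[symmetric] scaleR_diff_right)
      finally show ?thesis ..
    qed
    then show ?thesis unfolding G_def by blast
  qed
  have "G e" for e
  proof -
    have "S \<noteq> {}" using S by (auto simp: tetrahedron_vertices_def)
    then obtain v0 where v0: "v0 \<in> S" by blast
    have "card (S - {v0}) = 3" using v0 S finS by (simp add: tetrahedron_vertices_def)
    then obtain v1 v2 v3 where 123: "S - {v0} = {v1, v2, v3}" "v1 \<noteq> v2" "v2 \<noteq> v3" "v1 \<noteq> v3"
      by (auto simp: card_3_iff)
    then have S4: "S = {v0, v1, v2, v3}" and ne: "v1 \<noteq> v0" "v2 \<noteq> v0" "v3 \<noteq> v0" using v0 by auto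
    let ?g = "\<lambda>x :: real^3. x $ 1 *\<^sub>R (v1 - v0) + x $ 2 *\<^sub>R (v2 - v0) + x $ 3 *\<^sub>R (v3 - v0)"
    have "surj ?g"
      using S S4 by (intro linear_injective_imp_surjective linear_edge_map inj_edge_map)
        (simp_all add: tetrahedron_vertices_def)
    then obtain x where e: "e = ?g x" by (rule surjE)
    have "G (v1 - v0)" "G (v2 - v0)" "G (v3 - v0)"
      using ne S4 by (auto intro!: Gedge)
    then have "G (1 *\<^sub>R (x $ 1 *\<^sub>R (v1 - v0) + x $ 2 *\<^sub>R (v2 - v0)) + x $ 3 *\<^sub>R (v3 - v0))"
      by (intro Gadd)
    then show "G e" using e by simp
  qed
  then have "\<forall>j. \<exists>w :: (real^3) set \<Rightarrow> real. \<forall>(f :: real^3 \<Rightarrow> 'b) f'. C1 f f' \<longrightarrow>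
    (LINT x|lebesgue_on ?K. f' x (axis j 1)) = (\<Sum>F\<in>?\<F>. w F *\<^sub>R (LINT x|surface_measure F. f x))"
    unfolding G_def ..
  from choice[OF this] obtain w :: "3 \<Rightarrow> (real^3) set \<Rightarrow> real" where
    w: "\<forall>j. \<forall>(f :: real^3 \<Rightarrow> 'b) f'. C1 f f' \<longrightarrow>
    (LINT x|lebesgue_on ?K. f' x (axis j 1)) = (\<Sum>F\<in>?\<F>. w j F *\<^sub>R (LINT x|surface_measure F. f x))"
    ..
  show ?thesis
    using w by (intro exI[of _ "\<lambda>F. \<chi> j. w j F"]) (simp only: vec_lambda_beta, blast)
qed

section \<open>Polynomials\<close>

lemma finite_multi_indices: "finite {\<alpha> :: 3 \<Rightarrow> nat. (\<Sum>i\<in>UNIV. \<alpha> i) \<le> k}"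
proof (rule finite_subset)
  show "{\<alpha> :: 3 \<Rightarrow> nat. (\<Sum>i\<in>UNIV. \<alpha> i) \<le> k} \<subseteq> PiE UNIV (\<lambda>_. {..k})"
  proof
    fix \<alpha> :: "3 \<Rightarrow> nat" assume a: "\<alpha> \<in> {\<alpha>. (\<Sum>i\<in>UNIV. \<alpha> i) \<le> k}"
    have "\<alpha> j \<le> (\<Sum>i\<in>UNIV. \<alpha> i)" for j
      by (rule member_le_sum) auto
    then show "\<alpha> \<in> PiE UNIV (\<lambda>_. {..k})"
      using a by (auto simp: PiE_UNIV_domain intro: order_trans)
  qed
qed (auto intro!: finite_PiE)

lemma poly_on_extend:
  assumes "f \<in> poly_on k S V"
  obtains p where "p \<in> poly_on k UNIV V" "\<And>x. x \<in> S \<Longrightarrow> f x = p x"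
proof -
  obtain c where c: "\<forall>\<alpha>. c \<alpha> \<in> V"
    "\<forall>x\<in>S. f x = (\<Sum>\<alpha> | (\<Sum>i\<in>UNIV. \<alpha> i) \<le> k. (\<Prod>i\<in>UNIV. (x $ i) ^ \<alpha> i) *\<^sub>R c \<alpha>)"
    using assms unfolding poly_on_def mem_Collect_eq by (elim exE conjE)
  show thesis
  proof (rule that)
    show "(\<lambda>x. \<Sum>\<alpha> | (\<Sum>i\<in>UNIV. \<alpha> i) \<le> k. (\<Prod>i\<in>UNIV. (x $ i) ^ \<alpha> i) *\<^sub>R c \<alpha>) \<in> poly_on k UNIV V"
      unfolding poly_on_def mem_Collect_eq by (intro exI[of _ c] conjI c(1)) simp
  qed (use c(2) in blast)
qed

lemma poly_on_subset:
  assumes "p \<in> poly_on k S V" "\<And>x. x \<in> T \<Longrightarrow> f x = p x" "T \<subseteq> S"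
  shows "f \<in> poly_on k T V"
proof -
  obtain c where c: "\<forall>\<alpha>. c \<alpha> \<in> V"
    "\<forall>x\<in>S. p x = (\<Sum>\<alpha> | (\<Sum>i\<in>UNIV. \<alpha> i) \<le> k. (\<Prod>i\<in>UNIV. (x $ i) ^ \<alpha> i) *\<^sub>R c \<alpha>)"
    using assms(1) unfolding poly_on_def mem_Collect_eq by (elim exE conjE)
  then show ?thesis
    unfolding poly_on_def mem_Collect_eq
    by (intro exI[of _ c]) (use assms(2,3) in auto)
qed

lemma monomial_in_poly_on:
  assumes "(\<Sum>i\<in>UNIV. \<alpha> i) \<le> k" "c \<in> V" "0 \<in> V"
  shows "(\<lambda>x. (\<Prod>i\<in>UNIV. (x $ i) ^ \<alpha> i) *\<^sub>R c) \<in> poly_on k S V"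
proof -
  have "(\<Sum>\<beta> | (\<Sum>i\<in>UNIV. \<beta> i) \<le> k. (\<Prod>i\<in>UNIV. (x $ i) ^ \<beta> i) *\<^sub>R (if \<beta> = \<alpha> then c else 0))
      = (\<Prod>i\<in>UNIV. (x $ i) ^ \<alpha> i) *\<^sub>R c" for x :: "real^3"
    using assms(1) by (subst sum.mono_neutral_right[of _ "{\<alpha>}"]) (auto simp: finite_multi_indices)
  then show ?thesis
    unfolding poly_on_def using assms(2,3)
    by (intro CollectI exI[of _ "\<lambda>\<beta>. if \<beta> = \<alpha> then c else 0"]) auto
qed

lemma zero_in_poly_on: "0 \<in> V \<Longrightarrow> (\<lambda>x. 0) \<in> poly_on k S V"
  using monomial_in_poly_on[of "\<lambda>_. 0" k 0 V S] by simp

lemma poly_on_add: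
  assumes "subspace V" "f \<in> poly_on k S V" "g \<in> poly_on k S V"
  shows "(\<lambda>x. f x + g x) \<in> poly_on k S V"
proof -
  obtain c where c: "\<And>\<alpha>. c \<alpha> \<in> V"
    "\<And>x. x \<in> S \<Longrightarrow> f x = (\<Sum>\<alpha> | (\<Sum>i\<in>UNIV. \<alpha> i) \<le> k. (\<Prod>i\<in>UNIV. (x $ i) ^ \<alpha> i) *\<^sub>R c \<alpha>)"
    using assms(2) unfolding poly_on_def by blast
  obtain d where d: "\<And>\<alpha>. d \<alpha> \<in> V"
    "\<And>x. x \<in> S \<Longrightarrow> g x = (\<Sum>\<alpha> | (\<Sum>i\<in>UNIV. \<alpha> i) \<le> k. (\<Prod>i\<in>UNIV. (x $ i) ^ \<alpha> i) *\<^sub>R d \<alpha>)"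
    using assms(3) unfolding poly_on_def by blast
  show ?thesis
    unfolding poly_on_def using c d assms(1)
    by (intro CollectI exI[of _ "\<lambda>\<alpha>. c \<alpha> + d \<alpha>"])
      (auto simp: subspace_add scaleR_add_right sum.distrib)
qed

lemma poly_on_sum:
  assumes "subspace V" "finite I" "\<And>i. i \<in> I \<Longrightarrow> f i \<in> poly_on k S V"
  shows "(\<lambda>x. \<Sum>i\<in>I. f i x) \<in> poly_on k S V"
  using assms(2,3)
  by (induction I rule: finite_induct)
    (auto intro!: zero_in_poly_on poly_on_add[OF assms(1)] subspace_0[OF assms(1)])

lemma poly_on_linear:
  assumes L: "linear L" and V: "\<And>v. v \<in> V \<Longrightarrow> L v \<in> W" and f: "f \<in> poly_on k S V"
  shows "(\<lambda>x. L (f x)) \<in> poly_on k S W"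
proof -
  obtain c where c: "\<And>\<alpha>. c \<alpha> \<in> V"
    "\<And>x. x \<in> S \<Longrightarrow> f x = (\<Sum>\<alpha> | (\<Sum>i\<in>UNIV. \<alpha> i) \<le> k. (\<Prod>i\<in>UNIV. (x $ i) ^ \<alpha> i) *\<^sub>R c \<alpha>)"
    using f unfolding poly_on_def by blast
  show ?thesis
    unfolding poly_on_def using c V
    by (intro CollectI exI[of _ "\<lambda>\<alpha>. L (c \<alpha>)"]) (auto simp: linear_sum[OF L] linear_cmul[OF L])
qed

lemma poly_on_degree_mono:
  assumes "subspace V" "k \<le> l" "f \<in> poly_on k S V"
  shows "f \<in> poly_on l S V"
proof -
  obtain c where c: "\<And>\<alpha>. c \<alpha> \<in> V"
    "\<And>x. x \<in> S \<Longrightarrow> f x = (\<Sum>\<alpha> | (\<Sum>i\<in>UNIV. \<alpha> i) \<le> k. (\<Prod>i\<in>UNIV. (x $ i) ^ \<alpha> i) *\<^sub>R c \<alpha>)"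
    using assms(3) unfolding poly_on_def by blast
  have "(\<lambda>x. \<Sum>\<alpha> | (\<Sum>i\<in>UNIV. \<alpha> i) \<le> k. (\<Prod>i\<in>UNIV. (x $ i) ^ \<alpha> i) *\<^sub>R c \<alpha>) \<in> poly_on l S V"
    using assms(1,2) c(1)
    by (intro poly_on_sum monomial_in_poly_on finite_multi_indices) (auto intro: subspace_0)
  then show ?thesis
    by (rule poly_on_subset) (use c in auto)
qed

lemma has_derivative_monomial:
  fixes \<alpha> :: "3 \<Rightarrow> nat" and c :: "'b::real_normed_vector"
  shows "((\<lambda>x. (\<Prod>i\<in>UNIV. (x $ i) ^ \<alpha> i) *\<^sub>R c) has_derivative
    (\<lambda>h. (\<Sum>i\<in>UNIV. (of_nat (\<alpha> i) * (h $ i) * (x $ i) ^ (\<alpha> i - 1)) * (\<Prod>l\<in>UNIV - {i}. (x $ l) ^ \<alpha> l)) *\<^sub>R c))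
    (at x)"
  by (intro has_derivative_scaleR_left has_derivative_prod has_derivative_power
      bounded_linear_imp_has_derivative bounded_linear_vec_nth)

text \<open>For \<open>\<alpha> j = 0\<close> the truncated exponent \<open>\<alpha> j - 1\<close> is wrong, but then the factor \<open>\<alpha> j\<close> vanishes.\<close>

lemma pd_monomial:
  fixes c :: "'b::real_normed_vector" and \<alpha> :: "3 \<Rightarrow> nat"
  shows "pd j (\<lambda>x. (\<Prod>i\<in>UNIV. (x $ i) ^ \<alpha> i) *\<^sub>R c) x
    = (\<Prod>i\<in>UNIV. (x $ i) ^ (\<alpha>(j := \<alpha> j - 1)) i) *\<^sub>R (of_nat (\<alpha> j) *\<^sub>R c)"
proof -
  have "pd j (\<lambda>x. (\<Prod>i\<in>UNIV. (x $ i) ^ \<alpha> i) *\<^sub>R c) x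
     = (\<Sum>i\<in>UNIV. (of_nat (\<alpha> i) * (axis j 1 $ i) * (x $ i) ^ (\<alpha> i - 1)) * (\<Prod>l\<in>UNIV - {i}. (x $ l) ^ \<alpha> l)) *\<^sub>R c"
    unfolding pd_def by (subst frechet_derivative_at[OF has_derivative_monomial, symmetric]) simp
  also have "(\<Sum>i\<in>UNIV. (of_nat (\<alpha> i) * (axis j 1 $ i) * (x $ i) ^ (\<alpha> i - 1)) * (\<Prod>l\<in>UNIV - {i}. (x $ l) ^ \<alpha> l))
     = of_nat (\<alpha> j) * ((x $ j) ^ (\<alpha> j - 1) * (\<Prod>l\<in>UNIV - {j}. (x $ l) ^ \<alpha> l))"
    by (subst sum.mono_neutral_right[of _ "{j}"]) (auto simp: axis_def)
  also have "(x $ j) ^ (\<alpha> j - 1) * (\<Prod>l\<in>UNIV - {j}. (x $ l) ^ \<alpha> l)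
     = (\<Prod>i\<in>UNIV. (x $ i) ^ (\<alpha>(j := \<alpha> j - 1)) i)"
    by (subst (2) prod.remove[of _ j]) auto
  finally show ?thesis by (simp add: mult.commute)
qed

lemma pd_eqI: "(f has_derivative f') (at x) \<Longrightarrow> pd j f x = f' (axis j 1)"
  by (simp add: pd_def frechet_derivative_at[symmetric])

lemma
  fixes p :: "real^3 \<Rightarrow> 'b::real_normed_vector"
  assumes V: "subspace V" and p: "p \<in> poly_on k UNIV V"
  shows differentiable_poly: "p differentiable (at x)"
    and pd_poly: "pd j p \<in> poly_on (k - 1) UNIV V"
proof -
  obtain c where c: "\<And>\<alpha>. c \<alpha> \<in> V"
    and p': "p = (\<lambda>x. \<Sum>\<alpha> | (\<Sum>i\<in>UNIV. \<alpha> i) \<le> k. (\<Prod>i\<in>UNIV. (x $ i) ^ \<alpha> i) *\<^sub>R c \<alpha>)"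
    using p unfolding poly_on_def by auto
  let ?m' = "\<lambda>\<alpha> x h. (\<Sum>i\<in>UNIV. (of_nat (\<alpha> i) * (h $ i) * (x $ i) ^ (\<alpha> i - 1)) * (\<Prod>l\<in>UNIV - {i}. (x $ l) ^ \<alpha> l)) *\<^sub>R c \<alpha>"
  have d: "(p has_derivative (\<lambda>h. \<Sum>\<alpha> | (\<Sum>i\<in>UNIV. \<alpha> i) \<le> k. ?m' \<alpha> x h)) (at x)" for x
    unfolding p' by (intro has_derivative_sum has_derivative_monomial)
  then show "p differentiable (at x)"
    unfolding differentiable_def by blast
  have "pd j p x = (\<Sum>\<alpha> | (\<Sum>i\<in>UNIV. \<alpha> i) \<le> k. (\<Prod>i\<in>UNIV. (x $ i) ^ (\<alpha>(j := \<alpha> j - 1)) i) *\<^sub>R (of_nat (\<alpha> j) *\<^sub>R c \<alpha>))" for x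
    unfolding pd_eqI[OF d] pd_monomial[symmetric] pd_eqI[OF has_derivative_monomial] ..
  then have eq: "pd j p = (\<lambda>x. \<Sum>\<alpha> | (\<Sum>i\<in>UNIV. \<alpha> i) \<le> k. (\<Prod>i\<in>UNIV. (x $ i) ^ (\<alpha>(j := \<alpha> j - 1)) i) *\<^sub>R (of_nat (\<alpha> j) *\<^sub>R c \<alpha>))"
    by blast
  have "(\<lambda>x. (\<Prod>i\<in>UNIV. (x $ i) ^ (\<alpha>(j := \<alpha> j - 1)) i) *\<^sub>R (of_nat (\<alpha> j) *\<^sub>R c \<alpha>)) \<in> poly_on (k - 1) UNIV V"
    if \<alpha>: "(\<Sum>i\<in>UNIV. \<alpha> i) \<le> k" for \<alpha>
  proof (cases "\<alpha> j = 0")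
    case True
    then show ?thesis using zero_in_poly_on[OF subspace_0[OF V]] by simp
  next
    case False
    have "(\<Sum>i\<in>UNIV. \<alpha> i) = \<alpha> j + (\<Sum>i\<in>UNIV - {j}. \<alpha> i)"
      by (rule sum.remove) auto
    moreover have "(\<Sum>i\<in>UNIV. (\<alpha>(j := \<alpha> j - 1)) i) = \<alpha> j - 1 + (\<Sum>i\<in>UNIV - {j}. \<alpha> i)"
      by (subst sum.remove[of _ j]) auto
    ultimately have "(\<Sum>i\<in>UNIV. (\<alpha>(j := \<alpha> j - 1)) i) \<le> k - 1"
      using \<alpha> False by linarith
    then show ?thesis
      using V c by (intro monomial_in_poly_on) (auto simp: subspace_scale subspace_0)
  qed
  then show "pd j p \<in> poly_on (k - 1) UNIV V"
    unfolding eq by (intro poly_on_sum V finite_multi_indices) auto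
qed

lemma continuous_on_poly:
  fixes p :: "real^3 \<Rightarrow> 'b::real_normed_vector"
  assumes "p \<in> poly_on k UNIV V"
  shows "continuous_on S p"
proof -
  have "p \<in> poly_on k UNIV UNIV" using assms unfolding poly_on_def by blast
  then show ?thesis
    using differentiable_poly[OF subspace_UNIV] by (meson continuous_at_imp_continuous_on differentiable_imp_continuous_within)
qed

lemma smooth_poly:
  fixes p :: "real^3 \<Rightarrow> 'b::real_normed_vector"
  assumes "p \<in> poly_on k UNIV UNIV"
  shows "smooth p"
proof -
  have "C_diff n p" for n
    using assms
  proof (induction n arbitrary: k p)
    case 0
    then show ?case using continuous_on_poly by auto
  next
    case (Suc n)
    then show ?case
      using Suc.IH[OF pd_poly[OF subspace_UNIV Suc.prems]] differentiable_poly[OF subspace_UNIV Suc.prems]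
      by simp
  qed
  then show ?thesis by (simp add: smooth_def)
qed

lemma smooth_imp_C1:
  assumes "smooth f"
  shows "C1 f (\<lambda>x. frechet_derivative f (at x))"
proof -
  have "C_diff 1 f" using assms smooth_def by blast
  then have d: "\<And>x. f differentiable (at x)" and c: "\<And>j. continuous_on UNIV (pd j f)"
    by auto
  have D: "(f has_derivative frechet_derivative f (at x)) (at x)" for x
    using d frechet_derivative_works by blast
  have "frechet_derivative f (at x) e = (\<Sum>j\<in>UNIV. e $ j *\<^sub>R pd j f x)" for x e
  proof -
    interpret linear "frechet_derivative f (at x)"
      using D by (rule has_derivative_linear)
    have "e = (\<Sum>j\<in>UNIV. e $ j *\<^sub>R axis j 1)"
      using basis_expansion[of e] by (simp add: scalar_mult_eq_scaleR)
    then have "frechet_derivative f (at x) e = frechet_derivative f (at x) (\<Sum>j\<in>UNIV. e $ j *\<^sub>R axis j 1)"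
      by simp
    then show ?thesis by (simp add: sum scale pd_def)
  qed
  then have "continuous_on UNIV (\<lambda>x. frechet_derivative f (at x) e)" for e
    using c by (simp add: continuous_on_sum continuous_on_scaleR)
  then show ?thesis using D by (simp add: C1_def)
qed

lemma C1_bounded_linear:
  assumes "bounded_linear L" "C1 f f'"
  shows "C1 (\<lambda>x. L (f x)) (\<lambda>x e. L (f' x e))"
  using assms unfolding C1_def
  by (auto intro: bounded_linear.has_derivative bounded_linear.continuous_on)

lemma C1_bounded_bilinear:
  assumes B: "bounded_bilinear B" and f: "C1 f f'" and g: "C1 g g'"
  shows "C1 (\<lambda>x. B (f x) (g x)) (\<lambda>x e. B (f x) (g' x e) + B (f' x e) (g x))"
  using f g C1_imp_continuous[OF f] C1_imp_continuous[OF g] unfolding C1_def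
  by (auto intro!: bounded_bilinear.FDERIV[OF B] continuous_on_add bounded_bilinear.continuous_on[OF B])

lemma subspace_sym_mat: "subspace (sym_mat :: (complex^3^3) set)"
  by (auto simp: subspace_def sym_mat_def transpose_def vec_eq_iff)

lemma linear_sym_part: "linear sym_part"
  by (auto intro!: linearI simp: sym_part_def vec_eq_iff transpose_def algebra_simps)

lemma sym_part_in_sym_mat: "sym_part G \<in> sym_mat"
  by (simp add: sym_mat_def sym_part_def vec_eq_iff transpose_def add.commute)

lemma sym_part_grad_poly:
  assumes p: "p \<in> poly_on (k + 1) UNIV UNIV"
  shows "(\<lambda>x. grad p x) \<in> poly_on k UNIV UNIV" "(\<lambda>x. sym_part (grad p x)) \<in> poly_on k UNIV sym_mat"
proof -
  define L :: "3 \<Rightarrow> complex^3 \<Rightarrow> complex^3^3" where "L j v = (\<chi> i l. if l = j then v $ i else 0)" for j v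
  have L: "linear (L j)" for j
    by (auto intro!: linearI simp: L_def vec_eq_iff)
  have eq: "grad p x = (\<Sum>j\<in>UNIV. L j (pd j p x))" for x
    by (simp add: grad_def L_def vec_eq_iff)
  show *: "(\<lambda>x. grad p x) \<in> poly_on k UNIV UNIV"
    unfolding eq using pd_poly[OF subspace_UNIV p]
    by (intro poly_on_sum subspace_UNIV) (auto intro!: poly_on_linear[OF L, of UNIV])
  show "(\<lambda>x. sym_part (grad p x)) \<in> poly_on k UNIV sym_mat"
    by (rule poly_on_linear[OF linear_sym_part sym_part_in_sym_mat *])
qed

section \<open>Functions on the boundary of a tetrahedron\<close>

text \<open>The surface measures and the Lebesgue measure on an element are complete. So a function that is
  known only up to a null set inherits measurability and integrals from any representative.\<close>

lemma (in complete_measure) borel_measurable_AE_cong: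
  assumes f: "f \<in> borel_measurable M" and eq: "AE x in M. f x = g x"
  shows "g \<in> borel_measurable M"
proof (rule measurableI)
  fix A :: "'b set" assume A: "A \<in> sets borel"
  show "g -` A \<inter> space M \<in> sets M"
  proof (rule in_sets_AE)
    show "AE x in M. x \<in> f -` A \<inter> space M \<longleftrightarrow> x \<in> g -` A \<inter> space M"
      using eq by eventually_elim auto
    show "f -` A \<inter> space M \<in> sets M" using f A by (rule measurable_sets)
  qed auto
qed auto

lemma AE_eq_imp_integral_eq:
  fixes f g :: "'a \<Rightarrow> 'b::{banach, second_countable_topology}"
  assumes "complete_measure M" "integrable M f" "AE x in M. f x = g x"
  shows "integrable M g" "integral\<^sup>L M f = integral\<^sup>L M g"
proof -
  have "g \<in> borel_measurable M"
    by (rule complete_measure.borel_measurable_AE_cong[OF assms(1) borel_measurable_integrable[OF assms(2)] assms(3)])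
  then show "integrable M g" "integral\<^sup>L M f = integral\<^sup>L M g"
    using assms by (auto intro: integrable_cong_AE_imp integral_cong_AE elim: AE_mp)
qed

text \<open>Gram--Schmidt without linear independence: the residual of a new function may vanish almost
  everywhere, and then its coefficient is \<open>0\<close> because division by zero yields zero.\<close>

lemma L2_projection_exists:
  fixes b :: "'i \<Rightarrow> 'a::topological_space \<Rightarrow> 'b::euclidean_space"
  assumes "finite I"
    and int: "\<And>f :: 'a \<Rightarrow> real. continuous_on UNIV f \<Longrightarrow> integrable M f"
    and b: "\<And>i. i \<in> I \<Longrightarrow> continuous_on UNIV (b i)"
    and u: "continuous_on UNIV u"
  shows "\<exists>c. \<forall>i\<in>I. (LINT x|M. (u x - (\<Sum>l\<in>I. c l *\<^sub>R b l x)) \<bullet> b i x) = 0"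
  using assms(1) b u
proof (induction I arbitrary: u rule: finite_induct)
  case empty
  then show ?case by simp
next
  case (insert n I)
  note bI = insert.prems(1) and u = insert.prems(2)
  obtain d where d: "\<And>i. i \<in> I \<Longrightarrow> (LINT x|M. (b n x - (\<Sum>l\<in>I. d l *\<^sub>R b l x)) \<bullet> b i x) = 0"
    using insert.IH[of "b n"] bI by blast
  obtain c where c: "\<And>i. i \<in> I \<Longrightarrow> (LINT x|M. (u x - (\<Sum>l\<in>I. c l *\<^sub>R b l x)) \<bullet> b i x) = 0"
    using insert.IH[of u] bI u by blast
  define r where "r x = b n x - (\<Sum>l\<in>I. d l *\<^sub>R b l x)" for x
  define e where "e x = u x - (\<Sum>l\<in>I. c l *\<^sub>R b l x)" for x
  have cont_b: "continuous_on UNIV (b i)" if "i \<in> insert n I" for i using bI that .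
  have cont_r: "continuous_on UNIV r" and cont_e: "continuous_on UNIV e"
    unfolding r_def e_def using cont_b u by (auto intro!: continuous_intros)
  have int': "integrable M (\<lambda>x. f x \<bullet> g x)" if "continuous_on UNIV f" "continuous_on UNIV g"
    for f g :: "'a \<Rightarrow> 'b"
    using that by (intro int continuous_intros)
  \<comment> \<open>the coefficient of the residual \<open>r\<close> of \<open>b n\<close> in the residual \<open>e\<close> of \<open>u\<close>\<close>
  define t where "t = (LINT x|M. e x \<bullet> r x) / (LINT x|M. r x \<bullet> r x)"
  define h where "h x = e x - t *\<^sub>R r x" for x
  have cont_h: "continuous_on UNIV h"
    unfolding h_def by (intro continuous_intros cont_e cont_r)
  have hI: "(LINT x|M. h x \<bullet> b i x) = 0" if "i \<in> I" for i
  proof -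
    have "(LINT x|M. h x \<bullet> b i x) = (LINT x|M. e x \<bullet> b i x) - t * (LINT x|M. r x \<bullet> b i x)"
      using that cont_b[of i] by (simp add: h_def inner_diff_left int' cont_e cont_r)
    then show ?thesis using c[OF that] d[OF that] by (simp add: e_def r_def)
  qed
  have er: "(LINT x|M. e x \<bullet> r x) = 0" if "(LINT x|M. r x \<bullet> r x) = 0"
  proof -
    have "AE x in M. r x \<bullet> r x = 0"
      using that integral_nonneg_eq_0_iff_AE[OF int'[OF cont_r cont_r]] by simp
    then have "AE x in M. e x \<bullet> r x = 0" by eventually_elim simp
    then show ?thesis by (rule integral_eq_zero_AE)
  qed
  have "(LINT x|M. h x \<bullet> r x) = (LINT x|M. e x \<bullet> r x) - t * (LINT x|M. r x \<bullet> r x)"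
    by (simp add: h_def inner_diff_left int' cont_e cont_r)
  then have hr: "(LINT x|M. h x \<bullet> r x) = 0"
    using er by (auto simp: t_def)
  have hn: "(LINT x|M. h x \<bullet> b n x) = 0"
  proof -
    have "h x \<bullet> b n x = h x \<bullet> r x + (\<Sum>l\<in>I. d l * (h x \<bullet> b l x))" for x
      by (simp add: r_def inner_diff_right inner_sum_right)
    then have "(LINT x|M. h x \<bullet> b n x) = (LINT x|M. h x \<bullet> r x) + (\<Sum>l\<in>I. d l * (LINT x|M. h x \<bullet> b l x))"
      using cont_b by (simp add: int' cont_h cont_r)
    then show ?thesis using hr hI by simp
  qed
  define c' where "c' l = (if l = n then t else c l - t * d l)" for l
  have "u x - (\<Sum>l\<in>insert n I. c' l *\<^sub>R b l x) = h x" for x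
  proof -
    have "(\<Sum>l\<in>I. c' l *\<^sub>R b l x) = (\<Sum>l\<in>I. c l *\<^sub>R b l x - t *\<^sub>R d l *\<^sub>R b l x)"
      using insert.hyps(2) by (intro sum.cong) (auto simp: c'_def algebra_simps)
    then show ?thesis
      using insert.hyps by (simp add: c'_def h_def e_def r_def sum_subtractf scaleR_sum_right algebra_simps)
  qed
  then show ?case using hI hn by (intro exI[of _ c']) auto
qed

lemma poly_projection_exists:
  fixes u :: "real^3 \<Rightarrow> 'b::euclidean_space"
  assumes int: "\<And>f :: real^3 \<Rightarrow> real. continuous_on UNIV f \<Longrightarrow> integrable M f"
    and u: "continuous_on UNIV u"
  shows "\<exists>p\<in>poly_on k UNIV UNIV. \<forall>q\<in>poly_on k UNIV UNIV. (LINT x|M. (u x - p x) \<bullet> q x) = 0"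
proof -
  define I where "I = {\<alpha> :: 3 \<Rightarrow> nat. (\<Sum>i\<in>UNIV. \<alpha> i) \<le> k} \<times> (Basis :: 'b set)"
  define b where "b = (\<lambda>(\<alpha> :: 3 \<Rightarrow> nat, v :: 'b) x :: real^3. (\<Prod>i\<in>UNIV. (x $ i) ^ \<alpha> i) *\<^sub>R v)"
  have fin: "finite I" by (simp add: I_def finite_multi_indices)
  have b_poly: "b i \<in> poly_on k UNIV UNIV" if "i \<in> I" for i
    using that by (auto simp: I_def b_def intro!: monomial_in_poly_on)
  have cont_b: "continuous_on UNIV (b i)" if "i \<in> I" for i
    using b_poly[OF that] by (rule continuous_on_poly)
  obtain c where c: "\<And>i. i \<in> I \<Longrightarrow> (LINT x|M. (u x - (\<Sum>l\<in>I. c l *\<^sub>R b l x)) \<bullet> b i x) = 0"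
    using L2_projection_exists[of I M b u, OF fin int cont_b u] by blast
  define p where "p x = (\<Sum>l\<in>I. c l *\<^sub>R b l x)" for x
  have p: "p \<in> poly_on k UNIV UNIV"
    unfolding p_def
    by (intro poly_on_sum subspace_UNIV fin poly_on_linear[OF linear_scaleR _ b_poly]) auto
  have "(LINT x|M. (u x - p x) \<bullet> q x) = 0" if "q \<in> poly_on k UNIV UNIV" for q
  proof -
    obtain a where a: "\<And>x. q x = (\<Sum>\<alpha> | (\<Sum>i\<in>UNIV. \<alpha> i) \<le> k. (\<Prod>i\<in>UNIV. (x $ i) ^ \<alpha> i) *\<^sub>R a \<alpha>)"
      using \<open>q \<in> poly_on k UNIV UNIV\<close> unfolding poly_on_def by auto
    have "(\<Prod>i\<in>UNIV. (x $ i) ^ \<alpha> i) *\<^sub>R a \<alpha> = (\<Sum>v\<in>Basis. (a \<alpha> \<bullet> v) *\<^sub>R b (\<alpha>, v) x)" for x \<alpha>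
    proof -
      have "a \<alpha> = (\<Sum>v\<in>Basis. (a \<alpha> \<bullet> v) *\<^sub>R v)" by (simp add: euclidean_representation)
      then have "(\<Prod>i\<in>UNIV. (x $ i) ^ \<alpha> i) *\<^sub>R a \<alpha> = (\<Prod>i\<in>UNIV. (x $ i) ^ \<alpha> i) *\<^sub>R (\<Sum>v\<in>Basis. (a \<alpha> \<bullet> v) *\<^sub>R v)"
        by (rule arg_cong)
      then show ?thesis by (simp add: b_def scaleR_sum_right mult.commute)
    qed
    then have "q x = (\<Sum>i\<in>I. (a (fst i) \<bullet> snd i) *\<^sub>R b i x)" for x
      unfolding a I_def by (simp add: sum.cartesian_product split_beta)
    then have "(LINT x|M. (u x - p x) \<bullet> q x) = (\<Sum>i\<in>I. (a (fst i) \<bullet> snd i) * (LINT x|M. (u x - p x) \<bullet> b i x))"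
      using u continuous_on_poly[OF p] cont_b
      by (simp add: inner_sum_right int continuous_on_inner continuous_on_diff)
    then show ?thesis using c by (simp add: p_def)
  qed
  then show ?thesis using p by blast
qed

locale tetrahedron =
  fixes S :: "(real^3) set"
  assumes vertices: "tetrahedron_vertices S"
begin

abbreviation "K \<equiv> convex hull S"

lemma finite_facets: "finite {F. F facet_of K}"
  by (rule finite_facets_tetrahedron[OF vertices])

lemma compact_K: "compact K"
proof -
  have "finite S" using vertices card.infinite by (fastforce simp: tetrahedron_vertices_def)
  then show ?thesis by (rule finite_imp_compact_convex_hull)
qed

text \<open>The second face serves to number the vertices: \<open>a\<close> is the vertex of \<open>F\<close> that is opposite to the
  common edge, and \<open>A\<close> is the plane of \<open>F'\<close>.\<close>

lemma facet_triangle: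
  assumes F: "F facet_of K" and F': "F' facet_of K" "F' \<noteq> F"
  obtains a b c A where "F = convex hull {a, b, c}" "surface_measure F = triangle_measure a b c"
    "affine A" "F' \<subseteq> A" "b \<in> A" "c \<in> A" "a \<notin> A"
proof -
  obtain v where v: "v \<in> S" "F = convex hull (S - {v})"
    using F facet_of_tetrahedron_iff[OF vertices] by blast
  obtain u where u: "u \<in> S" "F' = convex hull (S - {u})"
    using F' facet_of_tetrahedron_iff[OF vertices] by blast
  have "u \<noteq> v" using F'(2) u v by blast
  then obtain a b where ab: "S = {v, u, a, b}" "card {v, u, a, b} = 4"
    using tetrahedron_vertices_cases[OF vertices v(1) u(1)] by metis
  have ne: "v \<noteq> u" "v \<noteq> a" "v \<noteq> b" "u \<noteq> a" "u \<noteq> b" "a \<noteq> b"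
    using ab(2) by (auto simp: card_insert_if split: if_splits)
  show thesis
  proof (rule that[of u a b "affine hull (S - {u})"])
    show "F = convex hull {u, a, b}" "surface_measure F = triangle_measure u a b"
      using surface_measure_face[OF vertices ab(1)] v(2) by simp_all
    show "F' \<subseteq> affine hull (S - {u})"
      unfolding u(2) by (rule convex_hull_subset_affine_hull)
    show "a \<in> affine hull (S - {u})" "b \<in> affine hull (S - {u})"
      using ne unfolding ab(1) by (auto intro!: hull_inc)
    show "u \<notin> affine hull (S - {u})"
      using vertices u(1) unfolding tetrahedron_vertices_def affine_dependent_def by blast
  qed (rule affine_affine_hull)
qed

lemma facet_triangle_measure:
  assumes F: "F facet_of K"
  obtains a b c where "F = convex hull {a, b, c}" "surface_measure F = triangle_measure a b c"
proof -
  obtain v where v: "v \<in> S" "F = convex hull (S - {v})"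
    using F facet_of_tetrahedron_iff[OF vertices] by blast
  have "S \<noteq> {v}" using vertices by (auto simp: tetrahedron_vertices_def)
  then obtain u where u: "u \<in> S" "u \<noteq> v" using v(1) by blast
  have "convex hull (S - {u}) \<noteq> F"
  proof
    assume "convex hull (S - {u}) = F"
    then have "u \<in> convex hull (S - {u})" using u v(2) by (metis Diff_iff hull_inc singletonD)
    then show False using vertices u(1) convex_hull_subset_affine_hull[of "S - {u}"]
      unfolding tetrahedron_vertices_def affine_dependent_def by blast
  qed
  moreover have "convex hull (S - {u}) facet_of K"
    using facet_of_tetrahedron_iff[OF vertices] u(1) by blast
  ultimately show thesis using facet_triangle[OF F] that by metis
qed

lemma complete_face: "F facet_of K \<Longrightarrow> complete_measure (surface_measure F)"
  by (elim facet_triangle_measure) (auto simp: triangle_measure_def intro: completion.complete_measure_axioms)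

lemma AE_in_face: "F facet_of K \<Longrightarrow> AE x in surface_measure F. x \<in> F"
  by (elim facet_triangle_measure) (use AE_in_triangle in metis)

lemma AE_not_in_other_face:
  assumes "F facet_of K" "F' facet_of K" "F' \<noteq> F"
  shows "AE x in surface_measure F. x \<notin> F'"
proof -
  obtain a b c A where A: "surface_measure F = triangle_measure a b c"
    "affine A" "F' \<subseteq> A" "b \<in> A" "c \<in> A" "a \<notin> A"
    using facet_triangle[OF assms] by metis
  have "AE x in surface_measure F. x \<notin> A"
    unfolding A(1) by (rule AE_triangle_not_in_affine[OF A(2,4,5,6)])
  then show ?thesis by eventually_elim (use A(3) in blast)
qed

lemma integrable_continuous_face:
  fixes f :: "real^3 \<Rightarrow> 'b::euclidean_space"
  assumes "F facet_of K" "continuous_on UNIV f"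
  shows "integrable (surface_measure F) f"
  by (rule facet_triangle_measure[OF assms(1)]) (simp add: integrable_continuous_triangle[OF assms(2)])

text \<open>Since two faces meet in a null set of either, functions given on the faces separately are
  the restrictions of one function.\<close>

lemma glue_faces:
  fixes p :: "(real^3) set \<Rightarrow> real^3 \<Rightarrow> 'b"
  shows "\<exists>\<mu>. \<forall>F. F facet_of K \<longrightarrow> (AE x in surface_measure F. \<mu> x = p F x)"
proof (intro exI allI impI)
  fix F assume F: "F facet_of K"
  have "AE x in surface_measure F. \<forall>F'\<in>{F'. F' facet_of K} - {F}. x \<notin> F'"
    by (rule AE_finite_allI) (use finite_facets AE_not_in_other_face[OF F] in auto)
  with AE_in_face[OF F] show "AE x in surface_measure F. p (SOME F. F facet_of K \<and> x \<in> F) x = p F x"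
  proof eventually_elim
    case (elim x)
    then have "(SOME F. F facet_of K \<and> x \<in> F) = F"
      using F by (intro some_equality) auto
    then show ?case by simp
  qed
qed

text \<open>A class of boundary functions that contains the face polynomials and the restrictions of
  polynomials, is closed under continuous operations, and on which all pairings are integrable.\<close>

definition face_continuous :: "(real^3 \<Rightarrow> complex^3) \<Rightarrow> bool" where
  "face_continuous \<mu> \<longleftrightarrow> (\<forall>F. F facet_of K \<longrightarrow>
     (\<exists>p. continuous_on UNIV p \<and> (AE x in surface_measure F. \<mu> x = p x)))"

lemma face_continuousE:
  assumes "face_continuous \<mu>" "F facet_of K"
  obtains p where "continuous_on UNIV p" "AE x in surface_measure F. \<mu> x = p x"
  using assms unfolding face_continuous_def by blast

lemma face_continuous_compose2:
  assumes "face_continuous \<mu>" "face_continuous \<nu>"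
    and c: "continuous_on UNIV (\<lambda>p. f (fst p) (snd p))"
  shows "face_continuous (\<lambda>x. f (\<mu> x) (\<nu> x))"
  unfolding face_continuous_def
proof (intro allI impI)
  fix F assume F: "F facet_of K"
  obtain p where p: "continuous_on UNIV p" "AE x in surface_measure F. \<mu> x = p x"
    using face_continuousE[OF assms(1) F] .
  obtain q where q: "continuous_on UNIV q" "AE x in surface_measure F. \<nu> x = q x"
    using face_continuousE[OF assms(2) F] .
  have "continuous_on UNIV (\<lambda>x. f (p x) (q x))"
    using continuous_on_compose2[OF c continuous_on_Pair[OF p(1) q(1)]] by simp
  moreover have "AE x in surface_measure F. f (\<mu> x) (\<nu> x) = f (p x) (q x)"
    using p(2) q(2) by eventually_elim simp
  ultimately show "\<exists>p. continuous_on UNIV p \<and> (AE x in surface_measure F. f (\<mu> x) (\<nu> x) = p x)"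
    by blast
qed

lemma integrable_face_continuous2:
  fixes f :: "complex^3 \<Rightarrow> complex^3 \<Rightarrow> 'b::euclidean_space"
  assumes "face_continuous \<mu>" "face_continuous \<nu>" and F: "F facet_of K"
    and c: "continuous_on UNIV (\<lambda>p. f (fst p) (snd p))"
  shows "integrable (surface_measure F) (\<lambda>x. f (\<mu> x) (\<nu> x))"
proof -
  obtain p where p: "continuous_on UNIV p" "AE x in surface_measure F. \<mu> x = p x"
    using face_continuousE[OF assms(1) F] .
  obtain q where q: "continuous_on UNIV q" "AE x in surface_measure F. \<nu> x = q x"
    using face_continuousE[OF assms(2) F] .
  have "continuous_on UNIV (\<lambda>x. f (p x) (q x))"
    using continuous_on_compose2[OF c continuous_on_Pair[OF p(1) q(1)]] by simp
  then have "integrable (surface_measure F) (\<lambda>x. f (p x) (q x))"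
    by (rule integrable_continuous_face[OF F])
  moreover have "AE x in surface_measure F. f (p x) (q x) = f (\<mu> x) (\<nu> x)"
    using p(2) q(2) by eventually_elim simp
  ultimately show ?thesis
    by (rule AE_eq_imp_integral_eq(1)[OF complete_face[OF F]])
qed

lemma face_continuous_imp_L2_bd:
  assumes "face_continuous \<mu>"
  shows "L2_bd K \<mu>"
  unfolding L2_bd_def L2_def
proof (intro allI impI conjI)
  fix F assume F: "F facet_of K"
  show "\<mu> \<in> borel_measurable (surface_measure F)"
    by (rule borel_measurable_integrable[OF integrable_face_continuous2[OF assms assms F, of "\<lambda>a b. a"]])
      (intro continuous_intros)
  show "integrable (surface_measure F) (\<lambda>x. (norm (\<mu> x))\<^sup>2)"
    by (rule integrable_face_continuous2[OF assms assms F, of "\<lambda>a b. (norm a)\<^sup>2"])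
      (intro continuous_intros)
qed

lemma continuous_on_bdot: "continuous_on UNIV (\<lambda>p. bdot (fst p) (snd p))"
  unfolding bdot_def by (intro continuous_intros)

lemma continuous_on_conj_vec: "continuous_on UNIV conj_vec"
  unfolding conj_vec_def by (intro continuous_on_vec_lambda continuous_intros)

lemma face_continuous_conj_vec:
  assumes "face_continuous \<mu>" shows "face_continuous (\<lambda>x. conj_vec (\<mu> x))"
  by (rule face_continuous_compose2[OF assms assms, of "\<lambda>a b. conj_vec a"])
    (intro continuous_on_compose2[OF continuous_on_conj_vec] continuous_intros subset_UNIV)

lemma face_continuous_diff:
  assumes "face_continuous \<mu>" "face_continuous \<nu>" shows "face_continuous (\<lambda>x. \<mu> x - \<nu> x)"
  by (rule face_continuous_compose2[OF assms]) (intro continuous_intros)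

lemma integrable_bdot_face:
  assumes "face_continuous \<mu>" "face_continuous \<nu>" "F facet_of K"
  shows "integrable (surface_measure F) (\<lambda>x. bdot (\<mu> x) (\<nu> x))"
  by (rule integrable_face_continuous2[OF assms continuous_on_bdot])

lemma continuous_on_imp_face_continuous:
  assumes "continuous_on UNIV p" "\<And>x. x \<in> K \<Longrightarrow> \<mu> x = p x"
  shows "face_continuous \<mu>"
  unfolding face_continuous_def
proof (intro allI impI)
  fix F assume F: "F facet_of K"
  then have "F \<subseteq> K" by (rule facet_of_imp_subset)
  then have "AE x in surface_measure F. \<mu> x = p x"
    using AE_in_face[OF F] assms(2) by (auto elim: eventually_mono)
  then show "\<exists>p. continuous_on UNIV p \<and> (AE x in surface_measure F. \<mu> x = p x)"
    using assms(1) by blast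
qed

lemma face_polyE:
  assumes "\<mu> \<in> face_poly k K" "F facet_of K"
  obtains p where "p \<in> poly_on k UNIV UNIV" "AE x in surface_measure F. \<mu> x = p x"
proof -
  obtain q where q: "q \<in> poly_on k F UNIV" "AE x in surface_measure F. x \<in> F \<longrightarrow> \<mu> x = q x"
    using assms unfolding face_poly_def by blast
  obtain p where p: "p \<in> poly_on k UNIV UNIV" "\<And>x. x \<in> F \<Longrightarrow> q x = p x"
    using poly_on_extend[OF q(1)] by blast
  have "AE x in surface_measure F. \<mu> x = p x"
    using q(2) AE_in_face[OF assms(2)] by eventually_elim (use p(2) in auto)
  then show thesis using that p(1) by blast
qed

lemma face_polyI:
  assumes "\<And>F. F facet_of K \<Longrightarrow> \<exists>p\<in>poly_on k UNIV UNIV. AE x in surface_measure F. \<mu> x = p x"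
  shows "\<mu> \<in> face_poly k K"
  unfolding face_poly_def
proof (intro CollectI allI impI)
  fix F assume "F facet_of K"
  then obtain p where p: "p \<in> poly_on k UNIV UNIV" "AE x in surface_measure F. \<mu> x = p x"
    using assms by blast
  have "p \<in> poly_on k F UNIV" by (rule poly_on_subset[OF p(1)]) auto
  then show "\<exists>p\<in>poly_on k F UNIV. AE x in surface_measure F. x \<in> F \<longrightarrow> \<mu> x = p x"
    using p(2) by (auto elim: eventually_mono)
qed

lemma face_poly_imp_face_continuous: "\<mu> \<in> face_poly k K \<Longrightarrow> face_continuous \<mu>"
  unfolding face_continuous_def
  by (intro allI impI, erule (1) face_polyE) (blast intro: continuous_on_poly)

lemma face_poly_linear:
  assumes \<mu>: "\<mu> \<in> face_poly k K"
    and L: "\<And>F. F facet_of K \<Longrightarrow> \<exists>L. linear L \<and> (AE x in surface_measure F. \<nu> x = L (\<mu> x))"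
  shows "\<nu> \<in> face_poly k K"
proof (rule face_polyI)
  fix F assume F: "F facet_of K"
  obtain p where p: "p \<in> poly_on k UNIV UNIV" "AE x in surface_measure F. \<mu> x = p x"
    using face_polyE[OF \<mu> F] .
  obtain L where L: "linear L" "AE x in surface_measure F. \<nu> x = L (\<mu> x)"
    using assms(2)[OF F] by blast
  have "(\<lambda>x. L (p x)) \<in> poly_on k UNIV UNIV"
    by (rule poly_on_linear[OF L(1) _ p(1)]) auto
  moreover have "AE x in surface_measure F. \<nu> x = L (p x)"
    using L(2) p(2) by eventually_elim simp
  ultimately show "\<exists>p\<in>poly_on k UNIV UNIV. AE x in surface_measure F. \<nu> x = p x"
    by (intro bexI[of _ "\<lambda>x. L (p x)"])
qed

lemma linear_conj_vec: "linear conj_vec"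
  by (auto intro!: linearI simp: conj_vec_def vec_eq_iff)

lemma conj_vec_in_face_poly: "\<mu> \<in> face_poly k K \<Longrightarrow> (\<lambda>x. conj_vec (\<mu> x)) \<in> face_poly k K"
  by (rule face_poly_linear) (use linear_conj_vec in auto)

lemma mat_app_in_face_poly:
  assumes \<mu>: "\<mu> \<in> face_poly k K"
    and \<tau>: "\<forall>F. F facet_of K \<longrightarrow> (\<exists>T\<in>sym_mat. AE x in surface_measure F. x \<in> F \<longrightarrow> \<tau> x = T)"
  shows "mat_app \<tau> \<mu> \<in> face_poly k K"
proof (rule face_poly_linear[OF \<mu>])
  fix F assume F: "F facet_of K"
  then obtain T where T: "AE x in surface_measure F. x \<in> F \<longrightarrow> \<tau> x = T" using \<tau> by blast
  let ?L = "\<lambda>v. map_matrix complex_of_real T *v v"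
  have "linear ?L"
    by (auto intro!: linearI simp: matrix_vector_mult_def vec_eq_iff sum.distrib algebra_simps scaleR_sum_right)
  moreover have "AE x in surface_measure F. mat_app \<tau> \<mu> x = ?L (\<mu> x)"
    using T AE_in_face[OF F] by eventually_elim (simp add: mat_app_def)
  ultimately show "\<exists>L. linear L \<and> (AE x in surface_measure F. mat_app \<tau> \<mu> x = L (\<mu> x))"
    by (intro exI[of _ ?L] conjI)
qed

lemma ip_bd_commute: "ip_bd A u v = ip_bd A v u"
  by (simp add: ip_bd_def bdot_def mult.commute)

lemma ip_bd_conj: "ip_bd A (\<lambda>x. conj_vec (u x)) (\<lambda>x. conj_vec (v x)) = cnj (ip_bd A u v)"
proof -
  have "bdot (conj_vec a) (conj_vec b) = cnj (bdot a b)" for a b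
    by (simp add: bdot_def conj_vec_def)
  then show ?thesis by (simp add: ip_bd_def)
qed

lemma ip_bd_diff:
  assumes "face_continuous u" "face_continuous v" "face_continuous w"
  shows "ip_bd K (\<lambda>x. u x - v x) w = ip_bd K u w - ip_bd K v w"
proof -
  have "bdot (a - b) c = bdot a c - bdot b c" for a b c
    by (simp add: bdot_def algebra_simps sum_subtractf)
  then show ?thesis
    unfolding ip_bd_def sum_subtractf[symmetric]
    by (intro sum.cong) (auto intro!: Bochner_Integration.integral_diff integrable_bdot_face assms)
qed

text \<open>Real orthogonality to a complex subspace is complex orthogonality, as the imaginary part of
  the pairing with \<open>q\<close> is the real part of the pairing with \<open>\<i> q\<close>.\<close>

lemma face_projection_exists:
  assumes u: "face_continuous u"
  shows "\<exists>g. g \<in> face_poly k K \<and> (\<forall>\<mu>\<in>face_poly k K. ip_bd K (\<lambda>x. u x - g x) (\<lambda>x. conj_vec (\<mu> x)) = 0)"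
proof -
  have Re_bdot: "Re (bdot a (conj_vec b)) = a \<bullet> b" for a b
    by (simp add: bdot_def conj_vec_def inner_vec_def inner_complex_def)
  have Im_bdot: "Im (bdot a (conj_vec b)) = a \<bullet> (\<chi> i. \<i> * b $ i)" for a b
    by (simp add: bdot_def conj_vec_def inner_vec_def inner_complex_def algebra_simps)
  define P where "P F p \<longleftrightarrow> p \<in> poly_on k UNIV UNIV \<and> (\<forall>q\<in>poly_on k UNIV UNIV.
      (LINT x|surface_measure F. bdot (u x - p x) (conj_vec (q x))) = 0)" for F p
  have "\<exists>p. P F p" if F: "F facet_of K" for F
  proof -
    obtain v where v: "continuous_on UNIV v" "AE x in surface_measure F. u x = v x"
      using face_continuousE[OF u F] .
    obtain p where p: "p \<in> poly_on k UNIV UNIV"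
      and orth: "\<And>q. q \<in> poly_on k UNIV UNIV \<Longrightarrow> (LINT x|surface_measure F. (v x - p x) \<bullet> q x) = 0"
      using poly_projection_exists[OF integrable_continuous_face[OF F] v(1)] by blast
    have "(LINT x|surface_measure F. bdot (u x - p x) (conj_vec (q x))) = 0"
      if q: "q \<in> poly_on k UNIV UNIV" for q
    proof -
      have iq: "(\<lambda>x. \<chi> i. \<i> * q x $ i) \<in> poly_on k UNIV UNIV"
        by (rule poly_on_linear[OF _ _ q]) (auto intro!: linearI simp: vec_eq_iff algebra_simps)
      have cont: "continuous_on UNIV (\<lambda>x. v x - p x)" "continuous_on UNIV (\<lambda>x. conj_vec (q x))"
        by (intro continuous_on_diff v(1) continuous_on_poly[OF p]
            continuous_on_compose2[OF continuous_on_conj_vec continuous_on_poly[OF q]] subset_UNIV)+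
      have int: "integrable (surface_measure F) (\<lambda>x. bdot (v x - p x) (conj_vec (q x)))"
        using continuous_on_compose2[OF continuous_on_bdot continuous_on_Pair[OF cont]]
        by (intro integrable_continuous_face[OF F]) simp
      have "(LINT x|surface_measure F. bdot (v x - p x) (conj_vec (q x))) = 0"
        using orth[OF q] orth[OF iq] int
        by (intro complex_eqI) (simp_all add: integral_Re[symmetric] integral_Im[symmetric] Re_bdot Im_bdot)
      moreover have "AE x in surface_measure F. bdot (v x - p x) (conj_vec (q x)) = bdot (u x - p x) (conj_vec (q x))"
        using v(2) by eventually_elim simp
      note AE_eq_imp_integral_eq(2)[OF complete_face[OF F] int this]
      ultimately show ?thesis
        by simp
    qed
    then show ?thesis using p unfolding P_def by (intro exI[of _ p]) blast
  qed
  then obtain p where "\<And>F. F facet_of K \<Longrightarrow> P F (p F)" by metis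
  then have p: "F facet_of K \<Longrightarrow> p F \<in> poly_on k UNIV UNIV"
    and orth: "F facet_of K \<Longrightarrow> q \<in> poly_on k UNIV UNIV \<Longrightarrow>
      (LINT x|surface_measure F. bdot (u x - p F x) (conj_vec (q x))) = 0" for F q
    unfolding P_def by simp_all
  obtain g where g: "\<And>F. F facet_of K \<Longrightarrow> AE x in surface_measure F. g x = p F x"
    using glue_faces[of p] by blast
  have gp: "g \<in> face_poly k K" using g p by (intro face_polyI) blast
  have "ip_bd K (\<lambda>x. u x - g x) (\<lambda>x. conj_vec (\<mu> x)) = 0" if \<mu>: "\<mu> \<in> face_poly k K" for \<mu>
    unfolding ip_bd_def
  proof (rule sum.neutral, rule ballI)
    fix F assume "F \<in> {F. F facet_of K}"
    then have F: "F facet_of K" by simp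
    obtain q where q: "q \<in> poly_on k UNIV UNIV" "AE x in surface_measure F. \<mu> x = q x"
      using face_polyE[OF \<mu> F] .
    have "AE x in surface_measure F. bdot (u x - g x) (conj_vec (\<mu> x)) = bdot (u x - p F x) (conj_vec (q x))"
      using g[OF F] q(2) by eventually_elim simp
    then have "(LINT x|surface_measure F. bdot (u x - g x) (conj_vec (\<mu> x)))
        = (LINT x|surface_measure F. bdot (u x - p F x) (conj_vec (q x)))"
      using face_continuous_conj_vec[OF face_poly_imp_face_continuous[OF \<mu>]]
        face_continuous_diff[OF u face_poly_imp_face_continuous[OF gp]]
      by (intro AE_eq_imp_integral_eq(2)[OF complete_face[OF F]] integrable_bdot_face F)
    then show "(LINT x|surface_measure F. bdot (u x - g x) (conj_vec (\<mu> x))) = 0"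
      using orth[OF F q(1)] by simp
  qed
  then show ?thesis using gp by blast
qed

lemma
  assumes u: "face_continuous u"
  shows proj_M_in_face_poly: "proj_M k K u \<in> face_poly k K"
    and ip_bd_proj_M: "\<mu> \<in> face_poly k K \<Longrightarrow> ip_bd K (proj_M k K u) \<mu> = ip_bd K u \<mu>"
proof -
  let ?g = "proj_M k K u"
  from someI_ex[OF face_projection_exists[OF u, of k]]
  have g: "?g \<in> face_poly k K"
    and orth: "\<And>\<mu>. \<mu> \<in> face_poly k K \<Longrightarrow> ip_bd K (\<lambda>x. u x - ?g x) (\<lambda>x. conj_vec (\<mu> x)) = 0"
    unfolding proj_M_def by blast+
  show "?g \<in> face_poly k K" by (rule g)
  show "ip_bd K ?g \<mu> = ip_bd K u \<mu>" if \<mu>: "\<mu> \<in> face_poly k K"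
  proof -
    have "(\<lambda>x. conj_vec (conj_vec (\<mu> x))) = \<mu>"
      by (simp add: conj_vec_def)
    then have "ip_bd K (\<lambda>x. u x - ?g x) \<mu> = 0"
      using orth[OF conj_vec_in_face_poly[OF \<mu>]] by simp
    then show ?thesis
      using ip_bd_diff[OF u face_poly_imp_face_continuous[OF g] face_poly_imp_face_continuous[OF \<mu>]] by simp
  qed
qed

text \<open>The stabilization maps face polynomials to face polynomials, because it is constant on each
  face. So the test function in the boundary term can be replaced by its projection.\<close>

lemma ip_bd_stabilization_proj_M:
  assumes u: "face_continuous u"
    and \<tau>: "\<forall>F. F facet_of K \<longrightarrow> (\<exists>T\<in>sym_mat. AE x in surface_measure F. x \<in> F \<longrightarrow> \<tau> x = T)"
  shows "ip_bd K (mat_app \<tau> (proj_M k K u)) (\<lambda>x. conj_vec (u x))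
    = ip_bd K (mat_app \<tau> (proj_M k K u)) (\<lambda>x. conj_vec (proj_M k K u x))"
proof -
  let ?g = "proj_M k K u"
  let ?c = "\<lambda>x. conj_vec (mat_app \<tau> ?g x)"
  have c: "?c \<in> face_poly k K"
    by (intro conj_vec_in_face_poly mat_app_in_face_poly proj_M_in_face_poly u \<tau>)
  have conj: "ip_bd K (mat_app \<tau> ?g) (\<lambda>x. conj_vec (v x)) = cnj (ip_bd K v ?c)" for v
  proof -
    have "(\<lambda>x. conj_vec (?c x)) = mat_app \<tau> ?g"
      by (simp add: conj_vec_def)
    then show ?thesis
      using ip_bd_conj[of K ?c v] by (simp add: ip_bd_commute)
  qed
  show ?thesis
    unfolding conj ip_bd_proj_M[OF u c] ..
qed

end

section \<open>The compliance operator at a point\<close>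

lemma ddot_eq_inner: "ddot \<xi> \<zeta> = \<xi> \<bullet> \<zeta>" for \<xi> \<zeta> :: "real^3^3"
  unfolding ddot_def trace_def matrix_matrix_mult_def transpose_def inner_vec_def
  by (simp add: mult.commute, subst sum.swap, rule refl)

lemma subspace_sym_mat_real: "subspace (sym_mat :: (real^3^3) set)"
  by (auto simp: subspace_def sym_mat_def transpose_def vec_eq_iff)

definition symmetrize :: "real^3^3 \<Rightarrow> real^3^3" where
  "symmetrize \<xi> = (1/2) *\<^sub>R (\<xi> + transpose \<xi>)"

lemma linear_symmetrize: "linear symmetrize"
  by (auto intro!: linearI simp: symmetrize_def vec_eq_iff transpose_def algebra_simps)

lemma symmetrize_in_sym_mat: "symmetrize \<xi> \<in> sym_mat"
  by (simp add: sym_mat_def symmetrize_def vec_eq_iff transpose_def add.commute)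

lemma symmetrize_sym_mat: "\<xi> \<in> sym_mat \<Longrightarrow> symmetrize \<xi> = \<xi>"
  by (simp add: sym_mat_def symmetrize_def flip: scaleR_2)

locale elasticity_operator =
  fixes C :: "real^3^3 \<Rightarrow> real^3^3" and C\<^sub>0 :: real
  assumes C_sym: "\<And>\<xi>. \<xi> \<in> sym_mat \<Longrightarrow> C \<xi> \<in> sym_mat"
    and C_linear: "\<And>\<xi> \<zeta> a b. \<xi> \<in> sym_mat \<Longrightarrow> \<zeta> \<in> sym_mat \<Longrightarrow>
      C (a *\<^sub>R \<xi> + b *\<^sub>R \<zeta>) = a *\<^sub>R C \<xi> + b *\<^sub>R C \<zeta>"
    and C_selfadjoint: "\<And>\<xi> \<zeta>. \<xi> \<in> sym_mat \<Longrightarrow> \<zeta> \<in> sym_mat \<Longrightarrow> C \<xi> \<bullet> \<zeta> = \<xi> \<bullet> C \<zeta>"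
    and C0_pos: "0 < C\<^sub>0"
    and C_coercive: "\<And>\<xi>. \<xi> \<in> sym_mat \<Longrightarrow> C\<^sub>0 * (\<xi> \<bullet> \<xi>) \<le> C \<xi> \<bullet> \<xi>"
begin

abbreviation A :: "real^3^3 \<Rightarrow> real^3^3" where "A \<equiv> inv_into sym_mat C"

lemma sym_combination: "\<xi> \<in> sym_mat \<Longrightarrow> \<zeta> \<in> sym_mat \<Longrightarrow> a *\<^sub>R \<xi> + b *\<^sub>R \<zeta> \<in> sym_mat"
  for \<xi> \<zeta> :: "real^3^3"
  using subspace_sym_mat_real by (simp add: subspace_add subspace_scale)

lemma linear_C_symmetrize: "linear (\<lambda>\<xi>. C (symmetrize \<xi>))"
proof (rule linearI)
  fix \<xi> \<zeta> :: "real^3^3" and c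
  show "C (symmetrize (\<xi> + \<zeta>)) = C (symmetrize \<xi>) + C (symmetrize \<zeta>)"
    using C_linear[OF symmetrize_in_sym_mat symmetrize_in_sym_mat, of 1 \<xi> 1 \<zeta>]
    by (simp add: linear_add[OF linear_symmetrize])
  show "C (symmetrize (c *\<^sub>R \<xi>)) = c *\<^sub>R C (symmetrize \<xi>)"
    using C_linear[OF symmetrize_in_sym_mat symmetrize_in_sym_mat, of c \<xi> 0 \<xi>]
    by (simp add: linear_cmul[OF linear_symmetrize])
qed

lemma C_eq_0:
  assumes "\<xi> \<in> sym_mat" "C \<xi> = 0"
  shows "\<xi> = 0"
proof -
  have "\<xi> \<bullet> \<xi> \<le> 0"
    using C_coercive[OF assms(1)] assms(2) C0_pos by (simp add: mult_le_0_iff)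
  then show ?thesis by (metis inner_eq_zero_iff inner_ge_zero order_antisym)
qed

text \<open>Extending \<open>C\<close> by the identity on skew matrices gives an injective endomorphism of a
  finite-dimensional space, hence a surjective one.\<close>

lemma bij_betw_C: "bij_betw C sym_mat sym_mat"
proof -
  have "inj_on C sym_mat"
  proof (rule inj_onI)
    fix \<xi> \<zeta> assume *: "\<xi> \<in> sym_mat" "\<zeta> \<in> sym_mat" "C \<xi> = C \<zeta>"
    then have "C (\<xi> - \<zeta>) = 0" using C_linear[of \<xi> \<zeta> 1 "-1"] by simp
    then show "\<xi> = \<zeta>"
      using C_eq_0[of "\<xi> - \<zeta>"] * subspace_sym_mat_real by (simp add: subspace_diff)
  qed
  moreover have "sym_mat \<subseteq> C ` sym_mat"
  proof
    fix \<eta> :: "real^3^3" assume \<eta>: "\<eta> \<in> sym_mat"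
    let ?D = "\<lambda>\<xi>. C (symmetrize \<xi>) + (\<xi> - symmetrize \<xi>)"
    have symD: "symmetrize (?D \<xi>) = C (symmetrize \<xi>)" for \<xi>
      using symmetrize_sym_mat C_sym symmetrize_in_sym_mat
      by (simp add: linear_add[OF linear_symmetrize] linear_diff[OF linear_symmetrize])
    have linD: "linear ?D"
      by (intro linear_compose_add linear_C_symmetrize linear_compose_sub linear_ident linear_symmetrize)
    have inj: "inj ?D"
      unfolding linear_injective_0[OF linD]
    proof (intro allI impI)
      fix \<xi> assume 0: "?D \<xi> = 0"
      then have "C (symmetrize \<xi>) = 0"
        using symD[of \<xi>] by (simp add: linear_0[OF linear_symmetrize])
      then have "symmetrize \<xi> = 0" using C_eq_0 symmetrize_in_sym_mat by blast
      then show "\<xi> = 0" using 0 \<open>C (symmetrize \<xi>) = 0\<close> by simp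
    qed
    obtain \<xi> where "\<eta> = ?D \<xi>"
      using surjD[OF linear_injective_imp_surjective[OF linD inj refl], of \<eta>] by blast
    then have "\<eta> = C (symmetrize \<xi>)"
      using symD[of \<xi>] symmetrize_sym_mat[OF \<eta>] by simp
    then show "\<eta> \<in> C ` sym_mat" using symmetrize_in_sym_mat by blast
  qed
  ultimately show ?thesis using C_sym by (auto simp: bij_betw_def)
qed

lemma A_sym: "\<eta> \<in> sym_mat \<Longrightarrow> A \<eta> \<in> sym_mat"
  using bij_betw_C by (metis bij_betw_def inv_into_into)

lemma C_A: "\<eta> \<in> sym_mat \<Longrightarrow> C (A \<eta>) = \<eta>"
  using bij_betw_C by (metis bij_betw_inv_into_right)

lemma A_C: "\<xi> \<in> sym_mat \<Longrightarrow> A (C \<xi>) = \<xi>"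
  using bij_betw_C by (metis bij_betw_inv_into_left)

lemma A_linear:
  assumes "\<xi> \<in> sym_mat" "\<zeta> \<in> sym_mat"
  shows "A (a *\<^sub>R \<xi> + b *\<^sub>R \<zeta>) = a *\<^sub>R A \<xi> + b *\<^sub>R A \<zeta>"
proof -
  have "C (a *\<^sub>R A \<xi> + b *\<^sub>R A \<zeta>) = a *\<^sub>R \<xi> + b *\<^sub>R \<zeta>"
    using assms by (simp add: C_linear A_sym C_A)
  then show ?thesis
    using A_C[of "a *\<^sub>R A \<xi> + b *\<^sub>R A \<zeta>"] assms by (simp add: sym_combination A_sym)
qed

lemma A_selfadjoint:
  assumes "\<xi> \<in> sym_mat" "\<zeta> \<in> sym_mat"
  shows "A \<xi> \<bullet> \<zeta> = \<xi> \<bullet> A \<zeta>"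
  using C_selfadjoint[OF A_sym[OF assms(1)] A_sym[OF assms(2)]] assms by (simp add: C_A)

lemma A_coercive: "\<eta> \<in> sym_mat \<Longrightarrow> C\<^sub>0 * (A \<eta> \<bullet> A \<eta>) \<le> A \<eta> \<bullet> \<eta>"
  using C_coercive[OF A_sym[of \<eta>]] by (simp add: C_A inner_commute)

lemma A_nonneg: "\<eta> \<in> sym_mat \<Longrightarrow> 0 \<le> A \<eta> \<bullet> \<eta>"
  using A_coercive[of \<eta>] C0_pos by (meson inner_ge_zero mult_nonneg_nonneg less_imp_le order_trans)

lemma A_definite:
  assumes "\<eta> \<in> sym_mat" "A \<eta> \<bullet> \<eta> = 0"
  shows "\<eta> = 0"
proof -
  have "A \<eta> \<bullet> A \<eta> \<le> 0" using A_coercive[OF assms(1)] assms(2) C0_pos by (simp add: mult_le_0_iff)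
  then have "A \<eta> = 0" by (metis inner_eq_zero_iff inner_ge_zero order_antisym)
  moreover have "C 0 = 0" using C_linear[OF assms(1,1), of 0 0] by simp
  ultimately show ?thesis using C_A[OF assms(1)] by simp
qed

lemma norm_A_le:
  assumes "\<eta> \<in> sym_mat"
  shows "norm (A \<eta>) \<le> norm \<eta> / C\<^sub>0"
proof -
  have "C\<^sub>0 * (norm (A \<eta>))\<^sup>2 \<le> norm (A \<eta>) * norm \<eta>"
    using A_coercive[OF assms] norm_cauchy_schwarz[of "A \<eta>" \<eta>] by (simp add: power2_norm_eq_inner)
  then have "norm (A \<eta>) * (C\<^sub>0 * norm (A \<eta>)) \<le> norm (A \<eta>) * norm \<eta>"
    by (simp add: power2_eq_square ac_simps)
  then have "C\<^sub>0 * norm (A \<eta>) \<le> norm \<eta>"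
    by (cases "norm (A \<eta>) = 0") simp_all
  then show ?thesis using C0_pos by (simp add: field_simps)
qed

text \<open>The difference of the two sides is the value of the form of \<open>C\<close> at \<open>\<xi> - A \<eta>\<close>. The left-hand
  side contains \<open>C\<close> only through its components, which is what makes the quadratic form of \<open>A\<close>
  measurable when \<open>C\<close> varies.\<close>

lemma A_upper:
  assumes "\<eta> \<in> sym_mat" "\<xi> \<in> sym_mat"
  shows "2 * (\<eta> \<bullet> \<xi>) - C \<xi> \<bullet> \<xi> \<le> A \<eta> \<bullet> \<eta>"
proof -
  let ?d = "1 *\<^sub>R \<xi> + (-1) *\<^sub>R A \<eta>"
  have d: "?d \<in> sym_mat" using assms by (intro sym_combination A_sym)
  have "0 \<le> C ?d \<bullet> ?d"
    using C_coercive[OF d] C0_pos by (meson inner_ge_zero mult_nonneg_nonneg less_imp_le order_trans)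
  also have "C ?d = C \<xi> - \<eta>"
    using C_linear[OF assms(2) A_sym[OF assms(1)], of 1 "-1"] C_A[OF assms(1)] by simp
  also have "(C \<xi> - \<eta>) \<bullet> ?d = C \<xi> \<bullet> \<xi> - C \<xi> \<bullet> A \<eta> - \<eta> \<bullet> \<xi> + A \<eta> \<bullet> \<eta>"
    by (simp add: inner_diff_left inner_diff_right inner_commute)
  also have "C \<xi> \<bullet> A \<eta> = \<eta> \<bullet> \<xi>"
    using C_selfadjoint[OF assms(2) A_sym[OF assms(1)]] C_A[OF assms(1)] by (simp add: inner_commute)
  finally show ?thesis by simp
qed

text \<open>The supremum is attained at \<open>A \<eta>\<close>, which points of \<open>D\<close> approximate.\<close>

lemma A_eq_SUP:
  assumes \<eta>: "\<eta> \<in> sym_mat" and D: "D \<subseteq> sym_mat" "sym_mat \<subseteq> closure D"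
  shows "(SUP \<xi>\<in>D. ereal (2 * (\<eta> \<bullet> \<xi>) - C \<xi> \<bullet> \<xi>)) = ereal (A \<eta> \<bullet> \<eta>)"
proof (rule SUP_eqI)
  fix \<xi> assume "\<xi> \<in> D"
  then show "ereal (2 * (\<eta> \<bullet> \<xi>) - C \<xi> \<bullet> \<xi>) \<le> ereal (A \<eta> \<bullet> \<eta>)"
    using A_upper[OF \<eta>] D by auto
next
  fix y assume y: "\<And>\<xi>. \<xi> \<in> D \<Longrightarrow> ereal (2 * (\<eta> \<bullet> \<xi>) - C \<xi> \<bullet> \<xi>) \<le> y"
  have "A \<eta> \<in> closure D" using D A_sym[OF \<eta>] by blast
  then obtain \<xi> where \<xi>: "\<And>n. \<xi> n \<in> D" "\<xi> \<longlonglongrightarrow> A \<eta>"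
    by (auto simp: closure_sequential)
  let ?F = "\<lambda>\<xi>. 2 * (\<eta> \<bullet> \<xi>) - C (symmetrize \<xi>) \<bullet> \<xi>"
  have "isCont (\<lambda>\<xi>. C (symmetrize \<xi>)) (A \<eta>)"
    using linear_C_symmetrize by (intro linear_continuous_at) (simp add: linear_conv_bounded_linear)
  then have "isCont ?F (A \<eta>)" by (intro continuous_intros)
  then have "(\<lambda>n. ?F (\<xi> n)) \<longlonglongrightarrow> ?F (A \<eta>)"
    using \<xi>(2) by (rule isCont_tendsto_compose)
  then have "(\<lambda>n. ereal (?F (\<xi> n))) \<longlonglongrightarrow> ereal (?F (A \<eta>))" by simp
  moreover have "ereal (?F (\<xi> n)) \<le> y" for n
    using y[OF \<xi>(1)[of n]] symmetrize_sym_mat[OF subsetD[OF D(1) \<xi>(1)[of n]]] by simp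
  ultimately have "ereal (?F (A \<eta>)) \<le> y" by (meson LIMSEQ_le_const2)
  then show "ereal (A \<eta> \<bullet> \<eta>) \<le> y"
    using symmetrize_sym_mat[OF A_sym[OF \<eta>]] C_A[OF \<eta>] by (simp add: inner_commute)
qed

text \<open>A maximizer \<open>\<xi>\<close> of the quadratic form on the unit sphere is an eigenvector: with the maximum
  \<open>l\<close>, the form of \<open>l - A\<close> is nonnegative and vanishes at \<open>\<xi>\<close>.\<close>

lemma A_max_eigenvalue:
  obtains l \<xi> where "\<xi> \<in> sym_mat" "\<xi> \<noteq> 0" "A \<xi> = l *\<^sub>R \<xi>"
    "\<And>\<eta>. \<eta> \<in> sym_mat \<Longrightarrow> A \<eta> \<bullet> \<eta> \<le> l * (\<eta> \<bullet> \<eta>)"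
proof -
  let ?S = "sphere 0 1 \<inter> (sym_mat :: (real^3^3) set)"
  have lin: "linear (\<lambda>\<xi>. A (symmetrize \<xi>))"
  proof (rule linearI)
    fix \<xi> \<zeta> :: "real^3^3" and c
    show "A (symmetrize (\<xi> + \<zeta>)) = A (symmetrize \<xi>) + A (symmetrize \<zeta>)"
      using A_linear[OF symmetrize_in_sym_mat symmetrize_in_sym_mat, of 1 \<xi> 1 \<zeta>]
      by (simp add: linear_add[OF linear_symmetrize])
    show "A (symmetrize (c *\<^sub>R \<xi>)) = c *\<^sub>R A (symmetrize \<xi>)"
      using A_linear[OF symmetrize_in_sym_mat symmetrize_in_sym_mat, of c \<xi> 0 \<xi>]
      by (simp add: linear_cmul[OF linear_symmetrize])
  qed
  have comp: "compact ?S"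
    using closed_subspace[OF subspace_sym_mat_real] by (simp add: compact_Int_closed)
  have one: "mat 1 \<in> (sym_mat :: (real^3^3) set)" "(mat 1 :: real^3^3) \<noteq> 0"
    by (simp add: sym_mat_def transpose_mat, auto simp: vec_eq_iff mat_def)
  then have "(1 / norm (mat 1 :: real^3^3)) *\<^sub>R mat 1 \<in> ?S"
    using subspace_sym_mat_real by (simp add: subspace_scale)
  then have ne: "?S \<noteq> {}" by blast
  have "continuous_on ?S (\<lambda>\<xi>. A (symmetrize \<xi>) \<bullet> \<xi>)"
    using lin by (intro continuous_intros linear_continuous_on) (simp add: linear_conv_bounded_linear)
  then obtain \<xi> where \<xi>: "\<xi> \<in> ?S" "\<And>\<zeta>. \<zeta> \<in> ?S \<Longrightarrow> A (symmetrize \<zeta>) \<bullet> \<zeta> \<le> A (symmetrize \<xi>) \<bullet> \<xi>"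
    using continuous_attains_sup[OF comp ne] by blast
  then have \<xi>s: "\<xi> \<in> sym_mat" and \<xi>1: "\<xi> \<bullet> \<xi> = 1" by (auto simp: norm_eq_1)
  define l where "l = A \<xi> \<bullet> \<xi>"
  have le: "A \<eta> \<bullet> \<eta> \<le> l * (\<eta> \<bullet> \<eta>)" if \<eta>: "\<eta> \<in> sym_mat" for \<eta>
  proof (cases "\<eta> = 0")
    case False
    let ?c = "1 / norm \<eta>"
    have s: "?c *\<^sub>R \<eta> \<in> ?S" using \<eta> False subspace_sym_mat_real by (simp add: subspace_scale)
    have "A (?c *\<^sub>R \<eta>) = ?c *\<^sub>R A \<eta>" using A_linear[OF \<eta> \<eta>, of ?c 0] by simp
    then have "(?c * ?c) * (A \<eta> \<bullet> \<eta>) \<le> l"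
      using \<xi>(2)[OF s] s \<xi>s by (simp add: symmetrize_sym_mat l_def)
    then show ?thesis
      using False by (simp add: field_simps power2_norm_eq_inner[symmetric] power2_eq_square)
  qed simp
  define \<zeta> where "\<zeta> = l *\<^sub>R \<xi> - A \<xi>"
  have \<zeta>s: "\<zeta> \<in> sym_mat"
    unfolding \<zeta>_def using sym_combination[OF \<xi>s A_sym[OF \<xi>s], of l "-1"] by simp
  define M where "M = l * (\<zeta> \<bullet> \<zeta>) - A \<zeta> \<bullet> \<zeta>"
  have M: "0 \<le> M" using le[OF \<zeta>s] by (simp add: M_def)
  \<comment> \<open>the nonnegative form of \<open>l - A\<close> at \<open>\<xi> - s \<zeta>\<close>, where \<open>(l - A) \<xi> = \<zeta>\<close>\<close>
  have quad: "0 \<le> - 2 * s * (\<zeta> \<bullet> \<zeta>) + s * s * M" for s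
  proof -
    let ?z = "1 *\<^sub>R \<xi> + (- s) *\<^sub>R \<zeta>"
    have Az: "A ?z = 1 *\<^sub>R A \<xi> + (- s) *\<^sub>R A \<zeta>" by (rule A_linear[OF \<xi>s \<zeta>s])
    have 1: "A ?z \<bullet> ?z = l - 2 * s * (A \<xi> \<bullet> \<zeta>) + s * s * (A \<zeta> \<bullet> \<zeta>)"
      unfolding Az using A_selfadjoint[OF \<xi>s \<zeta>s] by (simp add: inner_simps l_def inner_commute algebra_simps)
    have 2: "?z \<bullet> ?z = 1 - 2 * s * (\<xi> \<bullet> \<zeta>) + s * s * (\<zeta> \<bullet> \<zeta>)"
      using \<xi>1 by (simp add: inner_simps inner_commute algebra_simps)
    have "A ?z \<bullet> ?z \<le> l * (?z \<bullet> ?z)"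
      by (rule le[OF sym_combination[OF \<xi>s \<zeta>s]])
    then have "0 \<le> - 2 * (s * (l * (\<xi> \<bullet> \<zeta>))) + 2 * (s * (A \<xi> \<bullet> \<zeta>)) + s * s * M"
      unfolding 1 2 by (simp add: M_def algebra_simps)
    moreover have "s * (\<zeta> \<bullet> \<zeta>) = s * (l * (\<xi> \<bullet> \<zeta>)) - s * (A \<xi> \<bullet> \<zeta>)"
      by (subst (1) \<zeta>_def) (simp add: inner_diff_left right_diff_distrib)
    ultimately show ?thesis by simp
  qed
  have "\<zeta> = 0"
  proof (rule ccontr)
    assume "\<zeta> \<noteq> 0"
    then have pos: "0 < \<zeta> \<bullet> \<zeta>" by simp
    define s where "s = (\<zeta> \<bullet> \<zeta>) / (M + 1)"
    have s: "0 < s" using pos M by (simp add: s_def)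
    have "s * M \<le> \<zeta> \<bullet> \<zeta>" using pos M by (simp add: s_def field_simps)
    then have "s * (s * M) \<le> s * (\<zeta> \<bullet> \<zeta>)" using s by simp
    then have "- 2 * s * (\<zeta> \<bullet> \<zeta>) + s * s * M \<le> - s * (\<zeta> \<bullet> \<zeta>)" by (simp add: mult.assoc)
    moreover have "- s * (\<zeta> \<bullet> \<zeta>) < 0" using s pos by simp
    ultimately show False using quad[of s] by linarith
  qed
  then have "A \<xi> = l *\<^sub>R \<xi>" by (simp add: \<zeta>_def)
  moreover have "\<xi> \<noteq> 0" using \<xi>1 by auto
  ultimately show thesis using that \<xi>s le by blast
qed

lemma A_le_Greatest_eigenvalue:
  assumes "\<eta> \<in> sym_mat"
  shows "A \<eta> \<bullet> \<eta> \<le> (GREATEST l. \<exists>\<xi>\<in>sym_mat. \<xi> \<noteq> 0 \<and> A \<xi> = l *\<^sub>R \<xi>) * (\<eta> \<bullet> \<eta>)"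
proof -
  obtain l \<xi> where l: "\<xi> \<in> sym_mat" "\<xi> \<noteq> 0" "A \<xi> = l *\<^sub>R \<xi>"
    and le: "\<And>\<eta>. \<eta> \<in> sym_mat \<Longrightarrow> A \<eta> \<bullet> \<eta> \<le> l * (\<eta> \<bullet> \<eta>)"
    using A_max_eigenvalue by blast
  have "(GREATEST l. \<exists>\<xi>\<in>sym_mat. \<xi> \<noteq> 0 \<and> A \<xi> = l *\<^sub>R \<xi>) = l"
  proof (rule Greatest_equality)
    fix m assume "\<exists>\<xi>\<in>sym_mat. \<xi> \<noteq> 0 \<and> A \<xi> = m *\<^sub>R \<xi>"
    then obtain \<zeta> where \<zeta>: "\<zeta> \<in> sym_mat" "\<zeta> \<noteq> 0" "A \<zeta> = m *\<^sub>R \<zeta>" by blast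
    then have "m * (\<zeta> \<bullet> \<zeta>) \<le> l * (\<zeta> \<bullet> \<zeta>)" using le[OF \<zeta>(1)] by simp
    then show "m \<le> l" using \<zeta>(2) by simp
  qed (use l in blast)
  then show ?thesis using le[OF assms] by simp
qed

end

section \<open>Material coefficients as functions on an element\<close>

lemma complete_lebesgue_on:
  assumes "S \<in> sets lebesgue"
  shows "complete_measure (lebesgue_on S)"
proof
  fix A B assume B: "A \<subseteq> B" "B \<in> null_sets (lebesgue_on S)"
  then have "B \<in> null_sets lebesgue" "B \<subseteq> S"
    using null_sets_restrict_space[of S lebesgue] assms by auto
  then have "A \<in> null_sets lebesgue" "A \<subseteq> S"
    using B(1) completion.complete2 by blast+
  then show "A \<in> sets (lebesgue_on S)"
    using assms by (auto simp: sets_restrict_space_iff)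
qed

lemma elasticity_field_operator:
  assumes "elasticity_field K \<C>"
  obtains C\<^sub>0 where "0 < C\<^sub>0" "AE x in lebesgue_on K. elasticity_operator (\<C> x) C\<^sub>0"
proof -
  obtain C\<^sub>0 where C\<^sub>0: "0 < C\<^sub>0" "AE x in lebesgue_on K. \<forall>\<xi>\<in>sym_mat. ddot (\<C> x \<xi>) \<xi> \<ge> C\<^sub>0 * ddot \<xi> \<xi>"
    using assms unfolding elasticity_field_def by blast
  have "AE x in lebesgue_on K. (\<forall>\<xi>\<in>sym_mat. \<C> x \<xi> \<in> sym_mat) \<and>
        (\<forall>\<xi>\<in>sym_mat. \<forall>\<zeta>\<in>sym_mat. \<forall>a b. \<C> x (a *\<^sub>R \<xi> + b *\<^sub>R \<zeta>) = a *\<^sub>R \<C> x \<xi> + b *\<^sub>R \<C> x \<zeta>) \<and>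
        (\<forall>\<xi>\<in>sym_mat. \<forall>\<zeta>\<in>sym_mat. ddot (\<C> x \<xi>) \<zeta> = ddot \<xi> (\<C> x \<zeta>))"
    using assms unfolding elasticity_field_def by (elim conjE)
  with C\<^sub>0(2) have "AE x in lebesgue_on K. elasticity_operator (\<C> x) C\<^sub>0"
  proof eventually_elim
    case (elim x)
    then show ?case
      using C\<^sub>0(1) unfolding elasticity_operator_def ddot_eq_inner by blast
  qed
  then show thesis using that C\<^sub>0(1) by blast
qed

text \<open>For a countable dense set of symmetric matrices the supremum in \<open>A_eq_SUP\<close> is one of countably many
  measurable functions.\<close>

lemma measurable_compliance_quadratic:
  assumes K: "K \<in> sets lebesgue" and \<C>: "elasticity_field K \<C>"
    and \<eta>[measurable]: "\<eta> \<in> borel_measurable (lebesgue_on K)" and sym: "\<And>x. \<eta> x \<in> sym_mat"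
  shows "(\<lambda>x. compliance \<C> x (\<eta> x) \<bullet> \<eta> x) \<in> borel_measurable (lebesgue_on K)"
proof -
  obtain C\<^sub>0 where op: "AE x in lebesgue_on K. elasticity_operator (\<C> x) C\<^sub>0"
    using elasticity_field_operator[OF \<C>] by blast
  obtain D :: "(real^3^3) set" where D: "countable D" "D \<subseteq> sym_mat" "sym_mat \<subseteq> closure D"
    using separable by blast
  have [measurable]: "(\<lambda>x. \<C> x \<xi> \<bullet> \<xi>) \<in> borel_measurable (lebesgue_on K)" if "\<xi> \<in> D" for \<xi>
    using \<C> that D(2) unfolding elasticity_field_def ddot_eq_inner by blast
  have "(\<lambda>x. SUP \<xi>\<in>D. ereal (2 * (\<eta> x \<bullet> \<xi>) - \<C> x \<xi> \<bullet> \<xi>)) \<in> borel_measurable (lebesgue_on K)"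
    using D(1) by (intro borel_measurable_SUP) measurable
  then have "(\<lambda>x. real_of_ereal (SUP \<xi>\<in>D. ereal (2 * (\<eta> x \<bullet> \<xi>) - \<C> x \<xi> \<bullet> \<xi>))) \<in> borel_measurable (lebesgue_on K)"
    by (rule borel_measurable_real_of_ereal)
  moreover have "AE x in lebesgue_on K.
      real_of_ereal (SUP \<xi>\<in>D. ereal (2 * (\<eta> x \<bullet> \<xi>) - \<C> x \<xi> \<bullet> \<xi>)) = compliance \<C> x (\<eta> x) \<bullet> \<eta> x"
    using op
  proof eventually_elim
    case (elim x)
    then show ?case
      using elasticity_operator.A_eq_SUP[OF elim sym D(2,3)] by (simp add: compliance_def)
  qed
  ultimately show ?thesis
    by (rule complete_measure.borel_measurable_AE_cong[OF complete_lebesgue_on[OF K]])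
qed

text \<open>Measurability follows from the quadratic case by polarization, as the compliance is self-adjoint;
  coercivity of the stiffness bounds the integrand.\<close>

lemma integrable_compliance:
  assumes K: "compact K" and \<C>: "elasticity_field K \<C>"
    and \<eta>: "continuous_on UNIV \<eta>" "\<And>x. \<eta> x \<in> sym_mat"
    and \<zeta>: "continuous_on UNIV \<zeta>" "\<And>x. \<zeta> x \<in> sym_mat"
  shows "integrable (lebesgue_on K) (\<lambda>x. compliance \<C> x (\<eta> x) \<bullet> \<zeta> x)"
proof -
  have Kl: "K \<in> sets lebesgue" using K by (auto intro: fmeasurableD lmeasurable_compact)
  obtain C\<^sub>0 where C\<^sub>0: "0 < C\<^sub>0" and op: "AE x in lebesgue_on K. elasticity_operator (\<C> x) C\<^sub>0"
    using elasticity_field_operator[OF \<C>] by blast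
  have cont_meas: "f \<in> borel_measurable (lebesgue_on K)" if "continuous_on UNIV f" for f :: "real^3 \<Rightarrow> real^3^3"
    by (rule borel_measurable_integrable[OF integrable_lebesgue_on_compact[OF K continuous_on_subset[OF that subset_UNIV]]])
  have q: "(\<lambda>x. compliance \<C> x (\<eta> x + c *\<^sub>R \<zeta> x) \<bullet> (\<eta> x + c *\<^sub>R \<zeta> x)) \<in> borel_measurable (lebesgue_on K)" for c
    using \<eta> \<zeta> subspace_sym_mat_real
    by (intro measurable_compliance_quadratic[OF Kl \<C>] cont_meas continuous_intros)
      (auto simp: subspace_add subspace_scale)
  have polar: "AE x in lebesgue_on K. (1/4) * (compliance \<C> x (\<eta> x + 1 *\<^sub>R \<zeta> x) \<bullet> (\<eta> x + 1 *\<^sub>R \<zeta> x)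
      - compliance \<C> x (\<eta> x + (-1) *\<^sub>R \<zeta> x) \<bullet> (\<eta> x + (-1) *\<^sub>R \<zeta> x)) = compliance \<C> x (\<eta> x) \<bullet> \<zeta> x"
    using op
  proof eventually_elim
    case (elim x)
    interpret elasticity_operator "\<C> x" C\<^sub>0 by (rule elim)
    have "A (\<eta> x + c *\<^sub>R \<zeta> x) = A (\<eta> x) + c *\<^sub>R A (\<zeta> x)" for c
      using A_linear[OF \<eta>(2) \<zeta>(2), of 1 x c x] by simp
    then show ?case
      using A_selfadjoint[OF \<eta>(2) \<zeta>(2), of x x]
      by (simp only: compliance_def) (simp add: inner_simps inner_commute)
  qed
  have meas: "(\<lambda>x. compliance \<C> x (\<eta> x) \<bullet> \<zeta> x) \<in> borel_measurable (lebesgue_on K)"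
    by (rule complete_measure.borel_measurable_AE_cong[OF complete_lebesgue_on[OF Kl] _ polar])
      (intro borel_measurable_times borel_measurable_diff q borel_measurable_const)
  have "integrable (lebesgue_on K) (\<lambda>x. (norm (\<eta> x) / C\<^sub>0) * norm (\<zeta> x))"
    using \<eta>(1) \<zeta>(1) C\<^sub>0
    by (intro integrable_lebesgue_on_compact K continuous_intros) (auto intro: continuous_on_subset)
  then show ?thesis
  proof (rule Bochner_Integration.integrable_bound[OF _ meas])
    show "AE x in lebesgue_on K. norm (compliance \<C> x (\<eta> x) \<bullet> \<zeta> x) \<le> norm ((norm (\<eta> x) / C\<^sub>0) * norm (\<zeta> x))"
      using op
    proof eventually_elim
      case (elim x)
      have "norm (compliance \<C> x (\<eta> x) \<bullet> \<zeta> x) \<le> norm (compliance \<C> x (\<eta> x)) * norm (\<zeta> x)"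
        by (simp add: Cauchy_Schwarz_ineq2)
      also have "\<dots> \<le> (norm (\<eta> x) / C\<^sub>0) * norm (\<zeta> x)"
        using elasticity_operator.norm_A_le[OF elim \<eta>(2)]
        by (intro mult_right_mono) (auto simp: compliance_def)
      finally show ?case using C\<^sub>0 by simp
    qed
  qed
qed

section \<open>Complex stresses\<close>

abbreviation "mat_Re \<equiv> map_matrix Re"
abbreviation "mat_Im \<equiv> map_matrix Im"
abbreviation "mat_cnj \<equiv> map_matrix cnj"

lemma ddot_eq_sum: "ddot \<xi> \<zeta> = (\<Sum>i\<in>UNIV. \<Sum>j\<in>UNIV. \<xi> $ i $ j * \<zeta> $ i $ j)"
  unfolding ddot_def trace_def matrix_matrix_mult_def transpose_def
  by (simp add: mult.commute, subst sum.swap, rule refl)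

lemma mat_Re_Im_sym: "s \<in> sym_mat \<Longrightarrow> mat_Re s \<in> sym_mat" "s \<in> sym_mat \<Longrightarrow> mat_Im s \<in> sym_mat"
  by (auto simp: sym_mat_def vec_eq_iff transpose_def map_matrix_def)

text \<open>The complex form is expressed by the real bilinear form of \<open>A\<close>, so that all properties of the real
  operator carry over.\<close>

lemma ddot_complex_ext:
  "ddot (complex_ext A s) (mat_cnj e) = Complex
    (A (mat_Re s) \<bullet> mat_Re e + A (mat_Im s) \<bullet> mat_Im e) (A (mat_Im s) \<bullet> mat_Re e - A (mat_Re s) \<bullet> mat_Im e)"
  by (rule complex_eqI)
    (simp_all add: ddot_eq_sum complex_ext_def inner_vec_def map_matrix_def sum.distrib sum_subtractf)

lemma norm_matrix_eq: "(norm (e :: complex^3^3))\<^sup>2 = mat_Re e \<bullet> mat_Re e + mat_Im e \<bullet> mat_Im e"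
  unfolding power2_norm_eq_inner inner_vec_def
  by (simp add: map_matrix_def inner_complex_def sum.distrib)

lemma linear_mat_Re: "linear mat_Re" and linear_mat_Im: "linear mat_Im" and linear_mat_cnj: "linear mat_cnj"
  by (auto intro!: linearI simp: map_matrix_def vec_eq_iff)

context elasticity_operator
begin

lemma form_nonneg: "s \<in> sym_mat \<Longrightarrow> 0 \<le> Re (ddot (complex_ext A s) (mat_cnj s))"
  unfolding ddot_complex_ext by (simp add: A_nonneg mat_Re_Im_sym)

lemma form_real: "s \<in> sym_mat \<Longrightarrow> Im (ddot (complex_ext A s) (mat_cnj s)) = 0"
  unfolding ddot_complex_ext
  using A_selfadjoint[of "mat_Im s" "mat_Re s"] by (simp add: mat_Re_Im_sym inner_commute)

lemma form_definite:
  assumes "s \<in> sym_mat" "Re (ddot (complex_ext A s) (mat_cnj s)) = 0"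
  shows "s = 0"
proof -
  have "A (mat_Re s) \<bullet> mat_Re s = 0" "A (mat_Im s) \<bullet> mat_Im s = 0"
    using assms(2) A_nonneg[OF mat_Re_Im_sym(1)[OF assms(1)]] A_nonneg[OF mat_Re_Im_sym(2)[OF assms(1)]]
    unfolding ddot_complex_ext by auto
  then have "mat_Re s = 0" "mat_Im s = 0"
    using A_definite mat_Re_Im_sym assms(1) by blast+
  then show ?thesis
    by (simp add: vec_eq_iff map_matrix_def complex_eq_iff)
qed

text \<open>The form of \<open>A\<close> is nonnegative at \<open>\<i> \<kappa> L s + e\<close>. Integrated, this gives the estimate that the
  Cauchy--Schwarz inequality of the form would give, without any square roots of integrals.\<close>

lemma form_cross_estimate:
  assumes s: "s \<in> sym_mat" and e: "e \<in> sym_mat"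
    and L: "\<And>\<eta>. \<eta> \<in> sym_mat \<Longrightarrow> A \<eta> \<bullet> \<eta> \<le> L * (\<eta> \<bullet> \<eta>)"
  shows "0 \<le> (\<kappa> * L)\<^sup>2 * Re (ddot (complex_ext A s) (mat_cnj s)) + L * (norm e)\<^sup>2
    + 2 * L * Re (\<i> * of_real \<kappa> * ddot (complex_ext A s) (mat_cnj e))"
proof -
  note sym = mat_Re_Im_sym[OF s] mat_Re_Im_sym[OF e]
  let ?sr = "mat_Re s" and ?si = "mat_Im s" and ?er = "mat_Re e" and ?ei = "mat_Im e"
  have sq: "0 \<le> c * c * (A p \<bullet> p) + 2 * c * (A p \<bullet> q) + A q \<bullet> q" if "p \<in> sym_mat" "q \<in> sym_mat" for c p q
  proof -
    have "A (c *\<^sub>R p + 1 *\<^sub>R q) = c *\<^sub>R A p + 1 *\<^sub>R A q" by (rule A_linear[OF that])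
    then have "0 \<le> (c *\<^sub>R A p + 1 *\<^sub>R A q) \<bullet> (c *\<^sub>R p + 1 *\<^sub>R q)"
      using A_nonneg[OF sym_combination[OF that, of c 1]] by simp
    also have "\<dots> = c * c * (A p \<bullet> p) + 2 * c * (A p \<bullet> q) + A q \<bullet> q"
      using A_selfadjoint[OF that] by (simp add: inner_simps inner_commute algebra_simps)
    finally show ?thesis .
  qed
  have "0 \<le> (\<kappa> * L) * (\<kappa> * L) * (A ?sr \<bullet> ?sr) + 2 * (\<kappa> * L) * (A ?sr \<bullet> ?ei) + L * (?ei \<bullet> ?ei)"
    using sq[OF sym(1,4), of "\<kappa> * L"] L[OF sym(4)] by linarith
  moreover have "0 \<le> (\<kappa> * L) * (\<kappa> * L) * (A ?si \<bullet> ?si) - 2 * (\<kappa> * L) * (A ?si \<bullet> ?er) + L * (?er \<bullet> ?er)"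
    using sq[OF sym(2,3), of "- (\<kappa> * L)"] L[OF sym(3)] by (simp add: algebra_simps)
  ultimately show ?thesis
    unfolding ddot_complex_ext norm_matrix_eq by (simp add: power2_eq_square algebra_simps)
qed

end

section \<open>Elements lie in the domain\<close>

text \<open>At a boundary point the domain is a hypograph, so that there are exterior points arbitrarily
  close to it. Hence the closure of the domain has no other interior points than those of the
  domain.\<close>

lemma interior_closure_lipschitz:
  assumes \<Omega>: "open \<Omega>" "lipschitz_boundary \<Omega>"
  shows "interior (closure \<Omega>) \<subseteq> \<Omega>"
proof
  fix x assume x: "x \<in> interior (closure \<Omega>)"
  show "x \<in> \<Omega>"
  proof (rule ccontr)
    assume nx: "x \<notin> \<Omega>"
    have "x \<in> frontier \<Omega>"
      using x nx \<Omega>(1) interior_subset by (auto simp: frontier_def interior_open)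
    then obtain T :: "real^3 \<Rightarrow> real^3" and \<phi> :: "real \<times> real \<Rightarrow> real" and L r where
      T: "orthogonal_transformation T" and \<phi>: "L-lipschitz_on UNIV \<phi>" and r: "0 < r"
      and iff: "\<And>y. y \<in> ball x r \<Longrightarrow> y \<in> \<Omega> \<longleftrightarrow> T y $ 3 < \<phi> (T y $ 1, T y $ 2)"
      using \<Omega>(2) unfolding lipschitz_boundary_def by blast
    obtain d where d: "0 < d" "ball x d \<subseteq> closure \<Omega>"
      using x by (auto simp: mem_interior)
    define t where "t = min d r / 2"
    have t: "0 < t" "t < d" "t < r" using d(1) r by (auto simp: t_def)
    have lin: "linear T" using T by (rule orthogonal_transformation_linear)
    obtain e where e: "T e = axis 3 1"
      using orthogonal_transformation_surj[OF T] by (metis surjD)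
    then have "norm e = 1" using orthogonal_transformation_norm[OF T, of e] by (simp add: norm_axis_1)
    define y where "y = x + t *\<^sub>R e"
    have Ty: "T y = T x + t *\<^sub>R axis 3 1"
      by (simp add: y_def linear_add[OF lin] linear_cmul[OF lin] e)
    have dist: "dist x y = t" using \<open>norm e = 1\<close> t(1) by (simp add: y_def dist_norm)
    let ?U = "{z. \<phi> (T z $ 1, T z $ 2) < T z $ 3} \<inter> ball x r"
    have c\<phi>: "continuous_on UNIV \<phi>" using \<phi> by (rule lipschitz_on_continuous_on)
    have cT: "continuous_on UNIV (\<lambda>z. T z $ i)" for i
      using lin by (intro continuous_intros linear_continuous_on) (simp add: linear_conv_bounded_linear)
    have "open {z. \<phi> (T z $ 1, T z $ 2) < T z $ 3}"
      by (intro open_Collect_less continuous_on_compose2[OF c\<phi>] continuous_on_Pair cT subset_UNIV)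
    then have "open ?U" by (intro open_Int) auto
    moreover have "\<phi> (T x $ 1, T x $ 2) \<le> T x $ 3"
      using iff[of x] r nx by simp
    then have "y \<in> ?U"
      using dist t by (simp add: Ty axis_def)
    moreover have "y \<in> closure \<Omega>" using d(2) dist t by auto
    ultimately obtain z where "z \<in> ?U" "z \<in> \<Omega>"
      using open_Int_closure_eq_empty[of ?U \<Omega>] by blast
    then show False using iff[of z] by auto
  qed
qed

text \<open>An element lies in the closure of the open domain and may leave the domain itself, but only in a
  null set.\<close>

lemma AE_lebesgue_on_transfer:
  assumes P: "AE x in lebesgue_on \<Omega>. P x" and \<Omega>: "\<Omega> \<in> sets lebesgue" and K: "K \<in> sets lebesgue"
    and null: "negligible (K - \<Omega>)"
  shows "AE x in lebesgue_on K. P x"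
proof -
  have "AE x in lebesgue. x \<in> \<Omega> \<longrightarrow> P x"
    using P \<Omega> by (subst (asm) AE_restrict_space_iff) auto
  moreover have "AE x in lebesgue. x \<notin> K - \<Omega>"
    using null by (intro AE_not_in) (simp add: negligible_iff_null_sets)
  ultimately have "AE x in lebesgue. x \<in> K \<longrightarrow> P x"
    by eventually_elim blast
  then show ?thesis
    using K by (subst AE_restrict_space_iff) auto
qed

lemma measurable_lebesgue_on_transfer:
  fixes f :: "'a::euclidean_space \<Rightarrow> real"
  assumes f: "f \<in> borel_measurable (lebesgue_on \<Omega>)" and \<Omega>: "\<Omega> \<in> sets lebesgue" and K: "K \<in> sets lebesgue"
    and null: "negligible (K - \<Omega>)"
  shows "f \<in> borel_measurable (lebesgue_on K)"
proof (rule complete_measure.borel_measurable_AE_cong[OF complete_lebesgue_on[OF K]])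
  have "(\<lambda>x. if x \<in> \<Omega> then f x else 0) \<in> borel_measurable lebesgue"
    using f \<Omega> by (simp add: borel_measurable_if)
  then show "(\<lambda>x. if x \<in> \<Omega> then f x else 0) \<in> borel_measurable (lebesgue_on K)"
    by (rule measurable_restrict_space1)
  show "AE x in lebesgue_on K. (if x \<in> \<Omega> then f x else 0) = f x"
    by (rule AE_lebesgue_on_transfer[OF _ \<Omega> K null]) (use \<Omega> in \<open>auto simp: AE_restrict_space_iff\<close>)
qed

lemma elasticity_field_transfer:
  assumes "elasticity_field \<Omega> \<C>" and tr: "\<Omega> \<in> sets lebesgue" "K \<in> sets lebesgue" "negligible (K - \<Omega>)"
  shows "elasticity_field K \<C>"
  using assms(1) unfolding elasticity_field_def
  by (meson AE_lebesgue_on_transfer[OF _ tr] measurable_lebesgue_on_transfer[OF _ tr])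

lemma density_field_transfer:
  assumes "density_field \<Omega> \<rho>" and tr: "\<Omega> \<in> sets lebesgue" "K \<in> sets lebesgue" "negligible (K - \<Omega>)"
  shows "density_field K \<rho>"
  using assms(1) unfolding density_field_def
  by (meson AE_lebesgue_on_transfer[OF _ tr] measurable_lebesgue_on_transfer[OF _ tr])

section \<open>Integration by parts on an element\<close>

lemma poly_on_values:
  assumes "subspace V" "p \<in> poly_on k UNIV V"
  shows "p x \<in> V"
proof -
  obtain c where c: "\<forall>\<alpha>. c \<alpha> \<in> V"
    "\<forall>x\<in>UNIV. p x = (\<Sum>\<alpha> | (\<Sum>i\<in>UNIV. \<alpha> i) \<le> k. (\<Prod>i\<in>UNIV. (x $ i) ^ \<alpha> i) *\<^sub>R c \<alpha>)"
    using assms(2) unfolding poly_on_def mem_Collect_eq by (elim exE conjE)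
  then show ?thesis
    using assms(1) by (simp add: subspace_sum subspace_scale)
qed

lemma C1_poly:
  fixes p :: "real^3 \<Rightarrow> 'b::real_normed_vector"
  assumes "p \<in> poly_on k UNIV V"
  shows "C1 p (\<lambda>x. frechet_derivative p (at x))"
proof -
  have "p \<in> poly_on k UNIV UNIV" using assms unfolding poly_on_def by blast
  then show ?thesis by (intro smooth_imp_C1 smooth_poly)
qed

lemma continuous_on_pd_poly:
  fixes p :: "real^3 \<Rightarrow> 'b::real_normed_vector"
  assumes "p \<in> poly_on k UNIV V"
  shows "continuous_on A (pd j p)"
proof -
  have "p \<in> poly_on k UNIV UNIV" using assms unfolding poly_on_def by blast
  then show ?thesis using pd_poly[OF subspace_UNIV] continuous_on_poly by blast
qed

lemma pd_linear:
  assumes "bounded_linear L" "f differentiable (at x)"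
  shows "pd j (\<lambda>x. L (f x)) x = L (pd j f x)"
proof -
  have "(f has_derivative frechet_derivative f (at x)) (at x)"
    using assms(2) frechet_derivative_works by blast
  from bounded_linear.has_derivative[OF assms(1) this] show ?thesis
    by (subst pd_eqI) (auto simp: pd_def)
qed

lemma pd_cong_interior:
  assumes eq: "\<And>x. x \<in> K \<Longrightarrow> f x = g x" and x: "x \<in> interior K" and g: "g differentiable (at x)"
  shows "pd j f x = pd j g x"
proof -
  have D: "(g has_derivative frechet_derivative g (at x)) (at x)"
    using g frechet_derivative_works by blast
  then have "(f has_derivative frechet_derivative g (at x)) (at x)"
    by (rule has_derivative_transform_within_open[of _ _ _ UNIV "interior K"])
      (use x eq[OF subsetD[OF interior_subset]] in auto)
  from pd_eqI[OF this, of j] show ?thesis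
    unfolding pd_def[of j g] .
qed

lemma bounded_linear_component: "bounded_linear (\<lambda>v :: complex^3. v $ i)"
  "bounded_linear (\<lambda>m :: complex^3^3. m $ i $ j)"
  by (auto intro: bounded_linear_vec_nth bounded_linear_compose[OF bounded_linear_vec_nth bounded_linear_vec_nth])

lemma continuous_on_row_div_poly:
  assumes "\<xi> \<in> poly_on k UNIV V"
  shows "continuous_on A (row_div \<xi>)"
  unfolding row_div_def
  by (intro continuous_on_vec_lambda continuous_on_sum
      bounded_linear.continuous_on[OF bounded_linear_component(2)] continuous_on_pd_poly[OF assms])

context tetrahedron
begin

lemma K_lebesgue: "K \<in> sets lebesgue"
  using compact_K by (auto intro: fmeasurableD lmeasurable_compact)

lemma integrable_K:
  fixes f :: "real^3 \<Rightarrow> 'b::euclidean_space"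
  assumes "continuous_on UNIV f"
  shows "integrable (lebesgue_on K) f"
  by (rule integrable_lebesgue_on_compact[OF compact_K continuous_on_subset[OF assms subset_UNIV]])

lemma facet_disjoint_interior: "F facet_of K \<Longrightarrow> x \<in> F \<Longrightarrow> x \<notin> interior K"
  using face_of_disjoint_interior[of F K] by (cases "F = K") (auto simp: facet_of_def)

text \<open>The divergence theorem is applied to the products \<open>p\<^sub>i \<xi>\<^sub>i\<^sub>j\<close>. The boundary term involves \<open>\<xi>\<close>
  through its normal component, which on each face is a polynomial of the same degree because the
  normal is constant there.\<close>

lemma green_formula:
  assumes \<xi>: "\<xi> \<in> poly_on k UNIV UNIV" and p: "p \<in> poly_on l UNIV UNIV"
  shows "\<exists>\<mu>\<in>face_poly k K. ipv K p (row_div \<xi>) + ipm K (grad p) \<xi> = ip_bd K p \<mu>"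
proof -
  obtain N :: "(real^3) set \<Rightarrow> real^3" where N: "\<forall>(f :: real^3 \<Rightarrow> complex) f'. C1 f f' \<longrightarrow>
    (\<forall>j. (LINT x|lebesgue_on K. f' x (axis j 1))
      = (\<Sum>F | F facet_of K. N F $ j *\<^sub>R (LINT x|surface_measure F. f x)))"
    using divergence_theorem_tetrahedron[OF vertices, where 'b = complex] ..
  define n where "n F x = (\<chi> i. \<Sum>j\<in>UNIV. N F $ j *\<^sub>R \<xi> x $ i $ j)" for F x
  obtain \<mu> where \<mu>: "\<forall>F. F facet_of K \<longrightarrow> (AE x in surface_measure F. \<mu> x = n F x)"
    using glue_faces[of n] ..
  have n_poly: "n F \<in> poly_on k UNIV UNIV" for F
    unfolding n_def
    by (rule poly_on_linear[OF _ _ \<xi>])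
      (auto intro!: linearI simp: vec_eq_iff sum.distrib scaleR_sum_right algebra_simps)
  have \<mu>_poly: "\<mu> \<in> face_poly k K"
    using \<mu> n_poly by (intro face_polyI) blast
  note cp = continuous_on_poly[OF p] and c\<xi> = continuous_on_poly[OF \<xi>]
  note cpd = continuous_on_pd_poly[OF p] and c\<xi>d = continuous_on_pd_poly[OF \<xi>]
  have cc: "continuous_on UNIV (\<lambda>x. p x $ i)" "continuous_on UNIV (\<lambda>x. \<xi> x $ i $ j)"
    "continuous_on UNIV (\<lambda>x. pd j p x $ i)" "continuous_on UNIV (\<lambda>x. pd j \<xi> x $ i $ j)" for i j
    by (intro bounded_linear.continuous_on[OF bounded_linear_component(1)]
        bounded_linear.continuous_on[OF bounded_linear_component(2)] cp c\<xi> cpd c\<xi>d)+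
  have part: "(LINT x|lebesgue_on K. p x $ i * pd j \<xi> x $ i $ j + pd j p x $ i * \<xi> x $ i $ j)
      = (\<Sum>F | F facet_of K. N F $ j *\<^sub>R (LINT x|surface_measure F. p x $ i * \<xi> x $ i $ j))" for i j
  proof -
    have "C1 (\<lambda>x. p x $ i * \<xi> x $ i $ j) (\<lambda>x e. p x $ i * frechet_derivative \<xi> (at x) e $ i $ j
        + frechet_derivative p (at x) e $ i * \<xi> x $ i $ j)"
      by (intro C1_bounded_bilinear[OF bounded_bilinear_mult]
          C1_bounded_linear[OF bounded_linear_component(1)] C1_bounded_linear[OF bounded_linear_component(2)]
          C1_poly[OF p] C1_poly[OF \<xi>])
    from N[rule_format, OF this, of j] show ?thesis by (simp add: pd_def)
  qed
  have "ipv K p (row_div \<xi>) + ipm K (grad p) \<xi>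
      = (LINT x|lebesgue_on K. bdot (p x) (row_div \<xi> x) + ddot (grad p x) (\<xi> x))"
    unfolding ipv_def ipm_def bdot_def ddot_eq_sum row_div_def grad_def vec_lambda_beta
    by (intro Bochner_Integration.integral_add[symmetric] integrable_K continuous_intros cc)
  also have "\<dots> = (LINT x|lebesgue_on K. (\<Sum>i\<in>UNIV. \<Sum>j\<in>UNIV. p x $ i * pd j \<xi> x $ i $ j + pd j p x $ i * \<xi> x $ i $ j))"
    by (simp add: bdot_def ddot_eq_sum row_div_def grad_def sum.distrib sum_distrib_left)
  also have "\<dots> = (\<Sum>i\<in>UNIV. \<Sum>j\<in>UNIV. LINT x|lebesgue_on K. p x $ i * pd j \<xi> x $ i $ j + pd j p x $ i * \<xi> x $ i $ j)"
    by (subst Bochner_Integration.integral_sum, intro integrable_K continuous_intros cc)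
      (intro sum.cong refl Bochner_Integration.integral_sum integrable_K continuous_intros cc)
  also have "\<dots> = (\<Sum>i\<in>UNIV. \<Sum>F | F facet_of K. \<Sum>j\<in>UNIV. N F $ j *\<^sub>R (LINT x|surface_measure F. p x $ i * \<xi> x $ i $ j))"
    unfolding part by (intro sum.cong refl sum.swap)
  also have "\<dots> = (\<Sum>F | F facet_of K. \<Sum>i\<in>UNIV. \<Sum>j\<in>UNIV. N F $ j *\<^sub>R (LINT x|surface_measure F. p x $ i * \<xi> x $ i $ j))"
    by (rule sum.swap)
  also have "\<dots> = (\<Sum>F | F facet_of K. LINT x|surface_measure F. bdot (p x) (\<mu> x))"
  proof (rule sum.cong[OF refl])
    fix F assume "F \<in> {F. F facet_of K}"
    then have F: "F facet_of K" by simp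
    note int = integrable_continuous_face[OF F]
    have "(\<Sum>i\<in>UNIV. \<Sum>j\<in>UNIV. N F $ j *\<^sub>R (LINT x|surface_measure F. p x $ i * \<xi> x $ i $ j))
        = (\<Sum>i\<in>UNIV. \<Sum>j\<in>UNIV. LINT x|surface_measure F. N F $ j *\<^sub>R (p x $ i * \<xi> x $ i $ j))"
      by simp
    also have "\<dots> = (LINT x|surface_measure F. (\<Sum>i\<in>UNIV. \<Sum>j\<in>UNIV. N F $ j *\<^sub>R (p x $ i * \<xi> x $ i $ j)))"
      by (subst Bochner_Integration.integral_sum, intro int continuous_intros cc)
        (intro sum.cong refl Bochner_Integration.integral_sum[symmetric] int continuous_intros cc)
    also have "\<dots> = (LINT x|surface_measure F. bdot (p x) (n F x))"
      by (simp add: bdot_def n_def sum_distrib_left)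
    also have "\<dots> = (LINT x|surface_measure F. bdot (p x) (\<mu> x))"
    proof (rule AE_eq_imp_integral_eq(2)[OF complete_face[OF F]])
      show "integrable (surface_measure F) (\<lambda>x. bdot (p x) (n F x))"
        using continuous_on_compose2[OF continuous_on_bdot continuous_on_Pair[OF cp continuous_on_poly[OF n_poly]]]
        by (intro int) simp
      show "AE x in surface_measure F. bdot (p x) (n F x) = bdot (p x) (\<mu> x)"
        using \<mu>[rule_format, OF F] by eventually_elim simp
    qed
    finally show "(\<Sum>i\<in>UNIV. \<Sum>j\<in>UNIV. N F $ j *\<^sub>R (LINT x|surface_measure F. p x $ i * \<xi> x $ i $ j))
        = (LINT x|surface_measure F. bdot (p x) (\<mu> x))" .
  qed
  finally have "ipv K p (row_div \<xi>) + ipm K (grad p) \<xi> = ip_bd K p \<mu>"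
    by (simp add: ip_bd_def)
  then show ?thesis using \<mu>_poly ..
qed

lemma L2_K:
  fixes f :: "real^3 \<Rightarrow> 'b::euclidean_space"
  assumes "continuous_on UNIV f"
  shows "L2 (lebesgue_on K) f"
  unfolding L2_def using assms
  by (auto intro!: integrable_K borel_measurable_integrable[OF integrable_K] continuous_intros)

text \<open>The classical gradient is the distributional one: a test function vanishes on the faces, so
  the divergence theorem has no boundary terms.\<close>

lemma H1_poly:
  assumes p: "p \<in> poly_on l UNIV UNIV"
  shows "H1 K p (grad p)"
  unfolding H1_def
proof (intro conjI allI impI)
  note cc = bounded_linear.continuous_on[OF bounded_linear_component(1)]
  have cgrad: "continuous_on UNIV (grad p)"
    unfolding grad_def by (intro continuous_on_vec_lambda cc continuous_on_pd_poly[OF p])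
  show "L2 (lebesgue_on K) p" "L2 (lebesgue_on K) (grad p)"
    by (intro L2_K continuous_on_poly[OF p] cgrad)+
  fix \<phi> :: "real^3 \<Rightarrow> real" and i j
  assume \<phi>: "smooth \<phi>" and supp: "closure {x. \<phi> x \<noteq> 0} \<subseteq> interior K"
  obtain N :: "(real^3) set \<Rightarrow> real^3" where N: "\<forall>(f :: real^3 \<Rightarrow> complex) f'. C1 f f' \<longrightarrow>
    (\<forall>j. (LINT x|lebesgue_on K. f' x (axis j 1))
      = (\<Sum>F | F facet_of K. N F $ j *\<^sub>R (LINT x|surface_measure F. f x)))"
    using divergence_theorem_tetrahedron[OF vertices, where 'b = complex] ..
  have C1: "C1 (\<lambda>x. \<phi> x *\<^sub>R p x $ i) (\<lambda>x e. \<phi> x *\<^sub>R frechet_derivative p (at x) e $ i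
      + frechet_derivative \<phi> (at x) e *\<^sub>R p x $ i)"
    by (intro C1_bounded_bilinear[OF bounded_bilinear_scaleR] smooth_imp_C1[OF \<phi>]
        C1_bounded_linear[OF bounded_linear_component(1)] C1_poly[OF p])
  have "(LINT x|surface_measure F. \<phi> x *\<^sub>R p x $ i) = 0" if F: "F facet_of K" for F
  proof (rule integral_eq_zero_AE)
    show "AE x in surface_measure F. \<phi> x *\<^sub>R p x $ i = 0"
      using AE_in_face[OF F]
    proof eventually_elim
      case (elim x)
      then have "x \<notin> closure {x. \<phi> x \<noteq> 0}"
        using supp facet_disjoint_interior[OF F] by blast
      then have "x \<notin> {x. \<phi> x \<noteq> 0}" using closure_subset[of "{x. \<phi> x \<noteq> 0}"] by blast
      then have "\<phi> x = 0" by simp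
      then show ?case by simp
    qed
  qed
  then have "(LINT x|lebesgue_on K. \<phi> x *\<^sub>R pd j p x $ i + pd j \<phi> x *\<^sub>R p x $ i) = 0"
    using N[rule_format, OF C1, of j] by (simp add: pd_def)
  moreover have "C_diff 1 \<phi>" using \<phi> smooth_def by blast
  then have "continuous_on UNIV (pd j \<phi>)" by simp
  then have "(LINT x|lebesgue_on K. \<phi> x *\<^sub>R pd j p x $ i + pd j \<phi> x *\<^sub>R p x $ i)
      = (LINT x|lebesgue_on K. \<phi> x *\<^sub>R pd j p x $ i) + (LINT x|lebesgue_on K. pd j \<phi> x *\<^sub>R p x $ i)"
    by (intro Bochner_Integration.integral_add integrable_K continuous_on_scaleR cc
        continuous_on_pd_poly[OF p] continuous_on_poly[OF p] C1_imp_continuous[OF smooth_imp_C1[OF \<phi>]])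
  ultimately show "(LINT x|lebesgue_on K. pd j \<phi> x *\<^sub>R p x $ i) = - (LINT x|lebesgue_on K. \<phi> x *\<^sub>R grad p x $ i $ j)"
    by (simp add: grad_def eq_neg_iff_add_eq_0 add.commute)
qed

text \<open>A polynomial is smooth, so a constant sequence approximates it.\<close>

lemma H1_trace_poly:
  assumes p: "p \<in> poly_on l UNIV UNIV"
  shows "H1_trace K p (grad p) p"
  unfolding H1_trace_def
proof (intro conjI exI[of _ "\<lambda>_. p"])
  show "L2_bd K p"
    by (rule face_continuous_imp_L2_bd[OF continuous_on_imp_face_continuous[OF continuous_on_poly[OF p]]]) simp
qed (simp_all add: smooth_poly[OF p] L2_norm_on_def L2_norm_bd_def)

lemma ip_bd_cong_K:
  assumes p: "continuous_on UNIV p" and eq: "\<And>x. x \<in> K \<Longrightarrow> u x = p x" and \<mu>: "face_continuous \<mu>"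
  shows "ip_bd K u \<mu> = ip_bd K p \<mu>"
  unfolding ip_bd_def
proof (rule sum.cong[OF refl])
  fix F assume "F \<in> {F. F facet_of K}"
  then have F: "F facet_of K" by simp
  have "AE x in surface_measure F. bdot (p x) (\<mu> x) = bdot (u x) (\<mu> x)"
    using AE_in_face[OF F]
  proof eventually_elim
    case (elim x)
    then have "x \<in> K" using facet_of_imp_subset[OF F] by blast
    then show ?case using eq by simp
  qed
  moreover have "integrable (surface_measure F) (\<lambda>x. bdot (p x) (\<mu> x))"
    by (intro integrable_bdot_face continuous_on_imp_face_continuous[OF p] \<mu> F refl)
  ultimately show "(LINT x|surface_measure F. bdot (u x) (\<mu> x)) = (LINT x|surface_measure F. bdot (p x) (\<mu> x))"
    using AE_eq_imp_integral_eq(2)[OF complete_face[OF F]] by fastforce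
qed

lemma L2_norm_bd_eq_0_imp_AE:
  assumes g: "face_continuous g" and 0: "L2_norm_bd K g = 0" and F: "F facet_of K"
  shows "AE x in surface_measure F. g x = 0"
proof -
  have int: "integrable (surface_measure F) (\<lambda>x. (norm (g x))\<^sup>2)" if "F facet_of K" for F
    using face_continuous_imp_L2_bd[OF g] that unfolding L2_bd_def L2_def by blast
  have "(\<Sum>F | F facet_of K. LINT x|surface_measure F. (norm (g x))\<^sup>2) = 0"
    using 0 by (simp add: L2_norm_bd_def)
  then have "(LINT x|surface_measure F. (norm (g x))\<^sup>2) = 0"
    using F finite_facets by (subst (asm) sum_nonneg_eq_0_iff) auto
  then show ?thesis
    using integral_nonneg_eq_0_iff_AE[OF int[OF F]] by simp
qed

lemma ip_bd_eq_0:
  assumes "\<And>F. F facet_of K \<Longrightarrow> AE x in surface_measure F. a x = 0"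
  shows "ip_bd K a b = 0"
  unfolding ip_bd_def
proof (rule sum.neutral, rule ballI)
  fix F assume "F \<in> {F. F facet_of K}"
  then have "AE x in surface_measure F. a x = 0" using assms by blast
  then have "AE x in surface_measure F. bdot (a x) (b x) = 0"
    by eventually_elim (simp add: bdot_def)
  then show "(LINT x|surface_measure F. bdot (a x) (b x)) = 0"
    by (rule integral_eq_zero_AE)
qed

lemma interior_K_nonempty: "interior K \<noteq> {}"
proof -
  have ind: "\<not> affine_dependent S" and c: "card S = 4"
    using vertices by (simp_all add: tetrahedron_vertices_def)
  have "aff_dim K = 3"
    using aff_dim_affine_independent[OF ind] c by (simp add: aff_dim_convex_hull)
  then have "rel_interior K = interior K" by (intro interior_rel_interior) simp
  moreover have "K \<noteq> {}" using c by auto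
  ultimately show ?thesis using rel_interior_eq_empty[of K] by simp
qed

lemma K_subset_closure_interior: "K \<subseteq> closure (interior K)"
  using convex_closure_interior[of K] interior_K_nonempty closure_subset[of K] by simp

lemma diameter_K_pos: "0 < diameter K"
proof -
  have "card S = 4" using vertices by (simp add: tetrahedron_vertices_def)
  then have "\<not> card S \<le> 1" by simp
  then obtain a b where ab: "a \<in> S" "b \<in> S" "a \<noteq> b"
    by (metis One_nat_def card_le_Suc0_iff_eq card.infinite le0)
  then have "dist a b \<le> diameter K"
    using diameter_bounded_bound[OF compact_imp_bounded[OF compact_K]] by (simp add: hull_inc)
  then show ?thesis using ab(3) by (smt (verit) zero_less_dist_iff)
qed

lemma AE_K_imp_exists:
  assumes P: "AE x in lebesgue_on K. P x" and U: "open U" "U \<subseteq> K" "U \<noteq> {}"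
  shows "\<exists>x\<in>U. P x"
proof (rule ccontr)
  assume n: "\<not> (\<exists>x\<in>U. P x)"
  have "AE x in lebesgue. x \<in> K \<longrightarrow> P x"
    using P K_lebesgue by (subst (asm) AE_restrict_space_iff) auto
  then have "AE x in lebesgue. x \<notin> U"
    by eventually_elim (use n U in blast)
  moreover have "U \<in> sets lebesgue" using U(1) by (simp add: borel_open)
  ultimately have "negligible U"
    by (simp add: negligible_iff_null_sets AE_iff_null_sets)
  then show False using open_not_negligible U by blast
qed

text \<open>The zero set meets every nonempty open subset of \<open>K\<close>, and \<open>K\<close> is the closure of its interior.\<close>

lemma continuous_AE_zero_imp_zero:
  fixes f :: "real^3 \<Rightarrow> 'b::euclidean_space"
  assumes f: "continuous_on UNIV f" and 0: "AE x in lebesgue_on K. f x = 0" and x: "x \<in> K"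
  shows "f x = 0"
proof -
  have "f y = 0" if "y \<in> interior K" for y
  proof (rule ccontr)
    assume "f y \<noteq> 0"
    moreover have "open {z. f z \<noteq> 0}" by (intro open_Collect_neq f continuous_on_const)
    ultimately have "\<exists>z\<in>interior K \<inter> {z. f z \<noteq> 0}. f z = 0"
      using that interior_subset by (intro AE_K_imp_exists[OF 0]) auto
    then show False by blast
  qed
  then have "interior K \<subseteq> {z. f z = 0}" by blast
  moreover have "closed {z. f z = 0}" by (intro closed_Collect_eq f continuous_on_const)
  ultimately have "closure (interior K) \<subseteq> {z. f z = 0}" by (rule closure_minimal)
  then show ?thesis using K_subset_closure_interior x by blast
qed

text \<open>For a function that is not measurable or not essentially bounded the essential supremum is infinite
  and the norm is \<open>0\<close> by convention. So a nonzero norm is a genuine bound.\<close>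

lemma AE_le_Linf_norm:
  assumes "Linf_norm_on K f \<noteq> 0"
  shows "AE x in lebesgue_on K. \<bar>f x\<bar> \<le> Linf_norm_on K f" "0 < Linf_norm_on K f"
proof -
  let ?e = "esssup (lebesgue_on K) (\<lambda>x. ereal \<bar>f x\<bar>)"
  have "ereal (Linf_norm_on K f) = ?e"
    using assms unfolding Linf_norm_on_def by (cases ?e) auto
  moreover have "AE x in lebesgue_on K. ereal \<bar>f x\<bar> \<le> ?e" by (rule esssup_AE)
  ultimately show *: "AE x in lebesgue_on K. \<bar>f x\<bar> \<le> Linf_norm_on K f"
    by (metis (no_types, lifting) ereal_less_eq(3) eventually_mono)
  obtain x where "\<bar>f x\<bar> \<le> Linf_norm_on K f"
    using AE_K_imp_exists[OF *, of "interior K"] interior_K_nonempty interior_subset by auto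
  then show "0 < Linf_norm_on K f" using assms by linarith
qed

end

section \<open>The local solver\<close>

lemma ddot_sym_part:
  assumes "\<zeta> \<in> sym_mat"
  shows "ddot (sym_part G) \<zeta> = ddot G \<zeta>"
proof -
  have half: "sym_part G $ i $ j = (G $ i $ j + transpose G $ i $ j) / 2" for i j
    by (simp add: sym_part_def complex_eq_iff)
  have "\<zeta> $ i $ j = \<zeta> $ j $ i" for i j
    using assms by (auto simp: sym_mat_def vec_eq_iff transpose_def)
  then have "ddot (transpose G) \<zeta> = ddot G \<zeta>"
    by (subst ddot_eq_sum, subst sum.swap) (simp add: ddot_eq_sum transpose_def)
  moreover have "ddot (sym_part G) \<zeta> = (ddot G \<zeta> + ddot (transpose G) \<zeta>) / 2"
    by (simp add: ddot_eq_sum half sum.distrib[symmetric] sum_divide_distrib algebra_simps)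
  ultimately show ?thesis by simp
qed

lemma ddot_mat_cnj: "ddot e (mat_cnj e) = of_real ((norm e)\<^sup>2)"
  unfolding norm_matrix_eq
  by (rule complex_eqI) (simp_all add: ddot_eq_sum map_matrix_def inner_vec_def sum.distrib algebra_simps)

lemma bdot_conj_vec: "bdot v (conj_vec v) = of_real ((norm v)\<^sup>2)"
  unfolding power2_norm_eq_inner
  by (rule complex_eqI) (simp_all add: bdot_def conj_vec_def inner_vec_def inner_complex_def algebra_simps)

lemma mat_cnj_in_sym_mat: "s \<in> sym_mat \<Longrightarrow> mat_cnj s \<in> sym_mat"
  by (auto simp: sym_mat_def vec_eq_iff transpose_def map_matrix_def)

lemma ipv_conj: "ipv K (\<lambda>x. conj_vec (u x)) (\<lambda>x. conj_vec (v x)) = cnj (ipv K u v)"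
proof -
  have "bdot (conj_vec a) (conj_vec b) = cnj (bdot a b)" for a b
    by (simp add: bdot_def conj_vec_def)
  then show ?thesis by (simp add: ipv_def)
qed

lemma ipv_commute: "ipv K u v = ipv K v u"
  by (simp add: ipv_def bdot_def mult.commute)

lemma L2_norm_on_square: "(L2_norm_on K f)\<^sup>2 = (LINT x|lebesgue_on K. (norm (f x))\<^sup>2)"
  by (simp add: L2_norm_on_def integral_nonneg_AE)

lemma L2_norm_on_nonneg: "0 \<le> L2_norm_on K f"
  by (simp add: L2_norm_on_def integral_nonneg_AE)

lemma bounded_linear_mat_cnj: "bounded_linear mat_cnj"
  using linear_mat_cnj by (simp add: linear_conv_bounded_linear)

lemma row_div_mat_cnj:
  assumes "\<xi> \<in> poly_on k UNIV UNIV"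
  shows "row_div (\<lambda>x. mat_cnj (\<xi> x)) = (\<lambda>x. conj_vec (row_div \<xi> x))"
  unfolding fun_eq_iff row_div_def pd_linear[OF bounded_linear_mat_cnj differentiable_poly[OF subspace_UNIV assms]]
  by (simp add: conj_vec_def map_matrix_def vec_eq_iff)

context tetrahedron
begin

lemma integrable_complex_form:
  assumes \<C>: "elasticity_field K \<C>"
    and s: "s \<in> poly_on k UNIV sym_mat" and e: "e \<in> poly_on k UNIV sym_mat"
  shows "integrable (lebesgue_on K) (\<lambda>x. ddot (complex_ext (compliance \<C> x) (s x)) (mat_cnj (e x)))"
proof -
  have re: "continuous_on UNIV (\<lambda>x. mat_Re (f x))" "continuous_on UNIV (\<lambda>x. mat_Im (f x))"
    "\<And>x. mat_Re (f x) \<in> sym_mat" "\<And>x. mat_Im (f x) \<in> sym_mat"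
    if "f \<in> poly_on k UNIV sym_mat" for f
    using continuous_on_poly[OF that] linear_mat_Re linear_mat_Im
      mat_Re_Im_sym[OF poly_on_values[OF subspace_sym_mat that]]
    by (auto simp: linear_conv_bounded_linear intro: bounded_linear.continuous_on)
  show ?thesis
    unfolding ddot_complex_ext Complex_eq
    by (intro Bochner_Integration.integrable_add integrable_mult_right integrable_of_real
        Bochner_Integration.integrable_diff integrable_compliance[OF compact_K \<C>] re[OF s] re[OF e])
qed

text \<open>In the proof the solution is replaced by polynomials \<open>s\<close> and \<open>p\<close> on the whole space, which have
  classical derivatives everywhere and agree with \<open>\<sigma>\<close> and \<open>u\<close> on \<open>K\<close>.\<close>

theorem local_solver_unique:
  assumes \<C>: "elasticity_field K \<C>" and \<rho>: "density_field K \<rho>"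
    and stab: "0 < c\<^sub>\<tau>" "stabilization K \<tau> c\<^sub>\<tau> c\<^sub>\<tau>'"
    and \<kappa>: "0 < \<kappa>" and C: "0 < C"
    and korn: "\<And>v G g. H1 K v G \<Longrightarrow> H1_trace K v G g \<Longrightarrow>
        (\<forall>\<mu>\<in>face_poly 0 K. ip_bd K g \<mu> = 0) \<Longrightarrow>
        L2_norm_on K v \<le> C * diameter K * L2_norm_on K (\<lambda>x. sym_part (G x))"
    and small: "\<kappa> * diameter K
        < 1 / (C * sqrt (Linf_norm_on K (c_A \<C>)) * sqrt (Linf_norm_on K \<rho>))"
    and \<sigma>: "\<sigma> \<in> poly_on k K sym_mat"
    and u: "u \<in> poly_on (k + 1) K UNIV"
    and eq1: "\<forall>\<xi>\<in>poly_on k K sym_mat.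
        \<i> * of_real \<kappa> * ipm K (\<lambda>x. complex_ext (compliance \<C> x) (\<sigma> x)) \<xi>
          - ipv K u (row_div \<xi>) = 0"
    and eq2: "\<forall>w\<in>poly_on (k + 1) K UNIV.
        ipv K (row_div \<sigma>) w + ip_bd K (mat_app \<tau> (proj_M k K u)) w
          + \<i> * of_real \<kappa> * ipv K (\<lambda>x. \<rho> x *\<^sub>R u x) w = 0"
    and x: "x \<in> K"
  shows "\<sigma> x = 0 \<and> u x = 0"
proof -
  note compl = complete_lebesgue_on[OF K_lebesgue]
  let ?L = "Linf_norm_on K (c_A \<C>)" and ?R = "Linf_norm_on K \<rho>" and ?h = "diameter K"
  have h: "0 < ?h" by (rule diameter_K_pos)
  \<comment> \<open>If a norm were \<open>0\<close>, the bound on \<open>\<kappa> h\<close> would be \<open>1 / 0 = 0\<close>.\<close>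
  have LR0: "?L \<noteq> 0" "?R \<noteq> 0"
    using small mult_pos_pos[OF \<kappa> h] by auto
  note L = AE_le_Linf_norm[OF LR0(1)] and R = AE_le_Linf_norm[OF LR0(2)]
  obtain C\<^sub>0 where op: "AE x in lebesgue_on K. elasticity_operator (\<C> x) C\<^sub>0"
    using elasticity_field_operator[OF \<C>] by blast

  obtain p where p: "p \<in> poly_on (k + 1) UNIV UNIV" and up: "\<And>x. x \<in> K \<Longrightarrow> u x = p x"
    using poly_on_extend[OF u] by blast
  obtain s where s: "s \<in> poly_on k UNIV sym_mat" and \<sigma>s: "\<And>x. x \<in> K \<Longrightarrow> \<sigma> x = s x"
    using poly_on_extend[OF \<sigma>] by blast
  have s': "s \<in> poly_on k UNIV UNIV" using s unfolding poly_on_def by blast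
  have s_sym: "s x \<in> sym_mat" for x by (rule poly_on_values[OF subspace_sym_mat s])
  define e where "e x = sym_part (grad p x)" for x
  have e: "e \<in> poly_on k UNIV sym_mat" unfolding e_def by (rule sym_part_grad_poly(2)[OF p])
  have e_sym: "e x \<in> sym_mat" for x by (rule poly_on_values[OF subspace_sym_mat e])
  note cp = continuous_on_poly[OF p] and cs = continuous_on_poly[OF s] and ce = continuous_on_poly[OF e]
  have fu: "face_continuous u" using cp up by (rule continuous_on_imp_face_continuous)
  define a where "a f x = ddot (complex_ext (compliance \<C> x) (s x)) (mat_cnj (f x))" for f x
  have int_ss: "integrable (lebesgue_on K) (a s)" and int_se: "integrable (lebesgue_on K) (a e)"
    unfolding a_def by (rule integrable_complex_form[OF \<C> s s], rule integrable_complex_form[OF \<C> s e])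
  have cnj_poly: "(\<lambda>x. mat_cnj (f x)) \<in> poly_on k UNIV sym_mat" if "f \<in> poly_on k UNIV sym_mat" for f
    by (rule poly_on_linear[OF linear_mat_cnj mat_cnj_in_sym_mat that])

  have eq1': "\<i> * of_real \<kappa> * (LINT x|lebesgue_on K. a f x) = ipv K p (row_div (\<lambda>x. mat_cnj (f x)))"
    if f: "f \<in> poly_on k UNIV sym_mat" for f
  proof -
    have "(\<lambda>x. mat_cnj (f x)) \<in> poly_on k K sym_mat"
      by (rule poly_on_subset[OF cnj_poly[OF f]]) auto
    moreover have "ipm K (\<lambda>x. complex_ext (compliance \<C> x) (\<sigma> x)) (\<lambda>x. mat_cnj (f x)) = (LINT x|lebesgue_on K. a f x)"
      unfolding ipm_def a_def by (rule Bochner_Integration.integral_cong) (simp_all add: \<sigma>s)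
    moreover have "ipv K u v = ipv K p v" for v
      unfolding ipv_def by (rule Bochner_Integration.integral_cong) (simp_all add: up)
    ultimately show ?thesis using eq1 by fastforce
  qed

  \<comment> \<open>the energies \<open>(A \<sigma>, cnj \<sigma>)\<close> and \<open>(\<rho> u, cnj u)\<close>, the squared norms of \<open>u\<close> and \<open>\<epsilon>(u)\<close>, and the
    stabilization term\<close>
  define S where "S = (LINT x|lebesgue_on K. Re (a s x))"
  define W where "W = (LINT x|lebesgue_on K. \<rho> x * (norm (p x))\<^sup>2)"
  define U where "U = (LINT x|lebesgue_on K. (norm (p x))\<^sup>2)"
  define E where "E = (LINT x|lebesgue_on K. (norm (e x))\<^sup>2)"
  define B where "B = ip_bd K (mat_app \<tau> (proj_M k K u)) (\<lambda>x. conj_vec (u x))"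

  have a_ss: "AE x in lebesgue_on K. of_real (Re (a s x)) = a s x"
    using op by eventually_elim
      (simp add: a_def compliance_def complex_eq_iff elasticity_operator.form_real s_sym)
  have "integrable (lebesgue_on K) (\<lambda>x. complex_of_real (Re (a s x)))"
    using integrable_Re[OF int_ss] by (rule integrable_of_real)
  from AE_eq_imp_integral_eq(2)[OF compl this a_ss]
  have S: "(LINT x|lebesgue_on K. a s x) = of_real S"
    by (simp add: S_def integral_complex_of_real)

  have w: "(\<lambda>x. conj_vec (u x)) \<in> poly_on (k + 1) K UNIV"
    by (rule poly_on_linear[OF linear_conj_vec _ u]) auto
  \<comment> \<open>the first equation, conjugated, evaluates the divergence term of the second\<close>
  have "ipv K (row_div \<sigma>) (\<lambda>x. conj_vec (u x)) = ipv K (row_div s) (\<lambda>x. conj_vec (p x))"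
  proof -
    have AE_int: "AE x in lebesgue_on K. x \<in> interior K"
    proof -
      have "K - interior K \<subseteq> frontier K"
        using closure_subset[of K] unfolding frontier_def by blast
      then have "negligible (K - interior K)"
        by (rule negligible_subset[OF negligible_convex_frontier[OF convex_convex_hull]])
      then have "AE x in lebesgue. x \<notin> K - interior K"
        by (intro AE_not_in) (simp add: negligible_iff_null_sets)
      then show ?thesis
        using K_lebesgue by (subst AE_restrict_space_iff) (auto elim: eventually_mono)
    qed
    have "AE x in lebesgue_on K. bdot (row_div s x) (conj_vec (p x)) = bdot (row_div \<sigma> x) (conj_vec (u x))"
      using AE_int
    proof eventually_elim
      case (elim x)
      have "pd j \<sigma> x = pd j s x" for j
        using \<sigma>s elim differentiable_poly[OF subspace_UNIV s'] by (rule pd_cong_interior)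
      then have "row_div \<sigma> x = row_div s x" by (simp add: row_div_def)
      moreover have "u x = p x" using up elim interior_subset by blast
      ultimately show ?case by simp
    qed
    moreover have "integrable (lebesgue_on K) (\<lambda>x. bdot (row_div s x) (conj_vec (p x)))"
      using continuous_on_compose2[OF continuous_on_bdot continuous_on_Pair[OF continuous_on_row_div_poly[OF s]
          continuous_on_compose2[OF continuous_on_conj_vec cp subset_UNIV]]]
      by (intro integrable_K) simp
    ultimately show ?thesis
      using AE_eq_imp_integral_eq(2)[OF compl] unfolding ipv_def by fastforce
  qed
  also have "\<dots> = - \<i> * of_real \<kappa> * of_real S"
  proof -
    have "ipv K (row_div s) (\<lambda>x. conj_vec (p x)) = cnj (ipv K p (\<lambda>x. conj_vec (row_div s x)))"
      by (simp add: ipv_conj[symmetric] ipv_commute conj_vec_def)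
    also have "ipv K p (\<lambda>x. conj_vec (row_div s x)) = \<i> * of_real \<kappa> * of_real S"
      using eq1'[OF s] by (simp add: S row_div_mat_cnj[OF s'])
    finally show ?thesis by simp
  qed
  moreover have "ipv K (\<lambda>x. \<rho> x *\<^sub>R u x) (\<lambda>x. conj_vec (u x)) = of_real W"
  proof -
    have "bdot (r *\<^sub>R v) (conj_vec v) = of_real (r * (norm v)\<^sup>2)" for r v
    proof -
      have "bdot (r *\<^sub>R v) (conj_vec v) = of_real r * bdot v (conj_vec v)"
        unfolding bdot_def sum_distrib_left vector_scaleR_component
        by (simp only: scaleR_conv_of_real mult.assoc)
      then show ?thesis by (simp add: bdot_conj_vec)
    qed
    then have "ipv K (\<lambda>x. \<rho> x *\<^sub>R u x) (\<lambda>x. conj_vec (u x)) = (LINT x|lebesgue_on K. of_real (\<rho> x * (norm (p x))\<^sup>2))"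
      unfolding ipv_def by (intro Bochner_Integration.integral_cong) (simp_all add: up)
    then show ?thesis by (simp only: W_def integral_complex_of_real)
  qed
  ultimately have "- \<i> * of_real \<kappa> * of_real S + B + \<i> * of_real \<kappa> * of_real W = 0"
    using bspec[OF eq2 w] by (simp add: B_def)
  then have B: "B = \<i> * of_real (\<kappa> * (S - W))"
    by (simp add: algebra_simps eq_neg_iff_add_eq_0 add_eq_0_iff2)

  let ?g = "proj_M k K u"
  have \<tau>: "\<forall>F. F facet_of K \<longrightarrow> (\<exists>T\<in>sym_mat. AE x in surface_measure F. x \<in> F \<longrightarrow> \<tau> x = T)"
    using stab(2) unfolding stabilization_def by blast
  have g: "?g \<in> face_poly k K" by (rule proj_M_in_face_poly[OF fu])
  note fg = face_poly_imp_face_continuous[OF g]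
  have "c\<^sub>\<tau> * inverse ?h * (L2_norm_bd K ?g)\<^sup>2 \<le> Re B"
    using stab(2) face_continuous_imp_L2_bd[OF fg]
    unfolding stabilization_def B_def ip_bd_stabilization_proj_M[OF fu \<tau>] by blast
  also have "Re B = 0" by (simp add: B)
  finally have "c\<^sub>\<tau> * inverse ?h * (L2_norm_bd K ?g)\<^sup>2 \<le> c\<^sub>\<tau> * inverse ?h * 0" by simp
  then have "(L2_norm_bd K ?g)\<^sup>2 \<le> 0"
    by (rule mult_left_le_imp_le[OF _ mult_pos_pos[OF stab(1) positive_imp_inverse_positive[OF h]]])
  then have g0: "L2_norm_bd K ?g = 0" by simp
  then have g_AE: "AE x in surface_measure F. ?g x = 0" if "F facet_of K" for F
    using L2_norm_bd_eq_0_imp_AE[OF fg _ that] by blast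
  have u_orth: "ip_bd K p \<mu> = 0" if \<mu>: "\<mu> \<in> face_poly k K" for \<mu>
    using ip_bd_proj_M[OF fu \<mu>] ip_bd_eq_0[OF g_AE]
      ip_bd_cong_K[OF cp up face_poly_imp_face_continuous[OF \<mu>]] by simp
  have "B = 0"
    unfolding B_def
  proof (rule ip_bd_eq_0)
    fix F assume "F facet_of K"
    from g_AE[OF this] show "AE x in surface_measure F. mat_app \<tau> ?g x = 0"
      by eventually_elim (simp add: mat_app_def)
  qed
  then have SW: "S = W" using B \<kappa> by simp

  \<comment> \<open>the first equation with test function \<open>cnj (\<epsilon>(u))\<close>, integrated by parts\<close>
  have "Re (\<i> * of_real \<kappa> * (LINT x|lebesgue_on K. a e x)) = - E"
  proof -
    have \<xi>: "(\<lambda>x. mat_cnj (e x)) \<in> poly_on k UNIV UNIV"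
      using cnj_poly[OF e] unfolding poly_on_def by blast
    obtain \<mu> where \<mu>: "\<mu> \<in> face_poly k K"
      and green: "ipv K p (row_div (\<lambda>x. mat_cnj (e x))) + ipm K (grad p) (\<lambda>x. mat_cnj (e x)) = ip_bd K p \<mu>"
      using green_formula[OF \<xi> p] by blast
    have "ipm K (grad p) (\<lambda>x. mat_cnj (e x)) = of_real E"
    proof -
      have "ddot (grad p x) (mat_cnj (e x)) = of_real ((norm (e x))\<^sup>2)" for x
        using ddot_sym_part[OF mat_cnj_in_sym_mat[OF e_sym[of x]], of "grad p x"]
        by (simp add: e_def[symmetric] ddot_mat_cnj)
      then show ?thesis by (simp only: ipm_def E_def integral_complex_of_real)
    qed
    then have "\<i> * of_real \<kappa> * (LINT x|lebesgue_on K. a e x) = - of_real E"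
      using eq1'[OF e] green u_orth[OF \<mu>] by (simp add: eq_neg_iff_add_eq_0)
    then show ?thesis by simp
  qed
  moreover have "(LINT x|lebesgue_on K. Re (\<i> * of_real \<kappa> * a e x)) = Re (\<i> * of_real \<kappa> * (LINT x|lebesgue_on K. a e x))"
    using int_se by (subst integral_Re) (auto intro!: integrable_mult_right)
  ultimately have crossE: "(LINT x|lebesgue_on K. Re (\<i> * of_real \<kappa> * a e x)) = - E" by simp

  have int_e: "integrable (lebesgue_on K) (\<lambda>x. (norm (e x))\<^sup>2)"
    by (intro integrable_K continuous_intros ce)
  have int_p: "integrable (lebesgue_on K) (\<lambda>x. (norm (p x))\<^sup>2)"
    by (intro integrable_K continuous_intros cp)
  have int_Re: "integrable (lebesgue_on K) (\<lambda>x. Re (a s x))" "integrable (lebesgue_on K) (\<lambda>x. Re (\<i> * of_real \<kappa> * a e x))"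
    using int_ss int_se by (auto intro!: integrable_Re integrable_mult_right)
  have "AE x in lebesgue_on K. 0 \<le> (\<kappa> * ?L)\<^sup>2 * Re (a s x) + ?L * (norm (e x))\<^sup>2
      + 2 * ?L * Re (\<i> * of_real \<kappa> * a e x)"
    using op L(1)
  proof eventually_elim
    case (elim x)
    interpret elasticity_operator "\<C> x" C\<^sub>0 by (rule elim(1))
    have "A \<eta> \<bullet> \<eta> \<le> ?L * (\<eta> \<bullet> \<eta>)" if "\<eta> \<in> sym_mat" for \<eta>
    proof -
      have "A \<eta> \<bullet> \<eta> \<le> c_A \<C> x * (\<eta> \<bullet> \<eta>)"
        using A_le_Greatest_eigenvalue[OF that] by (simp only: c_A_def compliance_def)
      also have "\<dots> \<le> ?L * (\<eta> \<bullet> \<eta>)"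
        using elim(2) by (intro mult_right_mono) auto
      finally show ?thesis .
    qed
    from form_cross_estimate[OF s_sym[of x] e_sym[of x] this] show ?case
      by (simp only: a_def compliance_def)
  qed
  then have "0 \<le> (LINT x|lebesgue_on K. (\<kappa> * ?L)\<^sup>2 * Re (a s x) + ?L * (norm (e x))\<^sup>2
      + 2 * ?L * Re (\<i> * of_real \<kappa> * a e x))"
    by (rule integral_nonneg_AE)
  also have "\<dots> = (\<kappa> * ?L)\<^sup>2 * (LINT x|lebesgue_on K. Re (a s x)) + ?L * (LINT x|lebesgue_on K. (norm (e x))\<^sup>2)
      + 2 * ?L * (LINT x|lebesgue_on K. Re (\<i> * of_real \<kappa> * a e x))"
    using int_Re int_e by (simp del: times_complex.sel)
  also have "\<dots> = (\<kappa> * ?L)\<^sup>2 * S + ?L * E + 2 * ?L * (- E)"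
    unfolding crossE S_def E_def ..
  finally have "?L * E \<le> ?L * (\<kappa>\<^sup>2 * ?L * S)" by (simp add: power2_eq_square algebra_simps)
  then have E_le: "E \<le> \<kappa>\<^sup>2 * ?L * S" using L(2) by simp

  have "L2_norm_on K p \<le> C * ?h * L2_norm_on K e"
  proof -
    have "\<mu> \<in> face_poly k K" if \<mu>: "\<mu> \<in> face_poly 0 K" for \<mu>
    proof (rule face_polyI)
      fix F assume "F facet_of K"
      then obtain q where q: "q \<in> poly_on 0 UNIV UNIV" "AE x in surface_measure F. \<mu> x = q x"
        by (rule face_polyE[OF \<mu>])
      show "\<exists>q\<in>poly_on k UNIV UNIV. AE x in surface_measure F. \<mu> x = q x"
        by (intro bexI[of _ q] q(2) poly_on_degree_mono[OF subspace_UNIV le0 q(1)])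
    qed
    then show ?thesis
      using korn[OF H1_poly[OF p] H1_trace_poly[OF p]] u_orth unfolding e_def by blast
  qed
  then have "(L2_norm_on K p)\<^sup>2 \<le> (C * ?h * L2_norm_on K e)\<^sup>2"
    by (intro power_mono L2_norm_on_nonneg)
  then have U_le: "U \<le> (C * ?h)\<^sup>2 * E"
    by (simp add: power_mult_distrib L2_norm_on_square U_def E_def)

  have W_le: "W \<le> ?R * U"
  proof -
    have "(LINT x|lebesgue_on K. \<rho> x * (norm (p x))\<^sup>2) \<le> (LINT x|lebesgue_on K. ?R * (norm (p x))\<^sup>2)"
    proof (rule integral_mono_AE)
      have "\<rho> \<in> borel_measurable (lebesgue_on K)" using \<rho> unfolding density_field_def by blast
      then have m: "(\<lambda>x. \<rho> x * (norm (p x))\<^sup>2) \<in> borel_measurable (lebesgue_on K)"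
        by (rule borel_measurable_times[OF _ borel_measurable_integrable[OF int_p]])
      show i: "integrable (lebesgue_on K) (\<lambda>x. ?R * (norm (p x))\<^sup>2)"
        using int_p by (rule integrable_mult_right)
      show "AE x in lebesgue_on K. \<rho> x * (norm (p x))\<^sup>2 \<le> ?R * (norm (p x))\<^sup>2"
        using R(1) by eventually_elim (auto intro!: mult_right_mono)
      have "AE x in lebesgue_on K. norm (\<rho> x * (norm (p x))\<^sup>2) \<le> norm (?R * (norm (p x))\<^sup>2)"
        using R(1) by eventually_elim (auto simp: abs_mult intro!: mult_right_mono)
      then show "integrable (lebesgue_on K) (\<lambda>x. \<rho> x * (norm (p x))\<^sup>2)"
        by (rule Bochner_Integration.integrable_bound[OF i m])
    qed
    then show ?thesis by (simp add: W_def U_def)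
  qed

  \<comment> \<open>the contraction factor of the estimate \<open>\<parallel>u\<parallel> \<le> q \<parallel>u\<parallel>\<close>\<close>
  define q where "q = \<kappa> * ?h * (C * sqrt ?L * sqrt ?R)"
  have q: "0 \<le> q" "q < 1"
    using small \<kappa> h C L(2) R(2) by (auto simp: q_def field_simps)
  have U0: "0 \<le> U" by (simp add: U_def integral_nonneg_AE)
  have "U \<le> (C * ?h)\<^sup>2 * (\<kappa>\<^sup>2 * ?L * (?R * U))"
  proof -
    have "\<kappa>\<^sup>2 * ?L * S \<le> \<kappa>\<^sup>2 * ?L * (?R * U)"
      unfolding SW using W_le L(2) by (intro mult_left_mono) auto
    then have "(C * ?h)\<^sup>2 * E \<le> (C * ?h)\<^sup>2 * (\<kappa>\<^sup>2 * ?L * (?R * U))"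
      using E_le by (intro mult_left_mono) auto
    then show ?thesis using U_le by linarith
  qed
  also have "\<dots> = q\<^sup>2 * U"
    using L(2) R(2) by (simp add: q_def power_mult_distrib)
  finally have "(1 - q\<^sup>2) * U \<le> 0" by (simp add: algebra_simps)
  moreover have "q\<^sup>2 < 1" using q by (simp add: power_less_one_iff)
  ultimately have U: "U = 0" using U0 by (simp add: mult_le_0_iff)

  have "AE x in lebesgue_on K. p x = 0"
    using U integral_nonneg_eq_0_iff_AE[OF int_p] by (simp add: U_def)
  then have p0: "p x = 0" using x by (rule continuous_AE_zero_imp_zero[OF cp])

  have a_nonneg: "AE x in lebesgue_on K. 0 \<le> Re (a s x)"
    using op by eventually_elim (simp add: a_def compliance_def elasticity_operator.form_nonneg s_sym)
  have "S \<le> 0" using SW W_le U by simp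
  moreover have "0 \<le> S" unfolding S_def by (rule integral_nonneg_AE[OF a_nonneg])
  ultimately have "AE x in lebesgue_on K. Re (a s x) = 0"
    using integral_nonneg_eq_0_iff_AE[OF int_Re(1) a_nonneg] by (simp add: S_def)
  with op have "AE x in lebesgue_on K. s x = 0"
    by eventually_elim (auto simp: a_def compliance_def intro: elasticity_operator.form_definite[OF _ s_sym])
  then have "s x = 0" using x by (rule continuous_AE_zero_imp_zero[OF cs])
  then show ?thesis using p0 up[OF x] \<sigma>s[OF x] by simp
qed

end

theorem proposition4p2:
  fixes \<Omega> K :: "(real^3) set" and \<T> :: "(real^3) set set"
    and \<C> :: "real^3 \<Rightarrow> real^3^3 \<Rightarrow> real^3^3" and \<rho> :: "real^3 \<Rightarrow> real"
    and \<tau> :: "real^3 \<Rightarrow> real^3^3"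
    and \<gamma> \<kappa> C c\<^sub>\<tau> c\<^sub>\<tau>' :: real and k :: nat
    and \<sigma> :: "real^3 \<Rightarrow> complex^3^3" and u :: "real^3 \<Rightarrow> complex^3"
  assumes domain: "lipschitz_polyhedron \<Omega>"
    and mesh: "tetrahedrization \<Omega> \<T>" "shape_regular \<gamma> \<T>"
    and element: "K \<in> \<T>"
    and elasticity: "elasticity_field \<Omega> \<C>"
    and density: "density_field \<Omega> \<rho>"
    and stab: "0 < c\<^sub>\<tau>" "0 < c\<^sub>\<tau>'" "stabilization K \<tau> c\<^sub>\<tau> c\<^sub>\<tau>'"
    and wave_number: "0 < \<kappa>"
    and C_pos: "0 < C"
    and korn: "\<And>v G g. H1 K v G \<Longrightarrow> H1_trace K v G g \<Longrightarrow>
        (\<forall>\<mu>\<in>face_poly 0 K. ip_bd K g \<mu> = 0) \<Longrightarrow>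
        L2_norm_on K v \<le> C * diameter K * L2_norm_on K (\<lambda>x. sym_part (G x))"
    and small: "\<kappa> * diameter K
        < 1 / (C * sqrt (Linf_norm_on K (c_A \<C>)) * sqrt (Linf_norm_on K \<rho>))"
    and \<sigma>: "\<sigma> \<in> poly_on k K sym_mat"
    and u: "u \<in> poly_on (k + 1) K UNIV"
    and eq1: "\<forall>\<xi>\<in>poly_on k K sym_mat.
        \<i> * of_real \<kappa> * ipm K (\<lambda>x. complex_ext (compliance \<C> x) (\<sigma> x)) \<xi>
          - ipv K u (row_div \<xi>) = 0"
    and eq2: "\<forall>w\<in>poly_on (k + 1) K UNIV.
        ipv K (row_div \<sigma>) w + ip_bd K (mat_app \<tau> (proj_M k K u)) w
          + \<i> * of_real \<kappa> * ipv K (\<lambda>x. \<rho> x *\<^sub>R u x) w = 0"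
  shows "\<forall>x\<in>K. \<sigma> x = 0 \<and> u x = 0"
proof
  fix x assume x: "x \<in> K"
  have "3 simplex K" "K \<subseteq> closure \<Omega>"
    using mesh(1) element unfolding tetrahedrization_def by blast+
  then obtain S where S: "\<not> affine_dependent S" "int (card S) = 3 + 1" and K: "K = convex hull S"
    unfolding simplex_def by blast
  interpret tetrahedron S
    using S by unfold_locales (simp add: tetrahedron_vertices_def)
  have \<Omega>: "open \<Omega>" "lipschitz_boundary \<Omega>"
    using domain unfolding lipschitz_polyhedron_def by blast+
  have "interior K \<subseteq> \<Omega>"
    using interior_mono[OF \<open>K \<subseteq> closure \<Omega>\<close>] interior_closure_lipschitz[OF \<Omega>] by blast
  then have "K - \<Omega> \<subseteq> frontier K"
    using closure_subset[of K] unfolding frontier_def by blast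
  then have null: "negligible (K - \<Omega>)"
    using negligible_convex_frontier[of K] K by (metis convex_convex_hull negligible_subset)
  have \<Omega>l: "\<Omega> \<in> sets lebesgue" using \<Omega>(1) by (simp add: borel_open)
  have Kl: "K \<in> sets lebesgue" using K_lebesgue K by simp
  show "\<sigma> x = 0 \<and> u x = 0"
    using local_solver_unique[folded K, OF elasticity_field_transfer[OF elasticity \<Omega>l Kl null]
        density_field_transfer[OF density \<Omega>l Kl null] stab(1,3) wave_number C_pos korn small \<sigma> u eq1 eq2 x] .
qed

end
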